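(* Let $K\ge 2$, $0<p_1<\dots<p_K<p_{K+1}\le 1$, and let $\{Y_i\}_{i=1}^n$ be i.i.d. Pareto with exponent $\alpha>1$ and minimum size $c>0$. Let $\bar s$ be the vector of self-normalized non-overlapping top income shares, and let $\mu_k$ and $\Sigma$ be as defined in the context. Let $r_k=\mu_k/\mu_K$, define the $(K-1)$-vector $r=(r_1,\dots,r_{K-1})^\top$ and the $(K-1)\times K$ matrix $H=\frac{1}{\mu_K}\begin{bmatrix} I_{K-1} & -r\end{bmatrix}$. Then, as $n\to\infty$, $$\sqrt{n}(\bar s-r)\xrightarrow{d} N(0,H\Sigma H^\top).$$ The variance matrix $\Omega(\alpha):=H\Sigma H^\top$ depends only on $\alpha$ (for the given $p_1,\dots,p_{K+1}$; in particular not on $c$) and is positive definite.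
   Context: Pareto with exponent $\alpha$ and minimum size $c$ means the CDF is $F(y)=1-(y/c)^{-\alpha}$ for $y\ge c$. Let $Y_{(1)}\ge\dots\ge Y_{(n)}$ denote the order statistics in decreasing order. The top income shares are $$S_k=\frac{\sum_{i=1}^{\lfloor np_k\rfloor}Y_{(i)}}{\sum_{i=1}^n Y_{(i)}},\quad k=1,\dots,K+1,$$ and $$\bar s=(\bar s_1,\dots,\bar s_{K-1})^\top=\left(\frac{S_2-S_1}{S_{K+1}-S_K},\dots,\frac{S_K-S_{K-1}}{S_{K+1}-S_K}\right)^\top.$$ Let $\xi=1/\alpha$. For $0<p<q\le 1$ put $$\mu(p,q)=c\,\frac{q^{1-\xi}-p^{1-\xi}}{1-\xi},$$ $$\sigma^2(p,q)=\frac{2c^2\xi^2}{1-\xi}\left(\frac{q^{1-2\xi}-p^{1-2\xi}}{1-2\xi}+p^{1-\xi}\frac{q^{-\xi}-p^{-\xi}}{\xi}+\frac{2p^{1-\xi}q^{1-\xi}-p^{2-2\xi}-q^{2-2\xi}}{2-2\xi}\right),$$ where $\frac{q^{1-2\xi}-p^{1-2\xi}}{1-2\xi}$ is interpreted as $\log\frac{q}{p}$ if $\xi=1/2$. Set $\mu_k=\mu(p_k,p_{k+1})$ for $k=1,\dots,K$. The $K\times K$ matrix $\Sigma$ is symmetric with $\Sigma_{kk}=\sigma^2(p_k,p_{k+1})$ and, for $j<k$, $$\Sigma_{jk}=-c^2\xi^2\frac{p_{j+1}^{1-\xi}-p_j^{1-\xi}}{1-\xi}\left(\frac{p_{k+1}^{-\xi}-p_k^{-\xi}}{\xi}+\frac{p_{k+1}^{1-\xi}-p_k^{1-\xi}}{1-\xi}\right).$$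 *)

theory Defs
  imports "HOL-Probability.Probability"
begin

subsection \<open>Vectors and matrices with positions $1, \dots, n$\<close>

text \<open>
  A linearly ordered finite index type is identified with $\{1, \dots, n\}$ by ranking its
  elements. All families below are indexed by natural numbers starting at 1, and
  \<open>vec_of\<close> and \<open>mat_of\<close> turn them into library vectors and matrices.
\<close>

definition pos :: "'n::{finite,linorder} \<Rightarrow> nat" where
  "pos i = card {j. j \<le> i}"

definition vec_of :: "(nat \<Rightarrow> real) \<Rightarrow> real ^ 'n::{finite,linorder}" where
  "vec_of x = (\<chi> i. x (pos i))"

definition mat_of ::
  "(nat \<Rightarrow> nat \<Rightarrow> real) \<Rightarrow> real ^ 'n::{finite,linorder} ^ 'm::{finite,linorder}" where
  "mat_of A = (\<chi> i j. A (pos i) (pos j))"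

definition positive_definite :: "real ^ 'n ^ 'n \<Rightarrow> bool" where
  "positive_definite A \<longleftrightarrow> transpose A = A \<and> (\<forall>x. x \<noteq> 0 \<longrightarrow> x \<bullet> (A *v x) > 0)"


subsection \<open>Probability\<close>

definition pareto_distributed :: "'a measure \<Rightarrow> real \<Rightarrow> real \<Rightarrow> ('a \<Rightarrow> real) \<Rightarrow> bool" where
  "pareto_distributed M \<alpha> c X \<longleftrightarrow>
     X \<in> borel_measurable M \<and>
     (\<forall>y\<ge>c. cdf (distr M borel X) y = 1 - (y / c) powr (- \<alpha>))"

text \<open>
  The library's weak convergence is phrased through distribution functions on the real line;
  for random vectors we test against bounded continuous functions.
\<close>

definition converges_in_distribution ::
  "'a measure \<Rightarrow> (nat \<Rightarrow> 'a \<Rightarrow> 'b::topological_space) \<Rightarrow> 'b measure \<Rightarrow> bool" where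
  "converges_in_distribution M X N \<longleftrightarrow>
     (\<forall>n. X n \<in> borel_measurable M) \<and> prob_space N \<and> sets N = sets borel \<and>
     (\<forall>f :: 'b \<Rightarrow> real. continuous_on UNIV f \<and> bounded (range f) \<longrightarrow>
        (\<lambda>n. \<integral>\<omega>. f (X n \<omega>) \<partial>M) \<longlonglongrightarrow> (\<integral>x. f x \<partial>N))"

text \<open>
  The normal law with mean \<open>m\<close> and variance matrix \<open>V\<close>, given by its Lebesgue density;
  meaningful for positive definite \<open>V\<close> only.
\<close>

definition multivariate_normal :: "real ^ 'n \<Rightarrow> real ^ 'n ^ 'n \<Rightarrow> (real ^ 'n) measure" where
  "multivariate_normal m V = density lborel (\<lambda>x. ennreal
     (exp (- ((x - m) \<bullet> (matrix_inv V *v (x - m))) / 2) / sqrt ((2 * pi) ^ CARD('n) * det V)))"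


subsection \<open>Top income shares\<close>

text \<open>The sample of size \<open>n\<close> is \<open>Y 1, \<dots>, Y n\<close>; \<open>order_stat Y n i\<close> is its \<open>i\<close>-th largest value.\<close>

definition order_stat :: "(nat \<Rightarrow> 'a \<Rightarrow> real) \<Rightarrow> nat \<Rightarrow> nat \<Rightarrow> 'a \<Rightarrow> real" where
  "order_stat Y n i \<omega> = rev (sort (map (\<lambda>j. Y j \<omega>) [1..<Suc n])) ! (i - 1)"

definition top_share ::
  "(nat \<Rightarrow> 'a \<Rightarrow> real) \<Rightarrow> (nat \<Rightarrow> real) \<Rightarrow> nat \<Rightarrow> nat \<Rightarrow> 'a \<Rightarrow> real" where
  "top_share Y p n k \<omega> =
     (\<Sum>i = 1..nat \<lfloor>real n * p k\<rfloor>. order_stat Y n i \<omega>) / (\<Sum>i = 1..n. order_stat Y n i \<omega>)"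

definition normalized_share ::
  "(nat \<Rightarrow> 'a \<Rightarrow> real) \<Rightarrow> (nat \<Rightarrow> real) \<Rightarrow> nat \<Rightarrow> nat \<Rightarrow> 'a \<Rightarrow> nat \<Rightarrow> real" where
  "normalized_share Y p K n \<omega> k =
     (top_share Y p n (k + 1) \<omega> - top_share Y p n k \<omega>) /
     (top_share Y p n (K + 1) \<omega> - top_share Y p n K \<omega>)"


subsection \<open>Asymptotic mean and variance\<close>

definition mu :: "real \<Rightarrow> real \<Rightarrow> real \<Rightarrow> real \<Rightarrow> real" where
  "mu \<alpha> c p q = (let \<xi> = 1 / \<alpha> in c * (q powr (1 - \<xi>) - p powr (1 - \<xi>)) / (1 - \<xi>))"

definition sigma2 :: "real \<Rightarrow> real \<Rightarrow> real \<Rightarrow> real \<Rightarrow> real" where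
  "sigma2 \<alpha> c p q = (let \<xi> = 1 / \<alpha> in
     2 * c\<^sup>2 * \<xi>\<^sup>2 / (1 - \<xi>) *
     ((if \<xi> = 1 / 2 then ln (q / p)
       else (q powr (1 - 2 * \<xi>) - p powr (1 - 2 * \<xi>)) / (1 - 2 * \<xi>))
      + p powr (1 - \<xi>) * ((q powr (- \<xi>) - p powr (- \<xi>)) / \<xi>)
      + (2 * p powr (1 - \<xi>) * q powr (1 - \<xi>) - p powr (2 - 2 * \<xi>) - q powr (2 - 2 * \<xi>))
        / (2 - 2 * \<xi>)))"

definition sigma_offdiag :: "real \<Rightarrow> real \<Rightarrow> (nat \<Rightarrow> real) \<Rightarrow> nat \<Rightarrow> nat \<Rightarrow> real" where
  "sigma_offdiag \<alpha> c p j k = (let \<xi> = 1 / \<alpha> in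
     - (c\<^sup>2) * \<xi>\<^sup>2 * ((p (j + 1) powr (1 - \<xi>) - p j powr (1 - \<xi>)) / (1 - \<xi>)) *
     ((p (k + 1) powr (- \<xi>) - p k powr (- \<xi>)) / \<xi>
      + (p (k + 1) powr (1 - \<xi>) - p k powr (1 - \<xi>)) / (1 - \<xi>)))"

definition Sigma_mat ::
  "real \<Rightarrow> real \<Rightarrow> (nat \<Rightarrow> real) \<Rightarrow> real ^ 'k::{finite,linorder} ^ 'k::{finite,linorder}" where
  "Sigma_mat \<alpha> c p = mat_of (\<lambda>j k.
     if j = k then sigma2 \<alpha> c (p k) (p (k + 1))
     else if j < k then sigma_offdiag \<alpha> c p j k
     else sigma_offdiag \<alpha> c p k j)"

definition mean_ratio :: "real \<Rightarrow> real \<Rightarrow> (nat \<Rightarrow> real) \<Rightarrow> nat \<Rightarrow> nat \<Rightarrow> real" where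
  "mean_ratio \<alpha> c p K k = mu \<alpha> c (p k) (p (k + 1)) / mu \<alpha> c (p K) (p (K + 1))"

definition H_mat ::
  "real \<Rightarrow> real \<Rightarrow> (nat \<Rightarrow> real) \<Rightarrow> nat
     \<Rightarrow> real ^ 'k::{finite,linorder} ^ 'm::{finite,linorder}" where
  "H_mat \<alpha> c p K = (1 / mu \<alpha> c (p K) (p (K + 1))) *\<^sub>R mat_of (\<lambda>i j.
     if j = K then - mean_ratio \<alpha> c p K i else if i = j then 1 else 0)"

end

theory Submission
  imports Defs
begin

text \<open>
  Order statistics enter the shares only through sums of the $m$ largest incomes, and such a sum
  is the minimum over $t$ of $m t + \sum_j (Y_j - t)^+$, attained at the $m$-th largest income.
  The function is flat near its minimum: if $t$ is the $(1-p)$-quantile and $m = \lfloor np \rfloor$,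
  then evaluating it at $t$ overshoots the minimum by at most the distance from $t$ to the $m$-th
  largest income, which tends to $0$, times the difference between $m$ and the number of incomes
  above $t$, which is of order $\sqrt n$ (\<open>top_sum_linearization\<close>, \<open>remainder_vanishing\<close>).
  Up to an error $o(\sqrt n)$ in probability, the sum of the incomes with ranks between
  $n p_k$ and $n p_{k+1}$ is therefore a constant plus $\sum_j g_k(Y_j)$, where $g_k(y)$, a slab, is
  the length of the part of $[t_{k+1}, t_k]$ below $y$, with $t_k$ the quantile belonging to $p_k$.
  These are sums of bounded independent variables, also for $\alpha \le 2$ and for $p_{K+1} = 1$.

  The moments of the slabs are integrals of the tail of $Y$. Different slabs are nested: the upper
  one is positive only where the lower one is full. Their means and covariances come out as
  $\mu_k$ (up to the constant above) and $\Sigma$ (\<open>slab_second_moment\<close>,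
  \<open>centred_slab_covariance\<close>).

  Dividing by the last block, $\sqrt n (\bar s_k - r_k)$ is, up to a vanishing error, the scaled sum
  of $g_k - r_k g_K$, centred, times a factor that tends to $1/\mu_K$; this is the row $k$ of $H$
  applied to the slabs (\<open>share_linearization\<close>, \<open>H_row\<close>). For every $x$ the number
  $x \cdot \Omega x$ is thus the variance of the slab combination $\sum_k z_k g_k$ with
  $z = H^\top x$. This combination is piecewise linear with slope $z_k$ on an interval that $Y$ hits
  with positive probability, so its variance vanishes only if $z = 0$, that is, only if $x = 0$
  (\<open>slab_comb_nondegenerate\<close>). Both $\mu_k$ and $\sqrt{\Sigma_{kk}}$ are proportional to
  $c$, and $H \Sigma H^\top$ is of degree $0$ in $c$.

  It remains to pass from the one-dimensional central limit theorem for all $x \cdot Z_n$ to the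
  random vectors $Z_n$. Expectations of $\cos (x \cdot Z_n + b)$ determine the limit of
  expectations of all bounded continuous functions (\<open>multivariate_levy_continuity\<close>), and for
  the normal law they are computed from its density by a linear change of variables
  (\<open>multivariate_normal_cos\<close>).
\<close>

section \<open>Convergence in distribution from trigonometric test functions\<close>

text \<open>
  The family is closed under products because a product of cosines is a sum of cosines. The phase
  \<open>b\<close> covers sines and, with \<open>t = 0\<close>, constants.
\<close>
inductive_set trig :: "('a::euclidean_space \<Rightarrow> real) set" where
  cos: "(\<lambda>x. cos (t \<bullet> x + b)) \<in> trig"
| add: "f \<in> trig \<Longrightarrow> g \<in> trig \<Longrightarrow> (\<lambda>x. f x + g x) \<in> trig"
| scale: "f \<in> trig \<Longrightarrow> (\<lambda>x. a * f x) \<in> trig"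

lemma trig_const: "(\<lambda>_. c) \<in> trig"
  using trig.scale[OF trig.cos[of 0 0], of c] by simp

lemma trig_mult_cos: "g \<in> trig \<Longrightarrow> (\<lambda>x. cos (t \<bullet> x + b) * g x) \<in> trig"
proof (induction rule: trig.induct)
  case (cos s d)
  have "(\<lambda>x. cos (t \<bullet> x + b) * cos (s \<bullet> x + d)) =
     (\<lambda>x. (1/2) * (cos ((t - s) \<bullet> x + (b - d)) + cos ((t + s) \<bullet> x + (b + d))))"
    by (rule ext) (simp add: cos_times_cos inner_add_left inner_diff_left algebra_simps)
  then show ?case by (simp only: trig.scale[OF trig.add[OF trig.cos trig.cos]])
next
  case (add f g)
  from trig.add[OF add.IH] show ?case by (simp add: distrib_left)
next
  case (scale f a)
  from trig.scale[OF scale.IH, of a] show ?case by (simp add: mult.left_commute)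
qed

lemma trig_mult: "f \<in> trig \<Longrightarrow> g \<in> trig \<Longrightarrow> (\<lambda>x. f x * g x) \<in> trig"
proof (induction rule: trig.induct)
  case (cos t b)
  then show ?case by (rule trig_mult_cos)
next
  case (add f h)
  from trig.add[OF add.IH(1)[OF add.prems] add.IH(2)[OF add.prems]] show ?case by (simp add: distrib_right)
next
  case (scale f a)
  from trig.scale[OF scale.IH[OF scale.prems], of a] show ?case by (simp add: mult.assoc)
qed

lemma trig_continuous: "f \<in> trig \<Longrightarrow> continuous_on S f"
proof (induction rule: trig.induct)
  case (cos t b)
  show ?case by (intro continuous_intros)
next
  case (add f g)
  then show ?case by (intro continuous_on_add)
next
  case (scale f a)
  then show ?case by (intro continuous_on_mult continuous_on_const)
qed

lemma trig_bounded: "f \<in> trig \<Longrightarrow> \<exists>C. \<forall>x. \<bar>f x\<bar> \<le> C"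
proof (induction rule: trig.induct)
  case (cos t b)
  then show ?case by (intro exI[of _ 1]) simp
next
  case (add f g)
  then obtain C D where "\<And>x. \<bar>f x\<bar> \<le> C" "\<And>x. \<bar>g x\<bar> \<le> D" by auto
  then show ?case by (intro exI[of _ "C + D"]) (meson abs_triangle_ineq add_mono order_trans)
next
  case (scale f a)
  then obtain C where "\<And>x. \<bar>f x\<bar> \<le> C" by auto
  then show ?case by (intro exI[of _ "\<bar>a\<bar> * C"]) (simp add: abs_mult mult_left_mono)
qed

lemma trig_polynomial:
  assumes "real_polynomial_function q" "f \<in> trig"
  shows "(\<lambda>x. q (f x)) \<in> trig"
  using assms(1)
proof (induction rule: real_polynomial_function.induct)
  case (linear h)
  then obtain c where "h = (\<lambda>y. y * c)" using real_bounded_linear by blast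
  then show ?case using trig.scale[OF assms(2), of c] by (simp add: mult.commute)
next
  case (const c)
  show ?case by (rule trig_const)
next
  case (add g h)
  from trig.add[OF add.IH] show ?case .
next
  case (mult g h)
  from trig_mult[OF mult.IH] show ?case .
qed

lemma trig_separates:
  fixes x y :: "'a::euclidean_space"
  assumes "x \<noteq> y" shows "\<exists>f\<in>trig. f x \<noteq> f y"
proof -
  define u where "u = (x - y) \<bullet> (x - y)"
  have u: "u > 0" unfolding u_def using assms by simp
  define t where "t = (1 / u) *\<^sub>R (x - y)"
  have d: "t \<bullet> x - t \<bullet> y = 1" 
  proof -
    have "t \<bullet> x - t \<bullet> y = t \<bullet> (x - y)" by (simp add: inner_diff_right)
    also have "\<dots> = (1 / u) * u" unfolding t_def u_def by (simp only: inner_scaleR_left)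
    finally have "t \<bullet> x - t \<bullet> y = (1 / u) * u" .
    then show ?thesis using u by simp
  qed
  \<comment> \<open>The phase makes the argument 0 at y and 1 at x, and cos is injective on [0, \<pi>].\<close>
  have "t \<bullet> x + (- (t \<bullet> y)) = 1" using d by simp
  then have "cos (t \<bullet> x + (- (t \<bullet> y))) \<noteq> cos (t \<bullet> y + (- (t \<bullet> y)))"
    using cos_monotone_0_pi[of 0 1] pi_gt3 by simp
  then show ?thesis by (rule bexI[OF _ trig.cos])
qed

text \<open>
  Stone-Weierstrass controls the approximation on \<open>K\<close> only; a trigonometric polynomial that
  is close to \<open>f\<close> on \<open>K\<close> may be large elsewhere. Composing it with a polynomial close to the
  truncation at level \<open>B\<close> repairs this and stays within the algebra.
\<close>
lemma trig_approximation:
  fixes f :: "'a::euclidean_space \<Rightarrow> real"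
  assumes K: "compact K" and f: "continuous_on K f" and B: "\<And>x. x \<in> K \<Longrightarrow> \<bar>f x\<bar> \<le> B" and e: "e > 0"
    and B0: "B \<ge> 0"
  obtains Q where "Q \<in> trig" "\<And>x. x \<in> K \<Longrightarrow> \<bar>Q x - f x\<bar> \<le> e" "\<And>x. \<bar>Q x\<bar> \<le> B + e"
proof -
  interpret function_ring_on trig K
    
    by unfold_locales (fact K | rule trig_const | (rule trig_continuous trig.add trig_mult trig_separates; assumption))+
  obtain P where P: "P \<in> trig" "\<And>x. x \<in> K \<Longrightarrow> \<bar>f x - P x\<bar> < e / 2"
    using Stone_Weierstrass_basic[OF f, of "e/2"] e by auto
  obtain C where C: "\<And>x. \<bar>P x\<bar> \<le> C" using trig_bounded[OF P(1)] by auto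
  define cl where "cl y = max (- B) (min B y)" for y :: real
  have "continuous_on {-C..C} cl" unfolding cl_def by (intro continuous_intros)
  from Stone_Weierstrass_real_polynomial_function[OF compact_Icc this, of "e/2"] e
  obtain q where q: "real_polynomial_function q" "\<And>y. y \<in> {-C..C} \<Longrightarrow> \<bar>cl y - q y\<bar> < e / 2" by auto
  have Q: "\<bar>cl (P x) - q (P x)\<bar> < e / 2" for x using q(2)[of "P x"] C[of x] by (simp add: abs_le_iff)
  show thesis
  proof (rule that[of "\<lambda>x. q (P x)"])
    show "(\<lambda>x. q (P x)) \<in> trig" by (rule trig_polynomial[OF q(1) P(1)])
    show "\<bar>q (P x) - f x\<bar> \<le> e" if "x \<in> K" for x
    proof -
      have "\<bar>cl (P x) - f x\<bar> \<le> \<bar>P x - f x\<bar>" using B[OF that] unfolding cl_def by linarith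
      with P(2)[OF that] Q[of x] show ?thesis by linarith
    qed
    show "\<bar>q (P x)\<bar> \<le> B + e" for x
    proof -
      have "\<bar>cl (P x)\<bar> \<le> B" unfolding cl_def using B0 by linarith
      with Q[of x] e show ?thesis by linarith
    qed
  qed
qed

text \<open>
  A continuous function that dominates the indicator of the complement of a box and is a sum of
  functions of one coordinate, so that its expectations are controlled by the marginal laws.
\<close>
definition escape :: "real \<Rightarrow> 'a::euclidean_space \<Rightarrow> real" where
  "escape L x = (\<Sum>b\<in>Basis. min 1 (max 0 (\<bar>x \<bullet> b\<bar> - L)))"

lemma escape_ge_1:
  fixes x :: "'a::euclidean_space"
  assumes "x \<notin> cbox (- (\<Sum>b\<in>Basis. (L + 1) *\<^sub>R b)) (\<Sum>b\<in>Basis. (L + 1) *\<^sub>R b)"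
  shows "escape L x \<ge> 1"
proof -
  have c: "(\<Sum>b\<in>Basis. (L + 1) *\<^sub>R b) \<bullet> i = L + 1" if "i \<in> Basis" for i :: 'a
    using that by (rule inner_sum_left_Basis)
  have "\<exists>b\<in>Basis. \<bar>x \<bullet> b\<bar> > L + 1"
  proof (rule ccontr)
    assume "\<not> (\<exists>b\<in>Basis. \<bar>x \<bullet> b\<bar> > L + 1)"
    then have le: "\<bar>x \<bullet> b\<bar> \<le> L + 1" if "b \<in> Basis" for b using that by (meson not_le)
    have "x \<in> cbox (- (\<Sum>b\<in>Basis. (L + 1) *\<^sub>R b)) (\<Sum>b\<in>Basis. (L + 1) *\<^sub>R b)"
      unfolding mem_box
    proof (intro ballI conjI)
      fix i :: 'a assume i: "i \<in> Basis"
      show "- (\<Sum>b\<in>Basis. (L + 1) *\<^sub>R b) \<bullet> i \<le> x \<bullet> i" "x \<bullet> i \<le> (\<Sum>b\<in>Basis. (L + 1) *\<^sub>R b) \<bullet> i"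
        using le[OF i] unfolding inner_minus_left c[OF i] by linarith+
    qed
    with assms show False by simp
  qed
  then obtain b where b: "b \<in> Basis" "\<bar>x \<bullet> b\<bar> > L + 1" by blast
  have "1 = min 1 (max 0 (\<bar>x \<bullet> b\<bar> - L))" using b(2) by simp
  also have "\<dots> \<le> escape L x" unfolding escape_def
    using b(1) by (intro member_le_sum) auto
  finally show ?thesis .
qed

lemma escape_nonneg: "escape L x \<ge> 0"
  unfolding escape_def by (intro sum_nonneg) auto

lemma escape_le: "escape L (x::'a::euclidean_space) \<le> DIM('a)"
  unfolding escape_def using sum_mono[of "Basis::'a set" "\<lambda>b. min 1 (max 0 (\<bar>x \<bullet> b\<bar> - L))" "\<lambda>_. 1"] by simp

text \<open>
  The hypothesis gives the characteristic functions of every coordinate, so the one-dimensional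
  continuity theorem applies.
\<close>
lemma marginal_convergence:
  fixes X :: "nat \<Rightarrow> 'a \<Rightarrow> 'b::euclidean_space"
  assumes "prob_space M" "\<And>n. X n \<in> borel_measurable M"
    and "prob_space N" "sets N = sets borel"
    and conv: "\<And>t b. (\<lambda>n. \<integral>w. cos (t \<bullet> X n w + b) \<partial>M) \<longlonglongrightarrow> (\<integral>x. cos (t \<bullet> x + b) \<partial>N)"
    and h: "continuous_on UNIV h" "\<And>y. \<bar>h y\<bar> \<le> C"
  shows "(\<lambda>n. \<integral>w. (h (X n w \<bullet> b) :: real) \<partial>M) \<longlonglongrightarrow> (\<integral>x. h (x \<bullet> b) \<partial>N)"
proof -
  interpret M: prob_space M by fact
  interpret N: prob_space N by fact
  note [measurable] = assms(2)
  have mN[measurable]: "g \<in> borel_measurable N" if "g \<in> borel_measurable borel" for g :: "'b \<Rightarrow> real"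
    using that assms(4) by (simp cong: measurable_cong_sets)
  have char: "char (distr P borel Z) t = complex_of_real (\<integral>w. cos (t * Z w) \<partial>P) + \<i> * complex_of_real (\<integral>w. cos (t * Z w + (- pi/2)) \<partial>P)"
    if "prob_space P" and [measurable]: "Z \<in> borel_measurable P" for P :: "'c measure" and Z t
  proof -
    interpret P: prob_space P by fact
    have i: "integrable P (\<lambda>w. cos (t * Z w))" "integrable P (\<lambda>w. sin (t * Z w))"
      by (auto intro!: P.integrable_const_bound[of _ 1])
    have "char (distr P borel Z) t = (\<integral>w. iexp (t * Z w) \<partial>P)"
      unfolding char_def by (subst integral_distr) auto
    also have "\<dots> = (\<integral>w. complex_of_real (cos (t * Z w)) + \<i> * complex_of_real (sin (t * Z w)) \<partial>P)"
      by (intro Bochner_Integration.integral_cong refl) (simp add: exp_Euler flip: cos_of_real sin_of_real)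
    also have "\<dots> = complex_of_real (\<integral>w. cos (t * Z w) \<partial>P) + \<i> * complex_of_real (\<integral>w. sin (t * Z w) \<partial>P)"
      using i by (subst Bochner_Integration.integral_add) auto
    also have "(\<lambda>w. sin (t * Z w)) = (\<lambda>w. cos (t * Z w + (- pi/2)))"
      by (simp add: cos_diff)
    finally show ?thesis .
  qed
  have Nm: "(\<lambda>x. x \<bullet> b) \<in> borel_measurable N" by measurable
  have "weak_conv_m (\<lambda>n. distr M borel (\<lambda>w. X n w \<bullet> b)) (distr N borel (\<lambda>x. x \<bullet> b))"
  proof (rule levy_continuity)
    show "real_distribution (distr M borel (\<lambda>w. X n w \<bullet> b))" for n by (intro M.real_distribution_distr) measurable
    show "real_distribution (distr N borel (\<lambda>x. x \<bullet> b))" by (intro N.real_distribution_distr Nm)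
    show "(\<lambda>n. char (distr M borel (\<lambda>w. X n w \<bullet> b)) t) \<longlonglongrightarrow> char (distr N borel (\<lambda>x. x \<bullet> b)) t" for t
      using conv[of "t *\<^sub>R b" 0] conv[of "t *\<^sub>R b" "- pi/2"] 
      by (simp add: char[OF M.prob_space_axioms] char[OF N.prob_space_axioms Nm])
        (intro tendsto_intros; simp add: inner_commute)
  qed
  then have "(\<lambda>n. \<integral>y. h y \<partial>distr M borel (\<lambda>w. X n w \<bullet> b)) \<longlonglongrightarrow> (\<integral>y. h y \<partial>distr N borel (\<lambda>x. x \<bullet> b))"
    using h by (intro weak_conv_imp_integral_bdd_continuous_conv[where B = C] M.real_distribution_distr N.real_distribution_distr Nm)
      (auto simp: continuous_on_eq_continuous_at)
  moreover have "h \<in> borel_measurable borel" using h(1) by (rule borel_measurable_continuous_onI)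
  ultimately show ?thesis by (simp add: integral_distr Nm)
qed

lemma (in prob_space) expectation_close:
  fixes f g h :: "'a \<Rightarrow> real"
  assumes i: "integrable M g" "integrable M f" "integrable M h" and le: "\<And>x. \<bar>g x - f x\<bar> \<le> d + C * h x"
  shows "\<bar>expectation g - expectation f\<bar> \<le> d + C * expectation h"
proof -
  have "\<bar>expectation g - expectation f\<bar> = \<bar>\<integral>x. g x - f x \<partial>M\<bar>" using i by simp
  also have "\<dots> \<le> (\<integral>x. \<bar>g x - f x\<bar> \<partial>M)" by (rule integral_abs_bound)
  also have "\<dots> \<le> (\<integral>x. d + C * h x \<partial>M)" using i le by (intro integral_mono) auto
  also have "\<dots> = d + C * expectation h" using i by (simp add: prob_space)
  finally show ?thesis .
qed

text \<open>
  The marginals are tight, hence so is the sequence; on a large box a test function is uniformly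
  close to a trigonometric polynomial, for which convergence is the hypothesis.
\<close>
theorem multivariate_levy_continuity:
  fixes X :: "nat \<Rightarrow> 'a \<Rightarrow> 'b::euclidean_space"
  assumes "prob_space M" and X: "\<And>n. X n \<in> borel_measurable M"
    and "prob_space N" and sN: "sets N = sets borel"
    and conv: "\<And>t b. (\<lambda>n. \<integral>w. cos (t \<bullet> X n w + b) \<partial>M) \<longlonglongrightarrow> (\<integral>x. cos (t \<bullet> x + b) \<partial>N)"
  shows "converges_in_distribution M X N"
  unfolding converges_in_distribution_def
proof (intro conjI allI impI X sN \<open>prob_space N\<close>)
  interpret M: prob_space M by fact
  interpret N: prob_space N by fact
  note [measurable] = X
  have mN: "g \<in> borel_measurable N" if "continuous_on UNIV g" for g :: "'b \<Rightarrow> real"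
    using borel_measurable_continuous_onI[OF that] sN by (simp cong: measurable_cong_sets)
  have mM: "(\<lambda>w. g (X n w)) \<in> borel_measurable M" if "continuous_on UNIV g" for g :: "'b \<Rightarrow> real" and n
    using borel_measurable_continuous_onI[OF that] by measurable
  have iN: "integrable N g" if "continuous_on UNIV g" "\<And>x. \<bar>g x\<bar> \<le> C" for g :: "'b \<Rightarrow> real" and C
    using that by (intro N.integrable_const_bound[of _ C] mN) auto
  have iM: "integrable M (\<lambda>w. g (X n w))" if "continuous_on UNIV g" "\<And>x. \<bar>g x\<bar> \<le> C" for g :: "'b \<Rightarrow> real" and C n
    using that by (intro M.integrable_const_bound[of _ C] mM) auto
  have trig_conv: "(\<lambda>n. \<integral>w. g (X n w) \<partial>M) \<longlonglongrightarrow> (\<integral>x. g x \<partial>N)" if "g \<in> trig" for g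
    using that
  proof (induction rule: trig.induct)
    case (cos t b) then show ?case by (rule conv)
  next
    case (add f g)
    obtain C D where "\<And>x. \<bar>f x\<bar> \<le> C" "\<And>x. \<bar>g x\<bar> \<le> D" using trig_bounded add.hyps by metis
    then have "integrable M (\<lambda>w. f (X n w))" "integrable M (\<lambda>w. g (X n w))" "integrable N f" "integrable N g" for n
      by (auto intro!: iM iN trig_continuous add.hyps)
    then show ?case using tendsto_add[OF add.IH] by simp
  next
    case (scale f a)
    show ?case using tendsto_mult_left[OF scale.IH, of a] by simp
  qed
  have ec: "continuous_on UNIV (escape L :: 'b \<Rightarrow> real)" for L unfolding escape_def by (intro continuous_intros)
  have eb: "\<bar>escape L x\<bar> \<le> DIM('b)" for L and x :: 'b using escape_le[of L x] escape_nonneg[of L x] by simp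
  have escape_conv: "(\<lambda>n. \<integral>w. escape L (X n w) \<partial>M) \<longlonglongrightarrow> (\<integral>x. escape L x \<partial>N)" for L
  proof -
    define h where "h y = min 1 (max 0 (\<bar>y\<bar> - L))" for y
    have h: "continuous_on UNIV h" "\<And>y. \<bar>h y\<bar> \<le> 1" unfolding h_def by (auto intro!: continuous_intros)
    have h': "continuous_on UNIV (\<lambda>x::'b. h (x \<bullet> b))" for b unfolding h_def by (intro continuous_intros)
    have "(\<lambda>n. \<Sum>b\<in>Basis. \<integral>w. h (X n w \<bullet> b) \<partial>M) \<longlonglongrightarrow> (\<Sum>b\<in>Basis. \<integral>x. h (x \<bullet> b) \<partial>N)"
      by (intro tendsto_sum marginal_convergence[OF assms, where C = 1] h)
    moreover have "(\<integral>x. escape L x \<partial>N) = (\<Sum>b\<in>Basis. \<integral>x. h (x \<bullet> b) \<partial>N)"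
      unfolding escape_def h_def[symmetric] by (intro Bochner_Integration.integral_sum iN[of _ 1] h') (use h in auto)
    moreover have "(\<integral>w. escape L (X n w) \<partial>M) = (\<Sum>b\<in>Basis. \<integral>w. h (X n w \<bullet> b) \<partial>M)" for n
      unfolding escape_def h_def[symmetric] by (intro Bochner_Integration.integral_sum iM[of _ 1] h') (use h in auto)
    ultimately show ?thesis by simp
  qed
  have "(\<lambda>k. \<integral>x. escape (real k) x \<partial>N) \<longlonglongrightarrow> (\<integral>x. 0 \<partial>N)"
  proof (rule integral_dominated_convergence[where w = "\<lambda>_. real DIM('b)"])
    have "(\<lambda>k. escape (real k) x) \<longlonglongrightarrow> 0" for x :: 'b
    proof (rule tendsto_eventually)
      obtain k0 where k0: "real k0 \<ge> norm x" using real_arch_simple by blast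
      show "\<forall>\<^sub>F k in sequentially. escape (real k) x = 0"
      proof (rule eventually_sequentiallyI)
        fix k assume "k0 \<le> k"
        then have "real k \<ge> norm x" using k0 by linarith
        then have "\<bar>x \<bullet> b\<bar> \<le> real k" if "b \<in> Basis" for b using Basis_le_norm[OF that, of x] by linarith
        then show "escape (real k) x = 0" unfolding escape_def by (intro sum.neutral) auto
      qed
    qed
    then show "AE x in N. (\<lambda>k. escape (real k) x) \<longlonglongrightarrow> 0" by simp
  qed (use mN[OF ec] eb in auto)
  then have tight: "(\<lambda>k. \<integral>x. escape (real k) x \<partial>N) \<longlonglongrightarrow> 0" by simp
  fix f :: "'b \<Rightarrow> real"
  assume "continuous_on UNIV f \<and> bounded (range f)"
  then have f: "continuous_on UNIV f" and "bounded (range f)" by auto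
  then obtain B where B: "\<And>x. \<bar>f x\<bar> \<le> B" by (auto simp: bounded_iff)
  have B0: "B \<ge> 0" using B[of 0] by linarith
  show "(\<lambda>n. \<integral>w. f (X n w) \<partial>M) \<longlonglongrightarrow> (\<integral>x. f x \<partial>N)"
  proof (rule LIMSEQ_I, goal_cases)
    case (1 e)
    \<comment> \<open>Five errors have to fit into e: mass outside the box, weighted with 2 * B + 1, under both laws, and three uniform errors.\<close>
    define d where "d = min 1 (e / (2 * B + 2) / 5)"
    have d: "0 < d" "d \<le> 1" "5 * (2 * B + 2) * d \<le> e" 
    proof -
      show "0 < d" "d \<le> 1" unfolding d_def using 1 B0 by auto
      have "5 * (2 * B + 2) * d \<le> 5 * (2 * B + 2) * (e / (2 * B + 2) / 5)"
        unfolding d_def using B0 by (intro mult_left_mono) auto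
      also have "\<dots> = e" using B0 by simp
      finally show "5 * (2 * B + 2) * d \<le> e" .
    qed
    obtain k where k: "(\<integral>x. escape (real k) x \<partial>N) < d"
      using order_tendstoD(2)[OF tight d(1)] by (auto simp: eventually_sequentially)
    define L where "L = real k"
    let ?K = "cbox (- (\<Sum>b\<in>Basis. (L + 1) *\<^sub>R b)) (\<Sum>b\<in>Basis. (L + 1) *\<^sub>R b) :: 'b set"
    obtain Q where Q: "Q \<in> trig" "\<And>x. x \<in> ?K \<Longrightarrow> \<bar>Q x - f x\<bar> \<le> d" "\<And>x. \<bar>Q x\<bar> \<le> B + d"
      using trig_approximation[OF compact_cbox, of _ _ f B d] f B d(1) B0 continuous_on_subset by (metis subset_UNIV)
    have bound: "\<bar>Q x - f x\<bar> \<le> d + (2 * B + 1) * escape L x" for x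
    proof (cases "x \<in> ?K")
      case True
      with Q(2)[OF this] B0 escape_nonneg[of L x] show ?thesis by (smt (verit) mult_nonneg_nonneg)
    next
      case False
      have "\<bar>Q x - f x\<bar> \<le> d + (2 * B + 1) * 1" using Q(3)[of x] B[of x] d(1) unfolding mult_1_right by linarith
      also have "\<dots> \<le> d + (2 * B + 1) * escape L x" using escape_ge_1[OF False] B0 by (intro add_left_mono mult_left_mono) auto
      finally show ?thesis .
    qed
    note Qc = trig_continuous[OF Q(1), of UNIV]
    have EN: "\<bar>(\<integral>x. Q x \<partial>N) - (\<integral>x. f x \<partial>N)\<bar> \<le> d + (2 * B + 1) * (\<integral>x. escape L x \<partial>N)"
      using iN[OF Qc Q(3)] iN[OF f B] iN[OF ec eb] bound by (rule N.expectation_close)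
    have EM: "\<bar>(\<integral>w. Q (X n w) \<partial>M) - (\<integral>w. f (X n w) \<partial>M)\<bar>
        \<le> d + (2 * B + 1) * (\<integral>w. escape L (X n w) \<partial>M)" for n
      using iM[OF Qc Q(3)] iM[OF f B] iM[OF ec eb] bound by (rule M.expectation_close)
    have "\<forall>\<^sub>F n in sequentially. (\<integral>w. escape L (X n w) \<partial>M) < d"
      using order_tendstoD(2)[OF escape_conv[of L]] k unfolding L_def by blast
    moreover have "\<forall>\<^sub>F n in sequentially. \<bar>(\<integral>w. Q (X n w) \<partial>M) - (\<integral>x. Q x \<partial>N)\<bar> < d"
      using tendstoD[OF trig_conv[OF Q(1)] d(1)] by (simp add: dist_real_def)
    ultimately have "\<forall>\<^sub>F n in sequentially. norm ((\<integral>w. f (X n w) \<partial>M) - (\<integral>x. f x \<partial>N)) < e"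
    proof eventually_elim
      case (elim n)
      have "(2 * B + 1) * (\<integral>w. escape L (X n w) \<partial>M) \<le> (2 * B + 1) * d"
           "(2 * B + 1) * (\<integral>x. escape L x \<partial>N) \<le> (2 * B + 1) * d"
        using elim k B0 unfolding L_def by (intro mult_left_mono; simp)+
      with EM[of n] EN elim(2)
      have "\<bar>(\<integral>w. f (X n w) \<partial>M) - (\<integral>x. f x \<partial>N)\<bar> < 3 * d + 2 * ((2 * B + 1) * d)" by linarith
      also have "\<dots> \<le> 5 * (2 * B + 2) * d" using d(1) B0 by (simp add: algebra_simps)
      finally show ?case using d(3) by simp
    qed
    then show ?case by (simp add: eventually_sequentially)
  qed
qed

section \<open>Lebesgue measure under linear maps\<close>

text \<open>
  For fixed values of the other coordinates a shear only translates the coordinate \<open>m\<close>.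
\<close>
lemma nn_integral_lborel_shear:
  fixes f :: "'a::euclidean_space \<Rightarrow> ennreal" and m n :: 'a
  assumes [measurable]: "f \<in> borel_measurable borel" and mn: "m \<in> Basis" "n \<in> Basis" "m \<noteq> n"
  shows "(\<integral>\<^sup>+x. f (x + (x \<bullet> n) *\<^sub>R m) \<partial>lborel) = (\<integral>\<^sup>+x. f x \<partial>lborel)"
proof -
  interpret product_sigma_finite "\<lambda>_::'a. lborel :: real measure" by standard
  define v where "v y = (\<Sum>b\<in>Basis - {m}. y b *\<^sub>R b)" for y :: "'a \<Rightarrow> real"
  have fubini: "(\<integral>\<^sup>+x. g x \<partial>lborel) =
      (\<integral>\<^sup>+y. (\<integral>\<^sup>+s. g (s *\<^sub>R m + v y) \<partial>lborel) \<partial>Pi\<^sub>M (Basis - {m}) (\<lambda>_. lborel))"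
    if [measurable]: "g \<in> borel_measurable borel" for g :: "'a \<Rightarrow> ennreal"
  proof -
    have ins: "insert m (Basis - {m}) = (Basis :: 'a set)" using mn by auto
    have "(\<integral>\<^sup>+x. g x \<partial>lborel) = (\<integral>\<^sup>+y. g (\<Sum>b\<in>Basis. y b *\<^sub>R b) \<partial>Pi\<^sub>M (insert m (Basis - {m})) (\<lambda>_. lborel))"
      unfolding ins by (subst lborel_eq) (simp add: nn_integral_distr)
    also have "\<dots> = (\<integral>\<^sup>+y. (\<integral>\<^sup>+s. g (\<Sum>b\<in>Basis. (y(m := s)) b *\<^sub>R b) \<partial>lborel) \<partial>Pi\<^sub>M (Basis - {m}) (\<lambda>_. lborel))"
      by (rule product_nn_integral_insert) (auto simp: ins)
    also have "\<dots> = (\<integral>\<^sup>+y. (\<integral>\<^sup>+s. g (s *\<^sub>R m + v y) \<partial>lborel) \<partial>Pi\<^sub>M (Basis - {m}) (\<lambda>_. lborel))"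
    proof -
      have "(\<Sum>b\<in>Basis. (y(m := s)) b *\<^sub>R b) = s *\<^sub>R m + v y" for y s
        unfolding v_def using mn(1) by (subst sum.remove[of _ m]) auto
      then show ?thesis by simp
    qed
    finally show ?thesis .
  qed
  have "(\<integral>\<^sup>+x. f (x + (x \<bullet> n) *\<^sub>R m) \<partial>lborel) =
     (\<integral>\<^sup>+y. (\<integral>\<^sup>+s. f ((s *\<^sub>R m + v y) + ((s *\<^sub>R m + v y) \<bullet> n) *\<^sub>R m) \<partial>lborel) \<partial>Pi\<^sub>M (Basis - {m}) (\<lambda>_. lborel))"
    by (rule fubini) measurable
  also have "\<dots> = (\<integral>\<^sup>+y. (\<integral>\<^sup>+s. f (s *\<^sub>R m + v y) \<partial>lborel) \<partial>Pi\<^sub>M (Basis - {m}) (\<lambda>_. lborel))"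
  proof (rule nn_integral_cong)
    fix y
    have "(s *\<^sub>R m + v y) + ((s *\<^sub>R m + v y) \<bullet> n) *\<^sub>R m = (v y \<bullet> n + 1 * s) *\<^sub>R m + v y" for s
      using mn by (simp add: inner_add_left inner_Basis algebra_simps)
    then show "(\<integral>\<^sup>+s. f ((s *\<^sub>R m + v y) + ((s *\<^sub>R m + v y) \<bullet> n) *\<^sub>R m) \<partial>lborel) = (\<integral>\<^sup>+s. f (s *\<^sub>R m + v y) \<partial>lborel)"
      using nn_integral_real_affine[of "\<lambda>s. f (s *\<^sub>R m + v y)" 1 "v y \<bullet> n"] by (simp only:) simp
  qed
  also have "\<dots> = (\<integral>\<^sup>+x. f x \<partial>lborel)" by (rule fubini[symmetric]) measurable
  finally show ?thesis .
qed

lemma measurable_matrix_vector_mult [measurable]: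
  "(\<lambda>x. (A :: real^'n^'m) *v x) \<in> borel_measurable borel"
  by (intro borel_measurable_continuous_onI linear_continuous_on matrix_vector_mul_bounded_linear)

lemma prod_Basis_vec:
  "(\<Prod>b\<in>(Basis :: (real^'n) set). f b) = (\<Prod>i\<in>UNIV. f (axis i 1))"
proof -
  have B: "(Basis :: (real^'n) set) = range (\<lambda>i. axis i 1)" by (auto simp: Basis_vec_def)
  have i: "inj (\<lambda>i::'n. axis i (1::real))" by (auto simp: inj_on_def axis_eq_axis)
  show ?thesis unfolding B by (subst prod.reindex[OF i]) simp
qed

text \<open>
  Both sides are multiplicative in \<open>A\<close>, so it suffices to treat the elementary matrices:
  diagonal ones, transpositions of two coordinates, and shears. If a factor is singular,
  then so is the product.
\<close>
lemma nn_integral_lborel_linear: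
  fixes A :: "real^'n^'n" and f :: "real^'n \<Rightarrow> ennreal"
  assumes "det A \<noteq> 0" "f \<in> borel_measurable borel"
  shows "(\<integral>\<^sup>+x. f x \<partial>lborel) = ennreal \<bar>det A\<bar> * (\<integral>\<^sup>+x. f (A *v x) \<partial>lborel)"
proof -
  define P where "P A \<longleftrightarrow> (det A \<noteq> 0 \<longrightarrow> (\<forall>f\<in>borel_measurable borel.
      (\<integral>\<^sup>+x. f x \<partial>lborel) = ennreal \<bar>det A\<bar> * (\<integral>\<^sup>+x. f (A *v x) \<partial>lborel)))" for A :: "real^'n^'n"
  have "P A"
  proof (rule induct_matrix_elementary_alt[of P])
    fix A B :: "real^'n^'n"
    assume A: "P A" and B: "P B"
    show "P (A ** B)"
      unfolding P_def
    proof (intro impI ballI)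
      fix f :: "real^'n \<Rightarrow> ennreal"
      assume nz: "det (A ** B) \<noteq> 0" and [measurable]: "f \<in> borel_measurable borel"
      have "(\<integral>\<^sup>+x. f x \<partial>lborel) = ennreal \<bar>det A\<bar> * (\<integral>\<^sup>+x. f (A *v x) \<partial>lborel)"
      proof -
        have "det A \<noteq> 0" using nz unfolding det_mul by auto
        moreover have "f \<in> borel_measurable borel" by fact
        ultimately show ?thesis using A unfolding P_def by blast
      qed
      also have "(\<integral>\<^sup>+x. f (A *v x) \<partial>lborel) = ennreal \<bar>det B\<bar> * (\<integral>\<^sup>+x. f (A *v (B *v x)) \<partial>lborel)"
      proof -
        have "det B \<noteq> 0" using nz unfolding det_mul by auto
        moreover have "(\<lambda>x. f (A *v x)) \<in> borel_measurable borel" by measurable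
        ultimately show ?thesis using B unfolding P_def by blast
      qed
      finally show "(\<integral>\<^sup>+x. f x \<partial>lborel) = ennreal \<bar>det (A ** B)\<bar> * (\<integral>\<^sup>+x. f ((A ** B) *v x) \<partial>lborel)"
        by (simp add: det_mul abs_mult ennreal_mult mult.assoc matrix_vector_mul_assoc)
    qed
  next
    fix A :: "real^'n^'n" and i
    assume "row i A = 0"
    then show "P A" unfolding P_def using det_zero_row by blast
  next
    fix A :: "real^'n^'n"
    assume diag: "\<And>i j. i \<noteq> j \<Longrightarrow> A $ i $ j = 0"
    show "P A"
      unfolding P_def
    proof (intro impI ballI)
      fix f :: "real^'n \<Rightarrow> ennreal"
      assume nz: "det A \<noteq> 0" and [measurable]: "f \<in> borel_measurable borel"
      have detA: "det A = (\<Prod>i\<in>UNIV. A $ i $ i)" using diag by (rule det_diagonal)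
      have nz': "A $ i $ i \<noteq> 0" for i using nz unfolding detA by simp
      define c where "c b = b \<bullet> (A *v b)" for b
      have cax: "c (axis i 1) = A $ i $ i" for i
        unfolding c_def by (simp add: inner_axis' matrix_vector_mult_basis column_def)
      have cnz: "c b \<noteq> 0" if "b \<in> Basis" for b
        using that nz' cax by (auto simp: Basis_vec_def)
      have Av: "A *v x = 0 + (\<Sum>j\<in>Basis. (c j * (x \<bullet> j)) *\<^sub>R j)" for x
      proof -
        have L: "(A *v x) $ i = A $ i $ i * x $ i" for i
        proof -
          have "(A *v x) $ i = (\<Sum>j\<in>UNIV. if j = i then A $ i $ i * x $ i else 0)"
            unfolding matrix_vector_mult_def vec_lambda_beta
          proof (intro sum.cong refl)
            fix j show "A $ i $ j * x $ j = (if j = i then A $ i $ i * x $ i else 0)"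
              using diag[of i j] by (cases "j = i") auto
          qed
          then show ?thesis by simp
        qed
        have R: "(0 + (\<Sum>j\<in>Basis. (c j * (x \<bullet> j)) *\<^sub>R j)) $ i = A $ i $ i * x $ i" for i
        proof -
          have "(0 + (\<Sum>j\<in>Basis. (c j * (x \<bullet> j)) *\<^sub>R j)) $ i = (\<Sum>j\<in>Basis. (c j * (x \<bullet> j)) *\<^sub>R j) \<bullet> axis i 1"
            by (simp add: inner_axis)
          also have "\<dots> = c (axis i 1) * (x \<bullet> axis i 1)" by (rule inner_sum_left_Basis) simp
          finally show ?thesis by (simp add: cax inner_axis)
        qed
        show ?thesis unfolding vec_eq_iff
          by (rule allI) (rule trans[OF L R[symmetric]])
      qed
      have pr: "(\<Prod>j\<in>(Basis :: (real^'n) set). \<bar>c j\<bar>) = \<bar>det A\<bar>"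
        by (simp add: prod_Basis_vec cax detA abs_prod)
      have "lborel = density (distr lborel borel ((*v) A)) (\<lambda>_. ennreal \<bar>det A\<bar>)"
        using lborel_affine_euclidean[of c 0, OF cnz] unfolding pr Av[symmetric] by simp
      then have "(\<integral>\<^sup>+x. f x \<partial>lborel) = (\<integral>\<^sup>+x. f x \<partial>density (distr lborel borel ((*v) A)) (\<lambda>_. ennreal \<bar>det A\<bar>))"
        by (rule arg_cong[where f = "\<lambda>N. integral\<^sup>N N f"])
      also have "\<dots> = ennreal \<bar>det A\<bar> * (\<integral>\<^sup>+x. f (A *v x) \<partial>lborel)"
        by (simp add: nn_integral_density nn_integral_cmult nn_integral_distr)
      finally show "(\<integral>\<^sup>+x. f x \<partial>lborel) = ennreal \<bar>det A\<bar> * (\<integral>\<^sup>+x. f (A *v x) \<partial>lborel)" .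
    qed
  next
    fix m n :: 'n assume "m \<noteq> n"
    let ?\<tau> = "Transposition.transpose m n"
    define A :: "real^'n^'n" where "A = (\<chi> i j. mat 1 $ i $ ?\<tau> j)"
    have per: "?\<tau> permutes UNIV" by (rule permutes_swap_id) auto
    have "det A = of_int (sign ?\<tau>) * det (mat 1 :: real^'n^'n)"
      unfolding A_def by (rule det_permute_columns[OF per])
    then have detA: "\<bar>det A\<bar> = 1" by (simp add: sign_def)
    have Av: "(A *v x) $ i = x $ ?\<tau> i" for x i
    proof -
      have "(A *v x) $ i = (\<Sum>j\<in>UNIV. (if i = ?\<tau> j then 1 else 0) * x $ j)"
        unfolding A_def matrix_vector_mult_def by (simp add: mat_def)
      also have "\<dots> = (\<Sum>j\<in>UNIV. (if ?\<tau> i = j then x $ j else 0))"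
        by (intro sum.cong) (auto simp: transpose_eq_iff)
      finally show ?thesis by simp
    qed
    have "lborel = distr lborel borel ((*v) A)"
    proof (rule lborel_eqI)
      fix l u :: "real^'n"
      assume le: "\<And>b. b \<in> Basis \<Longrightarrow> l \<bullet> b \<le> u \<bullet> b"
      then have le': "l $ i \<le> u $ i" for i
        using le[of "axis i 1"] by (simp add: inner_axis)
      have "(*v) A -` box l u = box (A *v l) (A *v u)"
      proof -
        have "(\<forall>i. l $ i < x $ ?\<tau> i \<and> x $ ?\<tau> i < u $ i) \<longleftrightarrow> (\<forall>i. l $ ?\<tau> i < x $ i \<and> x $ i < u $ ?\<tau> i)" for x :: "real^'n"
          by (metis transpose_involutory)
        then show ?thesis by (auto simp: mem_box_cart Av)
      qed
      moreover have "(A *v l) \<bullet> b \<le> (A *v u) \<bullet> b" if "b \<in> Basis" for b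
        using that le' by (auto simp: Basis_vec_def inner_axis Av)
      ultimately have "emeasure (distr lborel borel ((*v) A)) (box l u) = ennreal (\<Prod>b\<in>Basis. (A *v u - A *v l) \<bullet> b)"
        by (simp add: emeasure_distr emeasure_lborel_box)
      also have "(\<Prod>b\<in>Basis. (A *v u - A *v l) \<bullet> b) = (\<Prod>i\<in>UNIV. (u - l) $ ?\<tau> i)"
        by (simp add: prod_Basis_vec inner_axis Av)
      also have "\<dots> = (\<Prod>i\<in>UNIV. (u - l) $ i)"
        using prod.permute[OF per, of "\<lambda>i. (u - l) $ i"] by (simp add: o_def)
      also have "\<dots> = (\<Prod>b\<in>Basis. (u - l) \<bullet> b)"
        by (simp add: prod_Basis_vec inner_axis)
      finally show "emeasure (distr lborel borel ((*v) A)) (box l u) = (\<Prod>b\<in>Basis. (u - l) \<bullet> b)" .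
    qed simp
    then have "(\<integral>\<^sup>+x. f x \<partial>lborel) = (\<integral>\<^sup>+x. f (A *v x) \<partial>lborel)"
      if "f \<in> borel_measurable borel" for f :: "real^'n \<Rightarrow> ennreal"
    proof -
      have "(\<integral>\<^sup>+x. f x \<partial>lborel) = (\<integral>\<^sup>+x. f x \<partial>distr lborel borel ((*v) A))"
        using \<open>lborel = _\<close> by (rule arg_cong[where f = "\<lambda>N. integral\<^sup>N N f"])
      also have "\<dots> = (\<integral>\<^sup>+x. f (A *v x) \<partial>lborel)"
        using that by (intro nn_integral_distr) auto
      finally show ?thesis .
    qed
    then have "P A" unfolding P_def detA abs_one ennreal_1 mult_1 by blast
    then show "P (\<chi> i j. mat 1 $ i $ ?\<tau> j)" unfolding A_def .
  next
    fix m n :: 'n assume mn: "m \<noteq> n"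
    define A :: "real^'n^'n" where "A = (\<chi> i j. of_bool (i = m \<and> j = n \<or> i = j))"
    have "A = (\<chi> k. if k = m then row m (mat 1) + 1 *s row n (mat 1) else row k (mat 1))"
      unfolding A_def using mn by (auto simp: vec_eq_iff row_def mat_def)
    then have detA: "det A = 1" using det_row_operation[OF mn, of "mat 1 :: real^'n^'n" 1] by simp
    have Av: "A *v x = x + (x \<bullet> axis n 1) *\<^sub>R axis m 1" for x
    proof -
      have "(A *v x) $ i = x $ i + (if i = m then x $ n else 0)" for i
      proof -
        have "(A *v x) $ i = (\<Sum>j\<in>UNIV. (if j = i then x $ j else 0) + (if j = n then (if i = m then x $ j else 0) else 0))"
          unfolding A_def matrix_vector_mult_def using mn by (auto intro!: sum.cong)
        then show ?thesis by (simp add: sum.distrib)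
      qed
      moreover have "x \<bullet> axis n 1 = x $ n" by (simp add: inner_axis)
      ultimately show ?thesis by (auto simp: vec_eq_iff axis_def)
    qed
    have "(\<integral>\<^sup>+x. f x \<partial>lborel) = (\<integral>\<^sup>+x. f (A *v x) \<partial>lborel)"
      if "f \<in> borel_measurable borel" for f :: "real^'n \<Rightarrow> ennreal"
      unfolding Av using that mn
      by (intro nn_integral_lborel_shear[symmetric]) (auto simp: axis_eq_axis)
    then have "P A" unfolding P_def detA abs_one ennreal_1 mult_1 by blast
    then show "P (\<chi> i j. of_bool (i = m \<and> j = n \<or> i = j))" unfolding A_def .
  qed
  with assms show ?thesis unfolding P_def by blast
qed

section \<open>The multivariate normal law\<close>

definition std_gauss :: "'a::euclidean_space \<Rightarrow> real" where
  "std_gauss x = (\<Prod>b\<in>Basis. std_normal_density (x \<bullet> b))"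

lemma std_gauss_eq: "std_gauss (x :: 'a::euclidean_space) = exp (- (x \<bullet> x) / 2) / sqrt ((2 * pi) ^ DIM('a))"
proof -
  have "std_gauss x = (\<Prod>b\<in>(Basis :: 'a set). 1 / sqrt (2 * pi)) * (\<Prod>b\<in>Basis. exp (- (x \<bullet> b)\<^sup>2 / 2))"
    unfolding std_gauss_def std_normal_density_def prod.distrib ..
  also have "(\<Prod>b\<in>Basis. exp (- (x \<bullet> b)\<^sup>2 / 2)) = exp (\<Sum>b\<in>Basis. - (x \<bullet> b)\<^sup>2 / 2)"
    by (simp add: exp_sum)
  also have "(\<Sum>b\<in>Basis. - (x \<bullet> b)\<^sup>2 / 2) = - (x \<bullet> x) / 2"
    by (simp add: euclidean_inner[of x x] power2_eq_square sum_divide_distrib sum_negf)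
  also have "(\<Prod>b\<in>(Basis :: 'a set). 1 / sqrt (2 * pi)) = 1 / sqrt ((2 * pi) ^ DIM('a))"
    by (simp only: prod_constant power_one_over real_sqrt_power)
  finally show ?thesis by (simp only: mult_1_left times_divide_eq_left)
qed

lemma std_gauss_nonneg: "std_gauss x \<ge> 0"
  unfolding std_gauss_def by (intro prod_nonneg) auto

lemma std_gauss_measurable [measurable]: "std_gauss \<in> borel_measurable borel"
  unfolding std_gauss_def by measurable

lemma std_gauss_char:
  fixes t :: "'a::euclidean_space"
  shows "integrable lborel (\<lambda>x. iexp (t \<bullet> x) * complex_of_real (std_gauss x))" (is ?I)
    and "(\<integral>x. iexp (t \<bullet> x) * complex_of_real (std_gauss x) \<partial>lborel) = complex_of_real (exp (- (t \<bullet> t) / 2))" (is ?E)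
proof -
  interpret product_sigma_finite "\<lambda>_::'a. lborel :: real measure" by standard
  define h where "h b y = iexp ((t \<bullet> b) * y) * complex_of_real (std_normal_density y)" for b :: 'a and y
  define F where "F x = iexp (t \<bullet> x) * complex_of_real (std_gauss x)" for x
  have F: "F (\<Sum>b\<in>Basis. y b *\<^sub>R b) = (\<Prod>b\<in>Basis. h b (y b))" for y
  proof -
    have "t \<bullet> (\<Sum>b\<in>Basis. y b *\<^sub>R b) = (\<Sum>b\<in>Basis. (t \<bullet> b) * y b)"
      by (simp add: inner_sum_right mult.commute)
    then have "iexp (t \<bullet> (\<Sum>b\<in>Basis. y b *\<^sub>R b)) = (\<Prod>b\<in>Basis. iexp ((t \<bullet> b) * y b))"
      by (simp add: exp_sum sum_distrib_left flip: of_real_mult)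
    moreover have "std_gauss (\<Sum>b\<in>Basis. y b *\<^sub>R b) = (\<Prod>b\<in>Basis. std_normal_density (y b))"
      unfolding std_gauss_def by (intro prod.cong refl) simp
    ultimately show ?thesis unfolding F_def h_def by (simp add: prod.distrib)
  qed
  have [measurable]: "F \<in> borel_measurable borel" unfolding F_def by measurable
  have h_int: "integrable lborel (h b)" for b
  proof (rule Bochner_Integration.integrable_bound[of _ std_normal_density])
    show "integrable lborel std_normal_density" by simp
    show "h b \<in> borel_measurable lborel" unfolding h_def by measurable
    show "AE x in lborel. cmod (h b x) \<le> norm (std_normal_density x)" unfolding h_def by (simp add: norm_mult)
  qed
  have h_val: "(\<integral>y. h b y \<partial>lborel) = complex_of_real (exp (- (t \<bullet> b)\<^sup>2 / 2))" for b
  proof -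
    have "char std_normal_distribution (t \<bullet> b) = (\<integral>y. std_normal_density y *\<^sub>R iexp ((t \<bullet> b) * y) \<partial>lborel)"
      unfolding char_def by (subst integral_density) auto
    also have "\<dots> = (\<integral>y. h b y \<partial>lborel)" unfolding h_def by (simp add: scaleR_conv_of_real mult.commute)
    finally show ?thesis by (simp add: char_std_normal_distribution)
  qed
  have "integrable (Pi\<^sub>M Basis (\<lambda>_. lborel)) (\<lambda>y. \<Prod>b\<in>Basis. h b (y b))"
    by (rule product_integrable_prod) (auto intro: h_int)
  then have "integrable (distr (Pi\<^sub>M Basis (\<lambda>_. lborel)) borel (\<lambda>y. \<Sum>b\<in>Basis. y b *\<^sub>R b)) F"
    by (subst integrable_distr_eq) (auto simp: F)
  then have "integrable lborel F" unfolding lborel_eq[symmetric] .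
  then show ?I unfolding F_def .
  have "(\<integral>x. F x \<partial>lborel) = (\<integral>y. (\<Prod>b\<in>Basis. h b (y b)) \<partial>Pi\<^sub>M Basis (\<lambda>_. lborel))"
    by (subst lborel_eq) (simp add: integral_distr F)
  also have "\<dots> = (\<Prod>b\<in>Basis. integral\<^sup>L lborel (h b))"
    by (rule product_integral_prod) (auto intro: h_int)
  also have "\<dots> = (\<Prod>b\<in>Basis. complex_of_real (exp (- (t \<bullet> b)\<^sup>2 / 2)))" by (simp only: h_val)
  also have "\<dots> = complex_of_real (exp (\<Sum>b\<in>Basis. - (t \<bullet> b)\<^sup>2 / 2))" by (simp add: exp_sum)
  also have "(\<Sum>b\<in>Basis. - (t \<bullet> b)\<^sup>2 / 2) = - (t \<bullet> t) / 2"
    by (simp add: euclidean_inner[of t t] power2_eq_square sum_divide_distrib sum_negf)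
  finally show ?E unfolding F_def .
qed

lemma std_gauss_integrable: "integrable lborel (std_gauss :: 'a::euclidean_space \<Rightarrow> real)"
  and std_gauss_integral: "(\<integral>x. std_gauss (x::'a) \<partial>lborel) = 1"
proof -
  show i: "integrable lborel (std_gauss :: 'a \<Rightarrow> real)"
    using std_gauss_char(1)[of "0 :: 'a"] by (simp add: complex_of_real_integrable_eq)
  show "(\<integral>x. std_gauss (x::'a) \<partial>lborel) = 1"
    using std_gauss_char(2)[of "0 :: 'a"] by (simp add: of_real_eq_1_iff)
qed

lemma std_gauss_prob_space: "prob_space (density lborel (\<lambda>x::'a::euclidean_space. ennreal (std_gauss x)))"
proof
  show "emeasure (density lborel (\<lambda>x::'a. ennreal (std_gauss x))) (space (density lborel (\<lambda>x::'a. ennreal (std_gauss x)))) = 1"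
  proof -
    have "(\<integral>\<^sup>+x. ennreal (std_gauss (x::'a)) \<partial>lborel) = ennreal (\<integral>x. std_gauss (x::'a) \<partial>lborel)"
      by (rule nn_integral_eq_integral[OF std_gauss_integrable]) (simp add: std_gauss_nonneg)
    then show ?thesis by (simp add: emeasure_density std_gauss_integral)
  qed
qed

text \<open>
  The real part of the characteristic function, shifted by the phase \<open>b\<close>.
\<close>
lemma std_gauss_cos:
  "(\<integral>x. cos (t \<bullet> x + b) \<partial>density lborel (\<lambda>x::'a::euclidean_space. ennreal (std_gauss x))) = cos b * exp (- (t \<bullet> t) / 2)"
proof -
  have "(\<integral>x. cos (t \<bullet> x + b) \<partial>density lborel (\<lambda>x::'a. ennreal (std_gauss x)))
      = (\<integral>x. Re (iexp b * (iexp (t \<bullet> x) * complex_of_real (std_gauss x))) \<partial>lborel)"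
  proof -
    have "Re (iexp b * (iexp (t \<bullet> x) * complex_of_real (std_gauss x))) = std_gauss x *\<^sub>R cos (t \<bullet> x + b)" for x
      by (simp add: Re_exp Im_exp cos_add algebra_simps)
    then show ?thesis by (subst integral_density) (auto simp: std_gauss_nonneg)
  qed
  also have "\<dots> = Re (\<integral>x. iexp b * (iexp (t \<bullet> x) * complex_of_real (std_gauss x)) \<partial>lborel)"
    by (rule integral_Re) (intro integrable_mult_right std_gauss_char)
  also have "\<dots> = Re (iexp b * complex_of_real (exp (- (t \<bullet> t) / 2)))"
    by (simp only: integral_mult_right_zero std_gauss_char)
  finally show ?thesis by (simp add: Re_exp)
qed

text \<open>
  Gram-Schmidt for the inner product $x \cdot V y$: as long as fewer vectors than the dimension are
  given, some nonzero \<open>x\<close> is orthogonal to all their images under \<open>V\<close>.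
\<close>
lemma positive_definite_orthonormal:
  fixes V :: "real^'n^'n"
  assumes "positive_definite V"
  shows "\<exists>b :: 'n \<Rightarrow> real^'n. \<forall>i\<in>I. \<forall>j\<in>I. b i \<bullet> (V *v b j) = (if i = j then 1 else 0)"
  using finite[of I]
proof (induction I rule: finite_induct)
  case (insert k I)
  then obtain b where b: "\<And>i j. i \<in> I \<Longrightarrow> j \<in> I \<Longrightarrow> b i \<bullet> (V *v b j) = (if i = j then 1 else 0)" by blast
  have sym: "x \<bullet> (V *v y) = y \<bullet> (V *v x)" for x y
  proof -
    have "transpose V = V" using assms unfolding positive_definite_def by blast
    then have "x \<bullet> (V *v y) = x \<bullet> (transpose V *v y)" by simp
    also have "\<dots> = y \<bullet> (V *v x)" by (simp add: dot_lmul_matrix[symmetric] inner_commute)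
    finally show ?thesis .
  qed
  let ?S = "(\<lambda>i. V *v b i) ` I"
  have "dim ?S \<le> card I" using dim_le_card'[of ?S] card_image_le[of I "\<lambda>i. V *v b i"] by simp
  also have "card I < CARD('n)" using insert(2) by (intro psubset_card_mono) auto
  finally have "dim ?S < DIM(real^'n)" by simp
  then obtain x where x: "x \<noteq> 0" "\<And>y. y \<in> span ?S \<Longrightarrow> orthogonal x y"
    using orthogonal_to_subspace_exists by blast
  have ortho: "x \<bullet> (V *v b i) = 0" if "i \<in> I" for i
    using x(2)[of "V *v b i"] that by (auto simp: orthogonal_def span_base)
  define q where "q = x \<bullet> (V *v x)"
  have q: "q > 0" using assms x(1) unfolding positive_definite_def q_def by blast
  \<comment> \<open>Positive definiteness makes q positive, so x can be normalized.\<close>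
  define z where "z = (1 / sqrt q) *\<^sub>R x"
  have zz: "z \<bullet> (V *v z) = 1" unfolding z_def using q
    by (simp add: matrix_vector_mult_scaleR q_def[symmetric] power2_eq_square[symmetric] flip: real_sqrt_mult)
  have zb: "z \<bullet> (V *v b i) = 0" if "i \<in> I" for i unfolding z_def using ortho[OF that] by simp
  show ?case
  proof (intro exI[of _ "b(k := z)"] ballI)
    fix i j assume "i \<in> insert k I" "j \<in> insert k I"
    then show "(b(k := z)) i \<bullet> (V *v (b(k := z)) j) = (if i = j then 1 else 0)"
      using insert(2) b zz zb sym[of "b i" z] by auto
  qed
qed auto

text \<open>
  If the rows of \<open>B\<close> are orthonormal for \<open>V\<close>, then $B V B^\top = 1$, so \<open>A\<close> is the
  inverse of \<open>B\<close>.
\<close>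
lemma positive_definite_factor:
  fixes V :: "real^'n^'n"
  assumes V: "positive_definite V"
  shows "\<exists>A B :: real^'n^'n. V = A ** transpose A \<and> A ** B = mat 1 \<and> B ** A = mat 1"
proof -
  obtain b :: "'n \<Rightarrow> real^'n" where b: "\<And>i j. b i \<bullet> (V *v b j) = (if i = j then 1 else 0)"
    using positive_definite_orthonormal[OF V, of UNIV] by auto
  define B :: "real^'n^'n" where "B = (\<chi> i. b i)"
  define A where "A = V ** transpose B"
  have "(B ** A) $ i $ j = b i \<bullet> (V *v b j)" for i j
    unfolding A_def B_def by (simp add: matrix_matrix_mult_def matrix_vector_mult_def inner_vec_def transpose_def)
  then have BA: "B ** A = mat 1" by (simp add: vec_eq_iff b mat_def)
  then have AB: "A ** B = mat 1" using matrix_left_right_inverse by blast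
  have "A ** transpose A = A ** (B ** transpose V)"
    unfolding A_def by (simp add: matrix_transpose_mul)
  also have "\<dots> = V" using V AB unfolding positive_definite_def by (simp add: matrix_mul_assoc)
  finally have "V = A ** transpose A" by (rule sym)
  with AB BA show ?thesis by blast
qed

text \<open>
  Under $x = A y$ the quadratic form of \<open>V\<close>'s inverse becomes $y \cdot y$, and the Jacobian
  $\lvert\det A\rvert$ is the square root of $\det V$.
\<close>
lemma multivariate_normal_eq_distr:
  fixes V A B :: "real^'n^'n"
  assumes VA: "V = A ** transpose A" and AB: "A ** B = mat 1" and BA: "B ** A = mat 1"
  shows "multivariate_normal 0 V = distr (density lborel (\<lambda>x. ennreal (std_gauss x))) borel ((*v) A)"
proof -
  have BtAt: "transpose B ** transpose A = mat 1" "transpose A ** transpose B = mat 1"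
    using AB BA by (metis matrix_transpose_mul transpose_mat)+
  have "V ** (transpose B ** B) = A ** (transpose A ** transpose B) ** B" unfolding VA by (simp add: matrix_mul_assoc)
  then have i1: "V ** (transpose B ** B) = mat 1" using BtAt AB by simp
  then have inv: "matrix_inv V = transpose B ** B"
  proof -
    have "invertible V" using i1 matrix_left_right_inverse unfolding invertible_def by blast
    then have "matrix_inv V ** V = mat 1"
      unfolding matrix_inv_def invertible_def by (rule someI2_ex) simp
    then have "matrix_inv V ** (V ** (transpose B ** B)) = transpose B ** B" by (simp add: matrix_mul_assoc)
    then show ?thesis unfolding i1 by simp
  qed
  have quad: "(A *v y) \<bullet> (matrix_inv V *v (A *v y)) = y \<bullet> y" for y
  proof -
    have "matrix_inv V *v (A *v y) = transpose B *v ((B ** A) *v y)"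
      unfolding inv by (simp add: matrix_vector_mul_assoc matrix_mul_assoc)
    then have "(A *v y) \<bullet> (matrix_inv V *v (A *v y)) = (A *v y) \<bullet> (transpose B *v y)" using BA by simp
    also have "\<dots> = (B *v (A *v y)) \<bullet> y" by (simp add: dot_lmul_matrix inner_commute[of _ y] inner_commute[of "A *v y"])
    also have "\<dots> = y \<bullet> y" by (simp add: matrix_vector_mul_assoc BA)
    finally show ?thesis .
  qed
  have detA: "det A \<noteq> 0" using AB by (metis det_I det_mul mult_zero_left zero_neq_one)
  have detV: "det V = (det A)\<^sup>2" unfolding VA by (simp add: det_mul power2_eq_square)
  define f where "f x = exp (- (x \<bullet> (matrix_inv V *v x)) / 2) / sqrt ((2 * pi) ^ CARD('n) * det V)" for x
  have fA: "\<bar>det A\<bar> * f (A *v y) = std_gauss y" for y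
    unfolding f_def quad std_gauss_eq using detA by (simp add: detV real_sqrt_mult)
  have f0: "f x \<ge> 0" for x unfolding f_def detV by simp
  have [measurable]: "f \<in> borel_measurable borel" unfolding f_def by measurable
  show ?thesis
  proof (rule measure_eqI)
    fix S assume "S \<in> sets (multivariate_normal 0 V)"
    then have [measurable]: "S \<in> sets borel" by (simp add: multivariate_normal_def)
    have "emeasure (multivariate_normal 0 V) S = (\<integral>\<^sup>+x. ennreal (f x) * indicator S x \<partial>lborel)"
      unfolding multivariate_normal_def f_def[symmetric] diff_zero by (rule emeasure_density) auto
    also have "\<dots> = ennreal \<bar>det A\<bar> * (\<integral>\<^sup>+y. ennreal (f (A *v y)) * indicator S (A *v y) \<partial>lborel)"
      by (rule nn_integral_lborel_linear[OF detA]) measurable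
    also have "\<dots> = (\<integral>\<^sup>+y. ennreal \<bar>det A\<bar> * (ennreal (f (A *v y)) * indicator S (A *v y)) \<partial>lborel)"
      by (rule nn_integral_cmult[symmetric]) measurable
    also have "\<dots> = (\<integral>\<^sup>+y. ennreal (std_gauss y) * indicator ((*v) A -` S) y \<partial>lborel)"
      by (intro nn_integral_cong) (simp add: fA[symmetric] ennreal_mult f0 mult.assoc indicator_def)
    also have "\<dots> = emeasure (density lborel (\<lambda>x. ennreal (std_gauss x))) ((*v) A -` S)"
    proof (rule emeasure_density[symmetric])
      show "(*v) A -` S \<in> sets lborel"
        using measurable_sets_borel[OF measurable_matrix_vector_mult, of S A] by simp
    qed measurable
    also have "\<dots> = emeasure (distr (density lborel (\<lambda>x. ennreal (std_gauss x))) borel ((*v) A)) S"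
      by (simp add: emeasure_distr space_density)
    finally show "emeasure (multivariate_normal 0 V) S = emeasure (distr (density lborel (\<lambda>x. ennreal (std_gauss x))) borel ((*v) A)) S" .
  qed (simp add: multivariate_normal_def)
qed

lemma multivariate_normal_prob_space:
  assumes "positive_definite (V :: real^'n^'n)"
  shows "prob_space (multivariate_normal 0 V)"
proof -
  obtain A B :: "real^'n^'n" where AB: "V = A ** transpose A" "A ** B = mat 1" "B ** A = mat 1"
    using positive_definite_factor[OF assms] by blast
  show ?thesis unfolding multivariate_normal_eq_distr[OF AB]
    by (rule prob_space.prob_space_distr[OF std_gauss_prob_space]) measurable
qed

lemma multivariate_normal_cos:
  assumes "positive_definite (V :: real^'n^'n)"
  shows "(\<integral>x. cos (t \<bullet> x + b) \<partial>multivariate_normal 0 V) = cos b * exp (- (t \<bullet> (V *v t)) / 2)"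
proof -
  obtain A B :: "real^'n^'n" where AB: "V = A ** transpose A" "A ** B = mat 1" "B ** A = mat 1"
    using positive_definite_factor[OF assms] by blast
  have adj: "x \<bullet> (A *v y) = (transpose A *v x) \<bullet> y" for x y
    by (simp add: dot_lmul_matrix)
  have "(\<integral>x. cos (t \<bullet> x + b) \<partial>multivariate_normal 0 V) =
     (\<integral>y. cos ((transpose A *v t) \<bullet> y + b) \<partial>density lborel (\<lambda>x. ennreal (std_gauss x)))"
    unfolding multivariate_normal_eq_distr[OF AB] adj[symmetric]
    by (rule integral_distr) measurable
  also have "\<dots> = cos b * exp (- ((transpose A *v t) \<bullet> (transpose A *v t)) / 2)" by (rule std_gauss_cos)
  also have "(transpose A *v t) \<bullet> (transpose A *v t) = t \<bullet> (V *v t)"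
    unfolding AB(1) matrix_vector_mul_assoc[symmetric] by (rule adj[symmetric])
  finally show ?thesis .
qed

section \<open>Convergence to zero in probability\<close>

text \<open>
  Convergence to zero in probability, expressed by the Ky Fan type functional $E \min(1, |X|)$:
  it is subadditive and bounds differences of cosines, which is how it is used.
\<close>
definition vanishing :: "'a measure \<Rightarrow> (nat \<Rightarrow> 'a \<Rightarrow> real) \<Rightarrow> bool" where
  "vanishing M X \<longleftrightarrow> (\<forall>n. X n \<in> borel_measurable M) \<and> (\<lambda>n. \<integral>w. min 1 \<bar>X n w\<bar> \<partial>M) \<longlonglongrightarrow> 0"

lemma vanishing_measurable: "vanishing M X \<Longrightarrow> X n \<in> borel_measurable M"
  unfolding vanishing_def by blast

context prob_space
begin

lemma integrable_min_1 [intro]: "X \<in> borel_measurable M \<Longrightarrow> integrable M (\<lambda>w. min 1 \<bar>X w :: real\<bar>)"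
  by (intro integrable_const_bound[of _ 1]) auto

lemma vanishingI:
  assumes [measurable]: "\<And>n. X n \<in> borel_measurable M"
    and "\<And>e. e > 0 \<Longrightarrow> eventually (\<lambda>n. expectation (\<lambda>w. min 1 \<bar>X n w\<bar>) \<le> e) sequentially"
  shows "vanishing M X"
  unfolding vanishing_def
proof (intro conjI allI assms(1) order_tendstoI)
  fix a :: real assume "a < 0"
  have "0 \<le> expectation (\<lambda>w. min 1 \<bar>X n w\<bar>)" for n by (intro integral_nonneg_AE) auto
  with \<open>a < 0\<close> show "eventually (\<lambda>n. a < expectation (\<lambda>w. min 1 \<bar>X n w\<bar>)) sequentially"
    by (intro always_eventually allI) (rule less_le_trans)
next
  fix a :: real assume "0 < a"
  then have "eventually (\<lambda>n. expectation (\<lambda>w. min 1 \<bar>X n w\<bar>) \<le> a / 2) sequentially" by (intro assms(2)) simp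
  then show "eventually (\<lambda>n. expectation (\<lambda>w. min 1 \<bar>X n w\<bar>) < a) sequentially"
    by eventually_elim (use \<open>0 < a\<close> in linarith)
qed

text \<open>
  The domination is required only from some index on, since the ratio of two blocks makes sense
  only once the denominator block is not empty.
\<close>
lemma vanishing_dominated:
  assumes [measurable]: "\<And>n. X n \<in> borel_measurable M" and Y: "vanishing M Y"
    and dom: "eventually (\<lambda>n. AE w in M. min 1 \<bar>X n w\<bar> \<le> C * min 1 \<bar>Y n w\<bar>) sequentially"
  shows "vanishing M X"
  unfolding vanishing_def
proof (intro conjI allI assms(1))
  note [measurable] = vanishing_measurable[OF Y]
  have "(\<lambda>n. C * expectation (\<lambda>w. min 1 \<bar>Y n w\<bar>)) \<longlonglongrightarrow> C * 0"
    using Y unfolding vanishing_def by (intro tendsto_mult_left) auto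
  then have "(\<lambda>n. C * expectation (\<lambda>w. min 1 \<bar>Y n w\<bar>)) \<longlonglongrightarrow> 0" by simp
  then show "(\<lambda>n. expectation (\<lambda>w. min 1 \<bar>X n w\<bar>)) \<longlonglongrightarrow> 0"
  proof (rule tendsto_sandwich[OF _ _ tendsto_const, rotated -1])
    show "eventually (\<lambda>n. 0 \<le> expectation (\<lambda>w. min 1 \<bar>X n w\<bar>)) sequentially"
      by (intro always_eventually allI integral_nonneg_AE) auto
    show "eventually (\<lambda>n. expectation (\<lambda>w. min 1 \<bar>X n w\<bar>) \<le> C * expectation (\<lambda>w. min 1 \<bar>Y n w\<bar>)) sequentially"
      using dom
    proof eventually_elim
      case (elim n)
      have "expectation (\<lambda>w. min 1 \<bar>X n w\<bar>) \<le> expectation (\<lambda>w. C * min 1 \<bar>Y n w\<bar>)"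
        using elim by (intro integral_mono_AE integrable_mult_right integrable_min_1) measurable
      then show ?case by simp
    qed
  qed
qed

lemma vanishing_add:
  assumes X: "vanishing M X" and Y: "vanishing M Y"
  shows "vanishing M (\<lambda>n w. X n w + Y n w)"
proof (rule vanishingI)
  note [measurable] = vanishing_measurable[OF X] vanishing_measurable[OF Y]
  show "(\<lambda>w. X n w + Y n w) \<in> borel_measurable M" for n by measurable
  fix e :: real assume "e > 0"
  have "(\<lambda>n. expectation (\<lambda>w. min 1 \<bar>X n w\<bar>) + expectation (\<lambda>w. min 1 \<bar>Y n w\<bar>)) \<longlonglongrightarrow> 0"
    using X Y unfolding vanishing_def by (auto intro: tendsto_add_zero)
  from order_tendstoD(2)[OF this \<open>e > 0\<close>]
  show "eventually (\<lambda>n. expectation (\<lambda>w. min 1 \<bar>X n w + Y n w\<bar>) \<le> e) sequentially"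
  proof eventually_elim
    case (elim n)
    have "expectation (\<lambda>w. min 1 \<bar>X n w + Y n w\<bar>) \<le> expectation (\<lambda>w. min 1 \<bar>X n w\<bar> + min 1 \<bar>Y n w\<bar>)"
      by (intro integral_mono Bochner_Integration.integrable_add integrable_min_1) auto
    also have "\<dots> = expectation (\<lambda>w. min 1 \<bar>X n w\<bar>) + expectation (\<lambda>w. min 1 \<bar>Y n w\<bar>)"
      by (intro Bochner_Integration.integral_add integrable_min_1) auto
    finally show ?case using elim by linarith
  qed
qed

lemma vanishing_mult_vanishing:
  assumes X: "vanishing M X" and Y: "vanishing M Y"
  shows "vanishing M (\<lambda>n w. X n w * Y n w)"
proof -
  note [measurable] = vanishing_measurable[OF X] vanishing_measurable[OF Y]
  have b: "min 1 \<bar>x * y\<bar> \<le> 1 * min 1 \<bar>\<bar>x\<bar> + \<bar>y\<bar>\<bar>" for x y :: real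
  proof (cases "\<bar>x\<bar> \<le> 1")
    case True
    then have "\<bar>x * y\<bar> \<le> 1 * \<bar>y\<bar>" unfolding abs_mult by (intro mult_right_mono) auto
    then have "\<bar>x * y\<bar> \<le> \<bar>\<bar>x\<bar> + \<bar>y\<bar>\<bar>" by simp
    then show ?thesis unfolding mult_1_left by (intro min.mono order_refl)
  next
    case False
    then have "1 \<le> \<bar>\<bar>x\<bar> + \<bar>y\<bar>\<bar>" by simp
    then show ?thesis by simp
  qed
  have V: "vanishing M (\<lambda>n w. \<bar>X n w\<bar> + \<bar>Y n w\<bar>)"
    using X Y by (intro vanishing_add) (auto simp: vanishing_def)
  show ?thesis
    by (rule vanishing_dominated[OF _ V, where C = 1]) (measurable, intro always_eventually allI AE_I2 b)
qed

lemma vanishing_cmult: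
  assumes X: "vanishing M X"
  shows "vanishing M (\<lambda>n w. a * X n w)"
proof -
  note [measurable] = vanishing_measurable[OF X]
  have "min 1 \<bar>a * x\<bar> \<le> (1 + \<bar>a\<bar>) * min 1 \<bar>x\<bar>" for x :: real
  proof (cases "\<bar>x\<bar> \<le> 1")
    case True
    have "\<bar>a * x\<bar> \<le> (1 + \<bar>a\<bar>) * \<bar>x\<bar>" unfolding abs_mult by (intro mult_right_mono) auto
    with True show ?thesis by (simp add: min_def)
  next
    case False
    then show ?thesis by (simp add: min.coboundedI1)
  qed
  then show ?thesis
    by (intro vanishing_dominated[OF _ X, where C = "1 + \<bar>a\<bar>"] always_eventually allI AE_I2) measurable
qed

lemma vanishing_zero: "vanishing M (\<lambda>n w. 0)"
  unfolding vanishing_def by simp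

lemma vanishing_sum:
  assumes "finite I" "\<And>i. i \<in> I \<Longrightarrow> vanishing M (X i)"
  shows "vanishing M (\<lambda>n w. \<Sum>i\<in>I. X i n w)"
  using assms
proof (induction I rule: finite_induct)
  case (insert i I)
  then have "vanishing M (\<lambda>n w. X i n w + (\<Sum>i\<in>I. X i n w))" by (intro vanishing_add) auto
  with insert show ?case by simp
qed (simp add: vanishing_zero)

text \<open>
  A sequence bounded in $L^2$ is tight, and vanishing sequences absorb tight factors.
\<close>
lemma vanishing_mult_L2:
  assumes X: "vanishing M X" and [measurable]: "\<And>n. Z n \<in> borel_measurable M"
    and Z: "\<And>n. integrable M (\<lambda>w. (Z n w)\<^sup>2)" "\<And>n. expectation (\<lambda>w. (Z n w)\<^sup>2) \<le> C"
  shows "vanishing M (\<lambda>n w. X n w * Z n w)"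
proof (rule vanishingI)
  note [measurable] = vanishing_measurable[OF X]
  show "(\<lambda>w. X n w * Z n w) \<in> borel_measurable M" for n by measurable
  fix e :: real assume e: "e > 0"
  have C: "C \<ge> 0" using order_trans[OF _ Z(2)] by (auto intro: integral_nonneg_AE)
  \<comment> \<open>The truncation level for Z: large values contribute at most C / L^2, which is at most e / 2.\<close>
  define L where "L = 1 + 2 * C / e"
  have L: "L \<ge> 1" using C e unfolding L_def by simp
  have "C / L\<^sup>2 \<le> C / L" using L C by (intro divide_left_mono) (auto simp: power2_eq_square)
  also have "C / L \<le> e / 2" using C e L unfolding L_def by (simp add: field_simps)
  finally have CL: "C / L\<^sup>2 \<le> e / 2" .
  have bound: "min 1 \<bar>x * z\<bar> \<le> L * min 1 \<bar>x\<bar> + z\<^sup>2 / L\<^sup>2" for x z :: real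
  proof (cases "\<bar>z\<bar> \<le> L")
    case True
    have "\<bar>x * z\<bar> \<le> L * \<bar>x\<bar>" unfolding abs_mult using True by (subst mult.commute) (intro mult_right_mono, auto)
    then have "min 1 \<bar>x * z\<bar> \<le> L * min 1 \<bar>x\<bar>" using L by (auto simp: min_def)
    moreover have "z\<^sup>2 / L\<^sup>2 \<ge> 0" by simp
    ultimately show ?thesis by linarith
  next
    case False
    then have "L\<^sup>2 \<le> z\<^sup>2" using L by (intro abs_le_square_iff[THEN iffD1]) auto
    then have "1 \<le> z\<^sup>2 / L\<^sup>2" using L by simp
    moreover have "L * min 1 \<bar>x\<bar> \<ge> 0" using L by simp
    ultimately show ?thesis by linarith
  qed
  have "(\<lambda>n. L * expectation (\<lambda>w. min 1 \<bar>X n w\<bar>)) \<longlonglongrightarrow> 0"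
    using X unfolding vanishing_def by (auto intro: tendsto_mult_right_zero)
  from order_tendstoD(2)[OF this, of "e/2"] e
  have "eventually (\<lambda>n. L * expectation (\<lambda>w. min 1 \<bar>X n w\<bar>) < e / 2) sequentially" by simp
  then show "eventually (\<lambda>n. expectation (\<lambda>w. min 1 \<bar>X n w * Z n w\<bar>) \<le> e) sequentially"
  proof eventually_elim
    case (elim n)
    have i: "integrable M (\<lambda>w. L * min 1 \<bar>X n w\<bar>)" "integrable M (\<lambda>w. (Z n w)\<^sup>2 / L\<^sup>2)"
      using Z(1) by (auto intro!: integrable_min_1)
    have "expectation (\<lambda>w. min 1 \<bar>X n w * Z n w\<bar>) \<le> expectation (\<lambda>w. L * min 1 \<bar>X n w\<bar> + (Z n w)\<^sup>2 / L\<^sup>2)"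
      using i bound by (intro integral_mono Bochner_Integration.integrable_add integrable_min_1) auto
    also have "\<dots> = L * expectation (\<lambda>w. min 1 \<bar>X n w\<bar>) + expectation (\<lambda>w. (Z n w)\<^sup>2) / L\<^sup>2"
      using i by (subst Bochner_Integration.integral_add) auto
    also have "expectation (\<lambda>w. (Z n w)\<^sup>2) / L\<^sup>2 \<le> C / L\<^sup>2" by (intro divide_right_mono Z) simp
    finally show ?case using elim CL by linarith
  qed
qed

lemma vanishing_const:
  assumes "a \<longlonglongrightarrow> 0"
  shows "vanishing M (\<lambda>n w. a n)"
proof -
  have "(\<lambda>n. min 1 \<bar>a n\<bar>) \<longlonglongrightarrow> min 1 \<bar>0\<bar>" using assms by (intro tendsto_intros)
  then show ?thesis unfolding vanishing_def by (simp add: prob_space)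
qed

lemma vanishing_L2:
  assumes [measurable]: "\<And>n. Z n \<in> borel_measurable M"
    and Z: "\<And>n. integrable M (\<lambda>w. (Z n w)\<^sup>2)" "\<And>n. expectation (\<lambda>w. (Z n w)\<^sup>2) \<le> C"
    and a: "a \<longlonglongrightarrow> 0"
  shows "vanishing M (\<lambda>n w. a n * Z n w)"
  by (rule vanishing_mult_L2[OF vanishing_const[OF a] assms(1-3)])

lemma vanishing_quotient:
  assumes X: "vanishing M X" and "\<mu> > 0"
  shows "vanishing M (\<lambda>n w. \<mu> / (\<mu> + X n w) - 1)"
proof (rule vanishing_dominated[where C = "1 + 2 / \<mu>"])
  note [measurable] = vanishing_measurable[OF X]
  show "(\<lambda>w. \<mu> / (\<mu> + X n w) - 1) \<in> borel_measurable M" for n by measurable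
  have b: "min 1 \<bar>\<mu> / (\<mu> + x) - 1\<bar> \<le> (1 + 2 / \<mu>) * min 1 \<bar>x\<bar>" for x :: real
  proof (cases "\<bar>x\<bar> \<le> 1 \<and> \<bar>x\<bar> \<le> \<mu> / 2")
    case True
    then have h: "\<mu> + x \<ge> \<mu> / 2" by linarith
    with assms(2) have pos: "\<mu> + x > 0" by linarith
    have "\<mu> / (\<mu> + x) - 1 = - x / (\<mu> + x)" using pos by (simp add: field_simps)
    then have "\<bar>\<mu> / (\<mu> + x) - 1\<bar> = \<bar>x\<bar> / (\<mu> + x)" using pos by simp
    also have "\<dots> \<le> \<bar>x\<bar> / (\<mu> / 2)" using h assms(2) by (intro divide_left_mono mult_pos_pos pos) auto
    also have "\<dots> = (2 / \<mu>) * \<bar>x\<bar>" by simp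
    also have "\<dots> \<le> (1 + 2 / \<mu>) * \<bar>x\<bar>" by (intro mult_right_mono) auto
    finally have "\<bar>\<mu> / (\<mu> + x) - 1\<bar> \<le> (1 + 2 / \<mu>) * min 1 \<bar>x\<bar>" using True by simp
    then show ?thesis by (rule min.coboundedI2)
  next
    case False
    have "1 \<le> (1 + 2 / \<mu>) * min 1 \<bar>x\<bar>"
    proof (cases "\<bar>x\<bar> \<le> 1")
      case True
      with False have "\<bar>x\<bar> > \<mu> / 2" by simp
      then have "1 \<le> (2 / \<mu>) * \<bar>x\<bar>" using assms(2) by (simp add: field_simps)
      also have "\<dots> \<le> (1 + 2 / \<mu>) * \<bar>x\<bar>" by (intro mult_right_mono) auto
      finally show ?thesis using True by simp
    qed (use assms(2) in simp)
    then show ?thesis by (rule min.coboundedI1)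
  qed
  show "eventually (\<lambda>n. AE w in M. min 1 \<bar>\<mu> / (\<mu> + X n w) - 1\<bar> \<le> (1 + 2 / \<mu>) * min 1 \<bar>X n w\<bar>) sequentially"
    by (intro always_eventually allI AE_I2 b)
qed (rule X)

text \<open>
  Slutsky's lemma for the test functions of \<open>multivariate_levy_continuity\<close>.
\<close>
lemma vanishing_cos:
  assumes A[measurable]: "\<And>n. A n \<in> borel_measurable M" and B[measurable]: "\<And>n. B n \<in> borel_measurable M"
    and V: "vanishing M (\<lambda>n w. A n w - B n w)"
    and lim: "(\<lambda>n. expectation (\<lambda>w. cos (B n w + b))) \<longlonglongrightarrow> l"
  shows "(\<lambda>n. expectation (\<lambda>w. cos (A n w + b))) \<longlonglongrightarrow> l"
proof -
  have i: "integrable M (\<lambda>w. cos (X w + b))" if [measurable]: "X \<in> borel_measurable M" for X :: "'a \<Rightarrow> real"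
    by (intro integrable_const_bound[of _ 1]) auto
  have lip: "\<bar>cos (x + b) - cos (y + b)\<bar> \<le> 2 * min 1 \<bar>x - y\<bar>" for x y :: real
  proof -
    have "cos (x + b) - cos (y + b) = 2 * (sin ((x + b + (y + b)) / 2) * sin ((y + b - (x + b)) / 2))"
      by (simp add: cos_diff_cos mult.assoc)
    then have "\<bar>cos (x + b) - cos (y + b)\<bar> = 2 * (\<bar>sin ((x + b + (y + b)) / 2)\<bar> * \<bar>sin ((y - x) / 2)\<bar>)"
      by (simp add: abs_mult)
    also have "\<dots> \<le> 2 * (1 * \<bar>sin ((y - x) / 2)\<bar>)" by (intro mult_left_mono mult_right_mono) auto
    also have "\<dots> \<le> 2 * min 1 \<bar>x - y\<bar>"
    proof -
      have "\<bar>(y - x) / 2\<bar> \<le> \<bar>x - y\<bar>" by (auto simp: abs_if field_simps)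
      with abs_sin_x_le_abs_x[of "(y - x) / 2"] have "\<bar>sin ((y - x) / 2)\<bar> \<le> \<bar>x - y\<bar>" by (rule order_trans)
      then show ?thesis by simp
    qed
    finally show ?thesis .
  qed
  have "(\<lambda>n. expectation (\<lambda>w. cos (A n w + b)) - expectation (\<lambda>w. cos (B n w + b))) \<longlonglongrightarrow> 0"
  proof (rule Lim_null_comparison)
    show "(\<lambda>n. 2 * expectation (\<lambda>w. min 1 \<bar>A n w - B n w\<bar>)) \<longlonglongrightarrow> 0"
      using V unfolding vanishing_def by (auto intro: tendsto_mult_right_zero)
    have "norm (expectation (\<lambda>w. cos (A n w + b)) - expectation (\<lambda>w. cos (B n w + b)))
        \<le> 2 * expectation (\<lambda>w. min 1 \<bar>A n w - B n w\<bar>)" for n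
    proof -
      have "\<bar>expectation (\<lambda>w. cos (A n w + b)) - expectation (\<lambda>w. cos (B n w + b))\<bar>
         = \<bar>expectation (\<lambda>w. cos (A n w + b) - cos (B n w + b))\<bar>" by (simp add: i)
      also have "\<dots> \<le> expectation (\<lambda>w. \<bar>cos (A n w + b) - cos (B n w + b)\<bar>)" by (rule integral_abs_bound)
      also have "\<dots> \<le> expectation (\<lambda>w. 2 * min 1 \<bar>A n w - B n w\<bar>)"
        by (intro integral_mono integrable_abs Bochner_Integration.integrable_diff i integrable_mult_right integrable_min_1 lip) auto
      finally show ?thesis by simp
    qed
    then show "eventually (\<lambda>n. norm (expectation (\<lambda>w. cos (A n w + b)) - expectation (\<lambda>w. cos (B n w + b)))
        \<le> 2 * expectation (\<lambda>w. min 1 \<bar>A n w - B n w\<bar>)) sequentially" by (intro always_eventually allI)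
  qed
  from tendsto_add[OF this lim] show ?thesis by simp
qed

end

section \<open>Sums of the largest order statistics\<close>

lemma nth_gt_iff_count:
  fixes ys :: "real list"
  assumes "sorted_wrt (\<ge>) ys" "i < length ys"
  shows "s < ys ! i \<longleftrightarrow> i < length (filter (\<lambda>y. s < y) ys)"
  using assms
proof (induction ys arbitrary: i)
  case (Cons y ys)
  show ?case
  proof (cases "s < y")
    case True
    then show ?thesis using Cons by (cases i) auto
  next
    case False
    then have "\<forall>z\<in>set (y # ys). z \<le> s" using Cons.prems(1) by force
    then have "filter (\<lambda>y. s < y) (y # ys) = []" and "(y # ys) ! i \<le> s"
      using Cons.prems(2) nth_mem[of i "y # ys"] by (auto simp: filter_empty_conv)
    then show ?thesis by simp
  qed
qed simp

text \<open>
  The number of incomes above a level is a sum of independent indicators, and it determines the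
  order statistics through \<open>order_stat_gt_iff\<close>.
\<close>
definition exceed :: "(nat \<Rightarrow> 'a \<Rightarrow> real) \<Rightarrow> nat \<Rightarrow> real \<Rightarrow> 'a \<Rightarrow> nat" where
  "exceed Y n s w = card {j \<in> {1..n}. s < Y j w}"

lemma exceed_le: "exceed Y n s w \<le> n"
proof -
  have "exceed Y n s w \<le> card {1..n}" unfolding exceed_def by (intro card_mono) auto
  then show ?thesis by simp
qed

lemma order_stat_gt_iff:
  assumes "i < n"
  shows "s < order_stat Y n (Suc i) w \<longleftrightarrow> i < exceed Y n s w"
proof -
  let ?xs = "map (\<lambda>j. Y j w) [1..<Suc n]"
  have "sorted_wrt (\<ge>) (rev (sort ?xs))" by (simp add: sorted_wrt_rev)
  then have "s < order_stat Y n (Suc i) w \<longleftrightarrow> i < length (filter (\<lambda>y. s < y) (rev (sort ?xs)))"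
    unfolding order_stat_def using nth_gt_iff_count[of "rev (sort ?xs)" i s] assms by simp
  also have "length (filter (\<lambda>y. s < y) (rev (sort ?xs))) = length (filter (\<lambda>y. s < y) ?xs)"
    by (metis mset_filter mset_rev mset_sort size_mset)
  also have "\<dots> = length (filter (\<lambda>j. s < Y j w) [1..<Suc n])" by (simp add: filter_map o_def)
  also have "\<dots> = card (set (filter (\<lambda>j. s < Y j w) [1..<Suc n]))"
    by (rule distinct_card[symmetric]) simp
  also have "set (filter (\<lambda>j. s < Y j w) [1..<Suc n]) = {j \<in> {1..n}. s < Y j w}" by auto
  finally show ?thesis unfolding exceed_def .
qed

lemma sum_order_stat:
  fixes \<phi> :: "real \<Rightarrow> real"
  shows "(\<Sum>i<n. \<phi> (order_stat Y n (Suc i) w)) = (\<Sum>j=1..n. \<phi> (Y j w))"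
proof -
  let ?xs = "map (\<lambda>j. Y j w) [1..<Suc n]"
  have "(\<Sum>i<n. \<phi> (order_stat Y n (Suc i) w)) = sum_list (map \<phi> (rev (sort ?xs)))"
  proof -
    have len: "length (rev (sort ?xs)) = n" by (simp del: upt_Suc)
    have "sum_list (map \<phi> (rev (sort ?xs))) = (\<Sum>i<n. map \<phi> (rev (sort ?xs)) ! i)"
      unfolding sum_list_sum_nth length_map len atLeast0LessThan ..
    also have "\<dots> = (\<Sum>i<n. \<phi> (rev (sort ?xs) ! i))"
      by (intro sum.cong refl nth_map) (simp only: len lessThan_iff)
    finally show ?thesis unfolding order_stat_def by simp
  qed
  also have "\<dots> = sum_mset (mset (map \<phi> (rev (sort ?xs))))" by (rule sum_mset_sum_list[symmetric])
  also have "mset (map \<phi> (rev (sort ?xs))) = mset (map \<phi> ?xs)" by (metis mset_map mset_rev mset_sort)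
  also have "sum_mset (mset (map \<phi> ?xs)) = sum_list (map \<phi> ?xs)" by (rule sum_mset_sum_list)
  also have "\<dots> = (\<Sum>j\<in>set [1..<Suc n]. \<phi> (Y j w))" by (subst sum_list_distinct_conv_sum_set[symmetric]) (simp_all add: o_def)
  also have "set [1..<Suc n] = {1..n}" by auto
  finally show ?thesis .
qed

lemma exceed_measurable:
  assumes "\<And>j. j \<ge> 1 \<Longrightarrow> Y j \<in> borel_measurable M"
  shows "exceed Y n s \<in> measurable M (count_space UNIV)"
proof -
  have "exceed Y n s = (\<lambda>w. \<Sum>j\<in>{1..n}. if s < Y j w then 1 else 0)"
    unfolding exceed_def by (rule ext) (simp add: sum.If_cases Int_def)
  also have "\<dots> \<in> measurable M (count_space UNIV)" using assms by measurable
  finally show ?thesis .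
qed

lemma order_stat_measurable:
  assumes Y: "\<And>j. j \<ge> 1 \<Longrightarrow> Y j \<in> borel_measurable M" and i: "1 \<le> i" "i \<le> n"
  shows "order_stat Y n i \<in> borel_measurable M"
proof -
  obtain k where k: "i = Suc k" "k < n" using i by (cases i) auto
  show ?thesis
  proof (subst borel_measurable_iff_greater, rule allI)
    fix s
    have "{w \<in> space M. s < order_stat Y n i w} = {w \<in> space M. k < exceed Y n s w}"
      unfolding k(1) order_stat_gt_iff[OF k(2)] ..
    also have "\<dots> \<in> sets M" using exceed_measurable[OF Y] by measurable
    finally show "{w \<in> space M. s < order_stat Y n i w} \<in> sets M" .
  qed
qed

text \<open>
  The difference is $\sum_{i<m} (t - y_i)^+ + \sum_{i \ge m} (y_i - t)^+$. Its nonzero terms have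
  their index between \<open>m\<close> and \<open>N t\<close>, and the two conditions on \<open>N\<close> say that all these
  terms are at most \<open>e\<close>.
\<close>
lemma top_sum_bound:
  fixes y :: "nat \<Rightarrow> real" and N :: "real \<Rightarrow> nat"
  assumes cnt: "\<And>s i. i < n \<Longrightarrow> s < y i \<longleftrightarrow> i < N s" and mn: "m \<le> n" and Nn: "N t \<le> n"
    and e: "0 \<le> e" "N (t + e) \<le> m" "m \<le> N (t - e)"
  shows "\<bar>(\<Sum>i<m. y i) - (real m * t + (\<Sum>i<n. max 0 (y i - t)))\<bar> \<le> e * \<bar>real (N t) - real m\<bar>"
proof -
  define r where "r i = (if i < m then max 0 (t - y i) else max 0 (y i - t))" for i
  define A where "A = {min m (N t)..<max m (N t)}"
  have split: "(\<Sum>i<n. f i) = (\<Sum>i<m. f i) + (\<Sum>i=m..<n. f i)" for f :: "nat \<Rightarrow> real"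
    using mn by (metis atLeast0LessThan sum.atLeastLessThan_concat zero_le)
  have "(real m * t + (\<Sum>i<n. max 0 (y i - t))) - (\<Sum>i<m. y i) = (\<Sum>i<m. t - y i + max 0 (y i - t)) + (\<Sum>i=m..<n. max 0 (y i - t))"
    by (simp add: split sum.distrib sum_subtractf)
  also have "\<dots> = (\<Sum>i<m. r i) + (\<Sum>i=m..<n. r i)"
    unfolding r_def by (intro arg_cong2[where f = "(+)"] sum.cong) auto
  also have "\<dots> = (\<Sum>i<n. r i)" by (rule split[symmetric])
  finally have eq: "(real m * t + (\<Sum>i<n. max 0 (y i - t))) - (\<Sum>i<m. y i) = (\<Sum>i<n. r i)" .
  have r0: "0 \<le> r i" for i unfolding r_def by simp
  have rb: "r i \<le> (if i \<in> A then e else 0)" if i: "i < n" for i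
    using cnt[OF i, of t] cnt[OF i, of "t + e"] cnt[OF i, of "t - e"] e
    unfolding r_def A_def by (auto simp: max_def min_def not_less)
  have "(\<Sum>i<n. r i) \<le> (\<Sum>i<n. if i \<in> A then e else 0)" by (intro sum_mono rb) simp
  also have "\<dots> = (\<Sum>i\<in>A. e)"
  proof -
    have "{..<n} \<inter> A = A" using mn Nn unfolding A_def by auto
    then show ?thesis using sum.inter_restrict[of "{..<n}" "\<lambda>_. e" A] by simp
  qed
  also have "\<dots> = e * \<bar>real (N t) - real m\<bar>" unfolding A_def by (auto simp: max_def min_def of_nat_diff)
  finally have "(\<Sum>i<n. r i) \<le> e * \<bar>real (N t) - real m\<bar>" .
  moreover have "0 \<le> (\<Sum>i<n. r i)" by (intro sum_nonneg r0)
  ultimately show ?thesis unfolding eq[symmetric] by linarith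
qed

lemma top_sum_linearization:
  assumes "m \<le> n" "0 \<le> e" "exceed Y n (t + e) w \<le> m" "m \<le> exceed Y n (t - e) w"
  shows "\<bar>(\<Sum>i=1..m. order_stat Y n i w) - (real m * t + (\<Sum>j=1..n. max 0 (Y j w - t)))\<bar>
     \<le> e * \<bar>real (exceed Y n t w) - real m\<bar>"
proof -
  have "(\<Sum>i=1..m. order_stat Y n i w) = (\<Sum>i<m. order_stat Y n (Suc i) w)"
    by (simp add: sum.atLeast1_atMost_eq)
  moreover have "(\<Sum>j=1..n. max 0 (Y j w - t)) = (\<Sum>i<n. max 0 (order_stat Y n (Suc i) w - t))"
    by (rule sum_order_stat[symmetric])
  ultimately show ?thesis
    using top_sum_bound[of n "\<lambda>i. order_stat Y n (Suc i) w" "\<lambda>s. exceed Y n s w" m t e,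
        OF order_stat_gt_iff assms(1) exceed_le assms(2-4)]
    by simp
qed

section \<open>Slabs of a Pareto variable\<close>

lemma pareto_tail:
  assumes "prob_space M" "pareto_distributed M \<alpha> c X" "c > 0" "s \<ge> c"
  shows "measure M {w \<in> space M. s < X w} = (s / c) powr (- \<alpha>)"
proof -
  interpret prob_space M by fact
  have [measurable]: "X \<in> borel_measurable M" using assms(2) unfolding pareto_distributed_def by blast
  have "cdf (distr M borel X) s = prob {w \<in> space M. X w \<le> s}"
    unfolding cdf_def by (subst measure_distr) (auto intro!: arg_cong[where f = prob])
  then have "prob {w \<in> space M. X w \<le> s} = 1 - (s / c) powr (- \<alpha>)"
    using assms(2,4) unfolding pareto_distributed_def by auto
  moreover have "prob {w \<in> space M. s < X w} = 1 - prob {w \<in> space M. X w \<le> s}"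
    by (subst prob_compl[symmetric]) (auto intro!: arg_cong[where f = prob])
  ultimately show ?thesis by simp
qed

lemma pareto_above_minimum:
  assumes "prob_space M" "pareto_distributed M \<alpha> c X" "c > 0"
  shows "AE w in M. c < X w"
proof -
  interpret prob_space M by fact
  have [measurable]: "X \<in> borel_measurable M" using assms(2) unfolding pareto_distributed_def by blast
  have "prob {w \<in> space M. c < X w} = 1" using pareto_tail[OF assms order_refl] assms(3) by simp
  then have "AE w in M. w \<in> {w \<in> space M. c < X w}" by (rule AE_prob_1)
  then show ?thesis by eventually_elim simp
qed

text \<open>
  Fubini: an increasing function of the truncated variable is the integral of its derivative over
  the levels below the variable, so its expectation is the integral of the derivative times the tail.
\<close>
lemma pareto_expectation:
  fixes W dW \<Phi> :: "real \<Rightarrow> real"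
  assumes M: "prob_space M" and X: "pareto_distributed M \<alpha> c X" and c: "c > 0" and ab: "c \<le> a" "a \<le> b"
    and W: "\<And>s. a \<le> s \<Longrightarrow> s \<le> b \<Longrightarrow> (W has_real_derivative dW s) (at s)"
    and dW: "\<And>s. a \<le> s \<Longrightarrow> s \<le> b \<Longrightarrow> 0 \<le> dW s" "dW \<in> borel_measurable borel"
    and \<Phi>: "\<And>s. a \<le> s \<Longrightarrow> s \<le> b \<Longrightarrow> (\<Phi> has_real_derivative dW s * (s / c) powr (- \<alpha>)) (at s)"
    and Wm: "W \<in> borel_measurable borel"
  shows "(\<integral>w. W (max a (min b (X w))) - W a \<partial>M) = \<Phi> b - \<Phi> a"
proof -
  interpret prob_space M by fact
  have [measurable]: "X \<in> borel_measurable M" using X unfolding pareto_distributed_def by blast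
  note [measurable] = dW(2) Wm
  have mono: "W s \<le> W s'" if "a \<le> s" "s \<le> s'" "s' \<le> b" for s s'
    using that(2)
  proof (rule DERIV_nonneg_imp_nondecreasing)
    fix x assume "s \<le> x" "x \<le> s'"
    with that have "a \<le> x" "x \<le> b" by auto
    then show "\<exists>y. (W has_real_derivative y) (at x) \<and> 0 \<le> y" using W dW(1) by blast
  qed
  have cl: "a \<le> max a (min b x)" "max a (min b x) \<le> b" for x using ab by auto
  have nonneg: "0 \<le> W (max a (min b x)) - W a" for x
    using mono[OF order_refl cl] by simp
  have \<Phi>mono: "\<Phi> a \<le> \<Phi> b"
    using ab(2)
  proof (rule DERIV_nonneg_imp_nondecreasing)
    fix x assume x: "a \<le> x" "x \<le> b"
    have "0 \<le> dW x * (x / c) powr (- \<alpha>)" using dW(1)[OF x] by simp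
    with \<Phi>[OF x] show "\<exists>y. (\<Phi> has_real_derivative y) (at x) \<and> 0 \<le> y" by blast
  qed
  have inner: "ennreal (W (max a (min b x)) - W a) = (\<integral>\<^sup>+s. ennreal (dW s) * indicator {a..b} s * indicator {..<x} s \<partial>lborel)" for x
  proof -
    have "ennreal (W (max a (min b x)) - W a) = (\<integral>\<^sup>+s. ennreal (dW s) * indicator {a..max a (min b x)} s \<partial>lborel)"
    proof (rule nn_integral_FTC_Icc[where F = W, symmetric])
      fix s assume "s \<in> {a..max a (min b x)}"
      then have s: "a \<le> s" "s \<le> b" using cl(2)[of x] by auto
      show "(W has_real_derivative dW s) (at s)" by (rule W[OF s])
      show "0 \<le> dW s" by (rule dW(1)[OF s])
    qed (use dW(2) cl in auto)
    also have "\<dots> = (\<integral>\<^sup>+s. ennreal (dW s) * indicator {a..b} s * indicator {..<x} s \<partial>lborel)"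
    proof (rule nn_integral_cong_AE)
      \<comment> \<open>The two integrands differ at the end points of the interval only.\<close>
      have "AE s in lborel. s \<noteq> a \<and> s \<noteq> x"
        using AE_lborel_singleton[of a] AE_lborel_singleton[of x] by eventually_elim simp
      then show "AE s in lborel. ennreal (dW s) * indicator {a..max a (min b x)} s = ennreal (dW s) * indicator {a..b} s * indicator {..<x} s"
        by eventually_elim (auto simp: indicator_def)
    qed
    finally show ?thesis .
  qed
  have "(\<integral>\<^sup>+w. ennreal (W (max a (min b (X w))) - W a) \<partial>M)
     = (\<integral>\<^sup>+w. (\<integral>\<^sup>+s. ennreal (dW s) * indicator {a..b} s * indicator {..<X w} s \<partial>lborel) \<partial>M)"
    unfolding inner ..
  also have "\<dots> = (\<integral>\<^sup>+s. (\<integral>\<^sup>+w. ennreal (dW s) * indicator {a..b} s * indicator {..<X w} s \<partial>M) \<partial>lborel)"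
  proof -
    interpret pair_sigma_finite lborel M by unfold_locales
    show ?thesis by (intro Fubini') (simp add: indicator_def)
  qed
  also have "\<dots> = (\<integral>\<^sup>+s. ennreal (dW s * (s / c) powr (- \<alpha>)) * indicator {a..b} s \<partial>lborel)"
  proof (rule nn_integral_cong)
    fix s :: real
    show "(\<integral>\<^sup>+w. ennreal (dW s) * indicator {a..b} s * indicator {..<X w} s \<partial>M) = ennreal (dW s * (s / c) powr (- \<alpha>)) * indicator {a..b} s"
    proof (cases "s \<in> {a..b}")
      case True
      have "(\<integral>\<^sup>+w. ennreal (dW s) * indicator {a..b} s * indicator {..<X w} s \<partial>M) = ennreal (dW s) * (\<integral>\<^sup>+w. indicator {..<X w} s \<partial>M)"
        using True by (subst nn_integral_cmult[symmetric]) (auto simp: indicator_def)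
      also have "(\<integral>\<^sup>+w. indicator {..<X w} s \<partial>M) = (\<integral>\<^sup>+w. indicator {w \<in> space M. s < X w} w \<partial>M)"
        by (intro nn_integral_cong) (auto simp: indicator_def)
      also have "\<dots> = ennreal ((s / c) powr (- \<alpha>))"
        using pareto_tail[OF M X c, of s] True ab by (simp add: emeasure_eq_measure)
      finally show ?thesis using True dW(1)[of s] by (simp add: ennreal_mult)
    qed simp
  qed
  also have "\<dots> = ennreal (\<Phi> b - \<Phi> a)"
  proof (rule nn_integral_FTC_Icc[where F = \<Phi>])
    fix s assume "s \<in> {a..b}"
    then have s: "a \<le> s" "s \<le> b" by auto
    show "(\<Phi> has_real_derivative dW s * (s / c) powr (- \<alpha>)) (at s)" by (rule \<Phi>[OF s])
    show "0 \<le> dW s * (s / c) powr (- \<alpha>)" using dW(1)[OF s] by simp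
  qed (use ab in measurable)
  finally have nn: "(\<integral>\<^sup>+w. ennreal (W (max a (min b (X w))) - W a) \<partial>M) = ennreal (\<Phi> b - \<Phi> a)" .
  show ?thesis
    using \<Phi>mono nonneg by (subst integral_eq_nn_integral) (auto simp: nn)
qed

text \<open>
  The length of the part of \<open>{a..b}\<close> that lies below \<open>y\<close>.
\<close>
definition slab :: "real \<Rightarrow> real \<Rightarrow> real \<Rightarrow> real" where
  "slab a b y = max a (min b y) - a"

lemma slab_measurable [measurable]: "slab a b \<in> borel_measurable borel"
  unfolding slab_def by measurable

text \<open>
  The difference of the two excesses that \<open>top_sum_linearization\<close> produces at the two ends of
  a block.
\<close>
lemma slab_eq: "a \<le> b \<Longrightarrow> slab a b y = max 0 (y - a) - max 0 (y - b)"
  unfolding slab_def max_def min_def by simp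

text \<open>
  The upper slab is positive only for \<open>y\<close> above \<open>a'\<close>, where the lower one is full.
\<close>
lemma slab_mult_nested:
  assumes "a \<le> b" "b \<le> a'" "a' \<le> b'"
  shows "slab a b y * slab a' b' y = (b - a) * slab a' b' y"
proof (cases "y \<le> a'")
  case True
  then have "slab a' b' y = 0" unfolding slab_def by simp
  then show ?thesis by simp
next
  case False
  with assms have "slab a b y = b - a" unfolding slab_def by (simp add: max_def min_def)
  then show ?thesis by simp
qed

text \<open>
  The level that is exceeded with probability \<open>p\<close>.
\<close>
definition quantile :: "real \<Rightarrow> real \<Rightarrow> real \<Rightarrow> real" where
  "quantile \<alpha> c p = c * p powr (- (1 / \<alpha>))"

text \<open>
  The integral of the tail between the quantiles of \<open>q\<close> and \<open>p\<close>; see \<open>slab_mean\<close>.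
\<close>
definition mean_slab :: "real \<Rightarrow> real \<Rightarrow> real \<Rightarrow> real \<Rightarrow> real" where
  "mean_slab \<alpha> c p q = c * (1 / \<alpha>) / (1 - 1 / \<alpha>) * (q powr (1 - 1 / \<alpha>) - p powr (1 - 1 / \<alpha>))"

text \<open>
  The algebra behind \<open>slab_second_moment\<close>: here $P, Q$ and $P', Q'$ stand for the powers of
  \<open>p\<close>, \<open>q\<close> with exponents $1-\xi$ and $-\xi$, and \<open>D\<close> for the increment of an
  antiderivative of $x^{-2\xi}$. The assumption on \<open>D\<close> holds for the logarithm as well, when
  $\xi = 1/2$ and both sides are zero.
\<close>
lemma slab_variance_identity:
  fixes c d \<xi> D P P' Q Q' :: real
  assumes d: "d > 0" "d = 1 - \<xi>" and \<xi>: "\<xi> > 0" and key: "(1 - 2 * (1 - \<xi>)) * D = P * P' - Q * Q'"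
  shows "2 * c\<^sup>2 * \<xi> * D - (2 * (c * Q') * c * \<xi> / d) * (Q - P) =
    2 * c\<^sup>2 * \<xi>\<^sup>2 / d * (D + P * ((Q' - P') / \<xi>) + (2 * P * Q - P\<^sup>2 - Q\<^sup>2) / (2 * d)) + (c * \<xi> / d * (Q - P))\<^sup>2"
proof -
  have "2 * c\<^sup>2 * \<xi>\<^sup>2 / d * (D + P * ((Q' - P') / \<xi>) + (2 * P * Q - P\<^sup>2 - Q\<^sup>2) / (2 * d)) =
     2 * c\<^sup>2 * \<xi>\<^sup>2 / d * D + 2 * c\<^sup>2 * \<xi>\<^sup>2 / d * (P * ((Q' - P') / \<xi>)) + 2 * c\<^sup>2 * \<xi>\<^sup>2 / d * ((2 * P * Q - P\<^sup>2 - Q\<^sup>2) / (2 * d))"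
    by (simp only: distrib_left)
  moreover have "2 * c\<^sup>2 * \<xi>\<^sup>2 / d * (P * ((Q' - P') / \<xi>)) = 2 * c\<^sup>2 * \<xi> / d * (P * (Q' - P'))"
    using \<xi> by (simp add: power2_eq_square)
  moreover have "2 * c\<^sup>2 * \<xi>\<^sup>2 / d * ((2 * P * Q - P\<^sup>2 - Q\<^sup>2) / (2 * d)) = - (c * \<xi> / d * (Q - P))\<^sup>2"
    using d(1) by (simp add: power_mult_distrib power_divide) (simp add: power2_eq_square algebra_simps diff_divide_distrib add_divide_distrib)
  moreover have "2 * c\<^sup>2 * \<xi>\<^sup>2 / d * D = 2 * c\<^sup>2 * \<xi> / d * (\<xi> * D)" by (simp add: power2_eq_square)
  moreover have "2 * c\<^sup>2 * \<xi> * D - (2 * (c * Q') * c * \<xi> / d) * (Q - P) = 2 * c\<^sup>2 * \<xi> / d * (d * D - Q' * (Q - P))"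
  proof -
    have "2 * c\<^sup>2 * \<xi> / d * (d * D) = 2 * c\<^sup>2 * \<xi> * D" using d(1) by simp
    moreover have "2 * c\<^sup>2 * \<xi> / d * (Q' * (Q - P)) = (2 * (c * Q') * c * \<xi> / d) * (Q - P)"
      by (simp add: power2_eq_square)
    ultimately show ?thesis by (simp only: right_diff_distrib[of "2 * c\<^sup>2 * \<xi> / d"])
  qed
  moreover have "2 * c\<^sup>2 * \<xi> / d * (d * D - Q' * (Q - P)) = 2 * c\<^sup>2 * \<xi> / d * (\<xi> * D) + 2 * c\<^sup>2 * \<xi> / d * (P * (Q' - P'))"
  proof -
    have "d * D - Q' * (Q - P) = \<xi> * D + P * (Q' - P')"
      using key unfolding d(2) by (simp add: algebra_simps)
    then show ?thesis by (simp only: distrib_left)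
  qed
  ultimately show ?thesis by linarith
qed

context
  fixes \<alpha> c :: real
  assumes \<alpha>: "\<alpha> > 1" and c: "c > 0"
begin

lemma quantile_tail: "0 < p \<Longrightarrow> (quantile \<alpha> c p / c) powr (- \<alpha>) = p"
proof -
  assume p: "0 < p"
  have "quantile \<alpha> c p / c = p powr (- (1 / \<alpha>))" unfolding quantile_def using c by simp
  then have "(quantile \<alpha> c p / c) powr (- \<alpha>) = p powr (- (1 / \<alpha>) * (- \<alpha>))" by (simp only: powr_powr)
  also have "- (1 / \<alpha>) * (- \<alpha>) = 1" using \<alpha> by simp
  finally show ?thesis using p by simp
qed

lemma quantile_mono: "0 < p \<Longrightarrow> p \<le> q \<Longrightarrow> quantile \<alpha> c q \<le> quantile \<alpha> c p"
  unfolding quantile_def using c \<alpha> powr_mono2'[of "- (1 / \<alpha>)" p q] by simp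

lemma quantile_strict_mono: "0 < p \<Longrightarrow> p < q \<Longrightarrow> quantile \<alpha> c q < quantile \<alpha> c p"
  unfolding quantile_def using c \<alpha> powr_less_mono2_neg[of "- (1 / \<alpha>)" p q] by simp

lemma quantile_1: "quantile \<alpha> c 1 = c"
  unfolding quantile_def by simp

lemma quantile_ge: "0 < p \<Longrightarrow> p \<le> 1 \<Longrightarrow> c \<le> quantile \<alpha> c p"
  using quantile_mono[of p 1] by (simp add: quantile_1)

text \<open>
  Antiderivatives below are written as functions of the tail \<open>u\<close>, because \<open>u\<close> takes the
  values \<open>p\<close> and \<open>q\<close> at the quantiles.
\<close>
lemma tail_derivative:
  fixes s :: real
  assumes "s > 0"
  defines "u \<equiv> \<lambda>s. (s / c) powr (- \<alpha>)"
  shows "(u has_real_derivative - (1 / (c * (1 / \<alpha>))) * u s powr (1 + 1 / \<alpha>)) (at s)"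
proof -
  have "(u has_real_derivative (- \<alpha>) * (s / c) powr (- \<alpha> - 1) * (1 / c)) (at s)"
    unfolding u_def using assms(1) c by (auto intro!: derivative_eq_intros simp: powr_diff)
  moreover have "u s powr (1 + 1 / \<alpha>) = (s / c) powr (- \<alpha> - 1)"
  proof -
    have "(- \<alpha>) * (1 + 1 / \<alpha>) = - \<alpha> - 1" using \<alpha> by (simp add: field_simps)
    then show ?thesis unfolding u_def powr_powr by simp
  qed
  ultimately show ?thesis using \<alpha> c by (simp add: mult.commute mult.left_commute)
qed

lemma slab_mean:
  assumes M: "prob_space M" and X: "pareto_distributed M \<alpha> c X" and pq: "0 < p" "p \<le> q" "q \<le> 1"
  shows "(\<integral>w. slab (quantile \<alpha> c q) (quantile \<alpha> c p) (X w) \<partial>M) = mean_slab \<alpha> c p q"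
proof -
  define \<xi> where "\<xi> = 1 / \<alpha>"
  have \<xi>: "0 < \<xi>" "\<xi> < 1" unfolding \<xi>_def using \<alpha> by auto
  define u where "u s = (s / c) powr (- \<alpha>)" for s
  \<comment> \<open>An antiderivative of the tail.\<close>
  define \<Phi> where "\<Phi> s = - (c * \<xi> / (1 - \<xi>)) * u s powr (1 - \<xi>)" for s
  have u': "(u has_real_derivative - (1 / (c * \<xi>)) * u s powr (1 + \<xi>)) (at s)" if "s > 0" for s
    using tail_derivative[OF that] unfolding u_def \<xi>_def .
  have u0: "u s > 0" if "s > 0" for s unfolding u_def using that c by simp
  have powr_chain: "((\<lambda>s. u s powr (1 - \<xi>)) has_real_derivative
      (1 - \<xi>) * u s powr (1 - \<xi> - 1) * (- (1 / (c * \<xi>)) * u s powr (1 + \<xi>))) (at s)" if "s > 0" for s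
    using DERIV_chain2[OF has_real_derivative_powr[OF u0[OF that], of "1 - \<xi>"] u'[OF that]] .
  have "(\<integral>w. max (quantile \<alpha> c q) (min (quantile \<alpha> c p) (X w)) - quantile \<alpha> c q \<partial>M) = \<Phi> (quantile \<alpha> c p) - \<Phi> (quantile \<alpha> c q)"
  proof (rule pareto_expectation[OF M X c, where dW = "\<lambda>_. 1" and W = "\<lambda>s. s"])
    show "c \<le> quantile \<alpha> c q" "quantile \<alpha> c q \<le> quantile \<alpha> c p" using pq quantile_ge quantile_mono by auto
    fix s assume "quantile \<alpha> c q \<le> s"
    with pq quantile_ge[of q] c have s: "s > 0" by auto
    have e: "- (c * \<xi> / (1 - \<xi>)) * ((1 - \<xi>) * u s powr (1 - \<xi> - 1) * (- (1 / (c * \<xi>)) * u s powr (1 + \<xi>))) = 1 * (s / c) powr (- \<alpha>)"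
    proof -
      have "u s powr (1 - \<xi> - 1) * u s powr (1 + \<xi>) = u s"
        using u0[OF s] by (simp add: powr_add[symmetric])
      then show ?thesis using \<xi> c unfolding u_def by (simp add: field_simps)
    qed
    show "(\<Phi> has_real_derivative 1 * (s / c) powr (- \<alpha>)) (at s)"
      unfolding e[symmetric] \<Phi>_def by (intro DERIV_cmult powr_chain s)
  qed (auto intro!: derivative_eq_intros)
  also have "\<dots> = mean_slab \<alpha> c p q"
    unfolding \<Phi>_def u_def mean_slab_def \<xi>_def[symmetric] using pq by (simp add: quantile_tail algebra_simps)
  finally show ?thesis unfolding slab_def .
qed

text \<open>
  The square of the slab has derivative $2(s-a)$ at level \<open>s\<close>, and $s = c\,u^{-\xi}$ turns the
  product of \<open>s\<close> with the tail into a power of \<open>u\<close>.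
\<close>
lemma slab_second_moment:
  assumes M: "prob_space M" and X: "pareto_distributed M \<alpha> c X" and pq: "0 < p" "p \<le> q" "q \<le> 1"
  shows "(\<integral>w. (slab (quantile \<alpha> c q) (quantile \<alpha> c p) (X w))\<^sup>2 \<partial>M) = sigma2 \<alpha> c p q + (mean_slab \<alpha> c p q)\<^sup>2"
proof -
  define \<xi> where "\<xi> = 1 / \<alpha>"
  have \<xi>: "0 < \<xi>" "\<xi> < 1" unfolding \<xi>_def using \<alpha> by auto
  define u where "u s = (s / c) powr (- \<alpha>)" for s
  define L where "L x = (if \<xi> = 1 / 2 then ln x else x powr (1 - 2 * \<xi>) / (1 - 2 * \<xi>))" for x
  define a where "a = quantile \<alpha> c q"
  \<comment> \<open>An antiderivative of 2 * (s - a) * u s, the two terms belonging to s and to a.\<close>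
  define \<Phi> where "\<Phi> s = - (2 * c\<^sup>2 * \<xi>) * L (u s) + (2 * a * c * \<xi> / (1 - \<xi>)) * u s powr (1 - \<xi>)" for s
  have u': "(u has_real_derivative - (1 / (c * \<xi>)) * u s powr (1 + \<xi>)) (at s)" if "s > 0" for s
    using tail_derivative[OF that] unfolding u_def \<xi>_def .
  have u0: "u s > 0" if "s > 0" for s unfolding u_def using that c by simp
  have powr_chain: "((\<lambda>s. u s powr (1 - \<xi>)) has_real_derivative
      (1 - \<xi>) * u s powr (1 - \<xi> - 1) * (- (1 / (c * \<xi>)) * u s powr (1 + \<xi>))) (at s)" if "s > 0" for s
    using DERIV_chain2[OF has_real_derivative_powr[OF u0[OF that], of "1 - \<xi>"] u'[OF that]] .
  have uxi: "u s powr (- \<xi>) = s / c" if "s > 0" for s unfolding u_def \<xi>_def using that c \<alpha> by (simp add: powr_powr)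
  have L': "(L has_real_derivative x powr (- 2 * \<xi>)) (at x)" if "x > 0" for x
  proof (cases "\<xi> = 1 / 2")
    case True
    then show ?thesis using that unfolding L_def
      by (auto intro!: derivative_eq_intros simp: powr_minus_divide True)
  next
    case False
    then have "((\<lambda>x. x powr (1 - 2 * \<xi>) / (1 - 2 * \<xi>)) has_real_derivative x powr (- 2 * \<xi>)) (at x)"
      using DERIV_cdivide[OF has_real_derivative_powr[OF that, of "1 - 2 * \<xi>"], of "1 - 2 * \<xi>"] by simp
    with False show ?thesis unfolding L_def by simp
  qed
  have "(\<integral>w. (max a (min (quantile \<alpha> c p) (X w)) - a)\<^sup>2 - (a - a)\<^sup>2 \<partial>M) = \<Phi> (quantile \<alpha> c p) - \<Phi> a"
  proof (rule pareto_expectation[OF M X c, where dW = "\<lambda>s. 2 * (s - a)" and W = "\<lambda>s. (s - a)\<^sup>2"])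
    show "c \<le> a" "a \<le> quantile \<alpha> c p" unfolding a_def using pq quantile_ge quantile_mono by auto
    fix s assume "a \<le> s"
    with pq quantile_ge[of q] c have s: "s > 0" unfolding a_def by auto
    show "((\<lambda>s. (s - a)\<^sup>2) has_real_derivative 2 * (s - a)) (at s)" by (auto intro!: derivative_eq_intros)
    show "0 \<le> 2 * (s - a)" using \<open>a \<le> s\<close> by simp
    have p1: "u s powr (- 2 * \<xi>) * u s powr (1 + \<xi>) = u s * (s / c)"
      using u0[OF s] by (simp add: powr_add[symmetric] uxi[OF s, symmetric] powr_mult_base)
    have p2: "u s powr (1 - \<xi> - 1) * u s powr (1 + \<xi>) = u s" using u0[OF s] by (simp add: powr_add[symmetric])
    have e: "- (2 * c\<^sup>2 * \<xi>) * (u s powr (- 2 * \<xi>) * (- (1 / (c * \<xi>)) * u s powr (1 + \<xi>)))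
        + (2 * a * c * \<xi> / (1 - \<xi>)) * ((1 - \<xi>) * u s powr (1 - \<xi> - 1) * (- (1 / (c * \<xi>)) * u s powr (1 + \<xi>)))
        = 2 * (s - a) * (s / c) powr (- \<alpha>)"
    proof -
      have "- (2 * c\<^sup>2 * \<xi>) * (u s powr (- 2 * \<xi>) * (- (1 / (c * \<xi>)) * u s powr (1 + \<xi>)))
         = 2 * c * (u s powr (- 2 * \<xi>) * u s powr (1 + \<xi>))" using \<xi> c by (simp add: field_simps power2_eq_square)
      also have "\<dots> = 2 * s * u s" unfolding p1 using c by simp
      finally have e1: "- (2 * c\<^sup>2 * \<xi>) * (u s powr (- 2 * \<xi>) * (- (1 / (c * \<xi>)) * u s powr (1 + \<xi>))) = 2 * s * u s" .
      have "(2 * a * c * \<xi> / (1 - \<xi>)) * ((1 - \<xi>) * u s powr (1 - \<xi> - 1) * (- (1 / (c * \<xi>)) * u s powr (1 + \<xi>)))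
         = - 2 * a * (u s powr (1 - \<xi> - 1) * u s powr (1 + \<xi>))" using \<xi> c by (simp add: field_simps)
      also have "\<dots> = - 2 * a * u s" unfolding p2 ..
      finally show ?thesis unfolding e1 u_def[symmetric] by (simp add: algebra_simps)
    qed
    show "(\<Phi> has_real_derivative 2 * (s - a) * (s / c) powr (- \<alpha>)) (at s)"
      unfolding e[symmetric] \<Phi>_def
      by (intro DERIV_add DERIV_cmult powr_chain s DERIV_chain2[OF L'[OF u0[OF s]] u'[OF s]])
  qed measurable
  then have "(\<integral>w. (slab a (quantile \<alpha> c p) (X w))\<^sup>2 \<partial>M) = \<Phi> (quantile \<alpha> c p) - \<Phi> a"
    unfolding slab_def by simp
  also have "\<dots> = 2 * c\<^sup>2 * \<xi> * (L q - L p) - (2 * a * c * \<xi> / (1 - \<xi>)) * (q powr (1 - \<xi>) - p powr (1 - \<xi>))"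
  proof -
    have "u (quantile \<alpha> c p) = p" "u a = q" unfolding u_def a_def using pq by (simp_all add: quantile_tail)
    moreover have "- A * x + B * z - (- A * y + B * w) = A * (y - x) - B * (w - z)" for A B x y z w :: real
      by (simp add: algebra_simps)
    ultimately show ?thesis unfolding \<Phi>_def by (simp only: mult_minus_left)
  qed
  also have "\<dots> = sigma2 \<alpha> c p q + (mean_slab \<alpha> c p q)\<^sup>2"
  proof -
    define P Q P' Q' where "P = p powr (1 - \<xi>)" and "Q = q powr (1 - \<xi>)" and "P' = p powr (- \<xi>)" and "Q' = q powr (- \<xi>)"
    have L: "(if \<xi> = 1 / 2 then ln (q / p) else (q powr (1 - 2 * \<xi>) - p powr (1 - 2 * \<xi>)) / (1 - 2 * \<xi>)) = L q - L p"
      unfolding L_def using pq by (auto simp: ln_div diff_divide_distrib)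
    have PP: "P * P' = p powr (1 - 2 * \<xi>)" "Q * Q' = q powr (1 - 2 * \<xi>)" "P\<^sup>2 = p powr (2 - 2 * \<xi>)" "Q\<^sup>2 = q powr (2 - 2 * \<xi>)"
      unfolding P_def Q_def P'_def Q'_def by (simp_all add: powr_add[symmetric] power2_eq_square)
    have key: "(2 * \<xi> - 1) * (L q - L p) = P * P' - Q * Q'"
    proof (cases "\<xi> = 1 / 2")
      case True
      then have "2 * \<xi> - 1 = 0" "1 - 2 * \<xi> = 0" by simp_all
      then show ?thesis unfolding PP using pq by simp
    next
      case False
      define k where "k = 1 - 2 * \<xi>"
      have k: "k \<noteq> 0" "2 * \<xi> - 1 = - k" unfolding k_def using False by auto
      have "L q - L p = (Q * Q' - P * P') / k" unfolding PP L_def k_def using False by (simp add: diff_divide_distrib)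
      then show ?thesis unfolding k(2) using k(1) by simp
    qed
    have a: "a = c * Q'" unfolding a_def quantile_def Q'_def \<xi>_def by simp
    have s: "sigma2 \<alpha> c p q = 2 * c\<^sup>2 * \<xi>\<^sup>2 / (1 - \<xi>) * ((L q - L p) + P * ((Q' - P') / \<xi>) + (2 * P * Q - P\<^sup>2 - Q\<^sup>2) / (2 - 2 * \<xi>))"
      unfolding sigma2_def Let_def \<xi>_def[symmetric] L PP(3,4) unfolding P_def Q_def P'_def Q'_def ..
    have m: "mean_slab \<alpha> c p q = c * \<xi> / (1 - \<xi>) * (Q - P)"
      unfolding mean_slab_def \<xi>_def[symmetric] P_def Q_def ..
    have e1: "1 - 2 * (1 - \<xi>) = 2 * \<xi> - 1" and e2: "2 - 2 * \<xi> = 2 * (1 - \<xi>)" by simp_all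
    note key' = key[folded e1]
    show ?thesis unfolding s m a e2 P_def[symmetric] Q_def[symmetric]
      by (rule slab_variance_identity[OF _ refl \<xi>(1) key'])  (use \<xi>(2) in simp)
  qed
  finally show ?thesis unfolding a_def .
qed

lemma sigma_offdiag_eq:
  "sigma_offdiag \<alpha> c p j k = (quantile \<alpha> c (p k) - quantile \<alpha> c (p (k + 1)) - mean_slab \<alpha> c (p k) (p (k + 1))) * mean_slab \<alpha> c (p j) (p (j + 1))"
proof -
  define \<xi> where "\<xi> = 1 / \<alpha>"
  have \<xi>: "0 < \<xi>" "\<xi> < 1" unfolding \<xi>_def using \<alpha> by auto
  show ?thesis
  proof -
    define J where "J = (p (j + 1) powr (1 - \<xi>) - p j powr (1 - \<xi>)) / (1 - \<xi>)"
    define K where "K = (p (k + 1) powr (1 - \<xi>) - p k powr (1 - \<xi>)) / (1 - \<xi>)"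
    have K: "mean_slab \<alpha> c (p k) (p (k + 1)) = c * \<xi> * K" and J: "mean_slab \<alpha> c (p j) (p (j + 1)) = c * \<xi> * J"
      unfolding mean_slab_def J_def K_def \<xi>_def[symmetric] by simp_all
    show ?thesis
      unfolding K J sigma_offdiag_def quantile_def Let_def \<xi>_def[symmetric] J_def[symmetric] K_def[symmetric]
      using \<xi>(1) by (simp add: field_simps power2_eq_square)
  qed
qed

text \<open>
  The last two terms are the contributions, per observation, of the summands $m t$ in the
  linearizations at the two ends of a block.
\<close>
lemma mu_eq:
  assumes "0 < p" "0 < q"
  shows "mu \<alpha> c p q = mean_slab \<alpha> c p q + q * quantile \<alpha> c q - p * quantile \<alpha> c p"
proof -
  define \<xi> where "\<xi> = 1 / \<alpha>"
  have \<xi>: "0 < \<xi>" "\<xi> < 1" unfolding \<xi>_def using \<alpha> by auto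
  have "q * q powr (- \<xi>) = q powr (1 - \<xi>)" "p * p powr (- \<xi>) = p powr (1 - \<xi>)"
    using assms by (simp_all add: powr_mult_base)
  then have e: "q * (c * q powr (- \<xi>)) = c * q powr (1 - \<xi>)" "p * (c * p powr (- \<xi>)) = c * p powr (1 - \<xi>)"
    by (metis mult.left_commute)+
  show ?thesis
    unfolding mu_def mean_slab_def quantile_def Let_def \<xi>_def[symmetric] e using \<xi>
    by (simp add: field_simps)
qed

lemma mu_pos:
  assumes "0 < p" "p < q"
  shows "mu \<alpha> c p q > 0"
proof -
  have "1 - 1 / \<alpha> > 0" using \<alpha> by simp
  moreover have "p powr (1 - 1 / \<alpha>) < q powr (1 - 1 / \<alpha>)" using assms calculation by (intro powr_less_mono2) auto
  ultimately show ?thesis unfolding mu_def Let_def using c by simp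
qed

end

section \<open>Sums over a Pareto sample\<close>

lemma (in prob_space) indep_vars_shift:
  assumes "indep_vars (\<lambda>_. N) Y {1..}"
  shows "indep_vars (\<lambda>_. N) (\<lambda>i. Y (Suc i)) UNIV"
  unfolding indep_vars_def2
proof (intro conjI ballI)
  define F where "F i = {Y i -` A \<inter> space M |A. A \<in> sets N}" for i
  have F: "indep_sets F {1..}" and rv: "\<And>i. i \<ge> 1 \<Longrightarrow> Y i \<in> measurable M N"
    using assms unfolding indep_vars_def2 F_def by auto
  show "Y (Suc i) \<in> measurable M N" for i by (rule rv) simp
  have "indep_sets (\<lambda>i. F (Suc i)) UNIV"
  proof (rule indep_setsI)
    show "F (Suc i) \<subseteq> events" for i using F unfolding indep_sets_def by auto
    fix A and J :: "nat set"
    assume J: "J \<noteq> {}" "finite J" and A: "\<forall>j\<in>J. A j \<in> F (Suc j)"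
    have inj: "inj_on Suc J" by simp
    have "prob (\<Inter>k\<in>Suc ` J. A (k - 1)) = (\<Prod>k\<in>Suc ` J. prob (A (k - 1)))"
      by (rule indep_setsD[OF F]) (use J A in auto)
    then show "prob (\<Inter>j\<in>J. A j) = (\<Prod>j\<in>J. prob (A j))"
      by (simp add: prod.reindex[OF inj])
  qed
  then show "indep_sets (\<lambda>i. {Y (Suc i) -` A \<inter> space M |A. A \<in> sets N}) UNIV" unfolding F_def .
qed

locale pareto_sample = prob_space M for M :: "'a measure" +
  fixes Y :: "nat \<Rightarrow> 'a \<Rightarrow> real" and \<alpha> c :: real
  assumes \<alpha>: "\<alpha> > 1" and c: "c > 0"
    and indep: "indep_vars (\<lambda>_. borel) Y {1..}"
    and pareto: "\<And>i. i \<ge> 1 \<Longrightarrow> pareto_distributed M \<alpha> c (Y i)"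
begin

lemma Y_measurable: "j \<ge> 1 \<Longrightarrow> Y j \<in> borel_measurable M"
  using pareto unfolding pareto_distributed_def by blast

lemma Y1_measurable [measurable]: "Y (Suc i) \<in> borel_measurable M"
  by (rule Y_measurable) simp

lemma AE_Y_gt: "AE w in M. \<forall>j\<ge>1. c < Y j w"
  by (simp add: AE_all_countable pareto_above_minimum[OF prob_space_axioms pareto c])

text \<open>
  The distribution function is prescribed above \<open>c\<close> only; below \<open>c\<close> it is zero by
  monotonicity.
\<close>
lemma distr_Y: "i \<ge> 1 \<Longrightarrow> distr M borel (Y i) = distr M borel (Y 1)"
proof (rule cdf_unique)
  assume i: "i \<ge> 1"
  have rd: "real_distribution (distr M borel (Y j))" if "j \<ge> 1" for j
    by (rule real_distribution_distr) (rule Y_measurable[OF that])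
  show "real_distribution (distr M borel (Y i))" "real_distribution (distr M borel (Y 1))" using rd i by auto
  have cdf_low: "cdf (distr M borel (Y j)) y = 0" if "j \<ge> 1" "y < c" for j y
  proof -
    interpret D: real_distribution "distr M borel (Y j)" by (rule rd[OF that(1)])
    have "cdf (distr M borel (Y j)) y \<le> cdf (distr M borel (Y j)) c" using that(2) by (intro D.cdf_nondecreasing) simp
    also have "\<dots> = 0" using pareto[OF that(1)] c unfolding pareto_distributed_def by auto
    finally show ?thesis using D.cdf_nonneg[of y] by simp
  qed
  show "cdf (distr M borel (Y i)) = cdf (distr M borel (Y 1))"
  proof
    fix y
    show "cdf (distr M borel (Y i)) y = cdf (distr M borel (Y 1)) y"
    proof (cases "y < c")
      case True
      then show ?thesis using cdf_low[OF i True] cdf_low[OF order_refl True] by simp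
    next
      case False
      then show ?thesis using pareto[OF i] pareto[OF order_refl] unfolding pareto_distributed_def by auto
    qed
  qed
qed

lemma expectation_Y:
  assumes "i \<ge> 1" and h: "h \<in> borel_measurable borel"
  shows "expectation (\<lambda>w. h (Y i w) :: real) = expectation (\<lambda>w. h (Y 1 w))"
proof -
  have "expectation (\<lambda>w. h (Y i w)) = (\<integral>y. h y \<partial>distr M borel (Y i))"
    by (rule integral_distr[symmetric]) (use Y_measurable[OF assms(1)] h in auto)
  also have "\<dots> = (\<integral>y. h y \<partial>distr M borel (Y 1))" using distr_Y[OF assms(1)] by simp
  also have "\<dots> = expectation (\<lambda>w. h (Y 1 w))"
    by (rule integral_distr) (use Y_measurable[OF order_refl] h in auto)
  finally show ?thesis .
qed

lemma integrable_bounded_comp: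
  assumes "i \<ge> 1" "h \<in> borel_measurable borel" "\<And>y. \<bar>h y :: real\<bar> \<le> B"
  shows "integrable M (\<lambda>w. h (Y i w))"
  using assms Y_measurable[OF assms(1)] by (intro integrable_const_bound[of _ B]) auto

lemma sum_bounded:
  fixes h :: "real \<Rightarrow> real"
  assumes "\<And>y. \<bar>h y\<bar> \<le> B"
  shows "\<bar>\<Sum>j=1..n. h (Y j w)\<bar> \<le> real n * B"
proof -
  have "\<bar>\<Sum>j=1..n. h (Y j w)\<bar> \<le> (\<Sum>j=1..n. \<bar>h (Y j w)\<bar>)" by (rule sum_abs)
  also have "\<dots> \<le> (\<Sum>j=1..n. B)" by (intro sum_mono assms)
  finally show ?thesis by simp
qed

lemma sum_measurable:
  assumes "h \<in> borel_measurable borel"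
  shows "(\<lambda>w. \<Sum>j=1..n. h (Y j w) :: real) \<in> borel_measurable M"
  using assms Y_measurable by (intro borel_measurable_sum) (auto intro: measurable_compose)

text \<open>
  The variance of a sum of independent variables. Boundedness of \<open>h\<close> settles all integrability
  questions.
\<close>
lemma second_moment_centred_sum:
  fixes h :: "real \<Rightarrow> real"
  assumes h[measurable]: "h \<in> borel_measurable borel" and B: "\<And>y. \<bar>h y\<bar> \<le> B" and m: "expectation (\<lambda>w. h (Y 1 w)) = 0"
  shows "integrable M (\<lambda>w. (\<Sum>j=1..n. h (Y j w))\<^sup>2)"
    and "expectation (\<lambda>w. (\<Sum>j=1..n. h (Y j w))\<^sup>2) = real n * expectation (\<lambda>w. (h (Y 1 w))\<^sup>2)"
proof -
  define S where "S n w = (\<Sum>j=1..n. h (Y j w))" for n w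
  have Sm[measurable]: "S n \<in> borel_measurable M" for n unfolding S_def by (rule sum_measurable[OF h])
  have Sb: "\<bar>S n w\<bar> \<le> real n * B" for n w unfolding S_def by (rule sum_bounded[OF B])
  have Si: "integrable M (S n)" for n using Sb by (intro integrable_const_bound[of _ "real n * B"]) auto
  have Si2: "integrable M (\<lambda>w. (S n w)\<^sup>2)" for n
  proof (intro integrable_const_bound[of _ "(real n * B)\<^sup>2"] AE_I2)
    fix w show "norm ((S n w)\<^sup>2) \<le> (real n * B)\<^sup>2" using Sb[of n w] by (simp add: abs_le_square_iff[symmetric])
  qed measurable
  show "integrable M (\<lambda>w. (\<Sum>j=1..n. h (Y j w))\<^sup>2)" using Si2[of n] unfolding S_def .
  have h2b: "\<bar>(h y)\<^sup>2\<bar> \<le> B\<^sup>2" for y using power_mono[OF B[of y] abs_ge_zero, of 2] by simp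
  have "expectation (\<lambda>w. (S n w)\<^sup>2) = real n * expectation (\<lambda>w. (h (Y 1 w))\<^sup>2)"
  proof (induction n)
    case 0
    show ?case unfolding S_def by simp
  next
    case (Suc n)
    define X where "X w = h (Y (Suc n) w)" for w
    have Xm[measurable]: "X \<in> borel_measurable M" unfolding X_def by measurable
    have Xi: "integrable M X" unfolding X_def by (rule integrable_bounded_comp[OF _ h B]) simp
    have Xi2: "integrable M (\<lambda>w. (X w)\<^sup>2)" unfolding X_def
      by (rule integrable_bounded_comp[where h = "\<lambda>y. (h y)\<^sup>2", OF _ _ h2b]) auto
    have EX: "expectation X = 0" unfolding X_def using expectation_Y[OF _ h, of "Suc n"] m by simp
    have EX2: "expectation (\<lambda>w. (X w)\<^sup>2) = expectation (\<lambda>w. (h (Y 1 w))\<^sup>2)" unfolding X_def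
      by (rule expectation_Y[where h = "\<lambda>y. (h y)\<^sup>2"]) auto
    have "indep_vars (\<lambda>_. borel) (\<lambda>j w. h (Y j w)) (insert (Suc n) {1..n})"
      by (rule indep_vars_subset[OF indep_vars_compose2[OF indep]]) auto
    then have "indep_var borel (\<lambda>w. h (Y (Suc n) w)) borel (\<lambda>w. \<Sum>j=1..n. h (Y j w))"
      by (intro indep_vars_sum) auto
    then have ind: "indep_var borel X borel (S n)" unfolding X_def S_def .
    have EXS: "expectation (\<lambda>w. X w * S n w) = 0" and iXS: "integrable M (\<lambda>w. X w * S n w)"
      using indep_var_lebesgue_integral[OF ind Xi Si] indep_var_integrable[OF ind Xi Si] EX by auto
    have "(S (Suc n) w)\<^sup>2 = (S n w)\<^sup>2 + 2 * (X w * S n w) + (X w)\<^sup>2" for w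
      unfolding S_def X_def by (simp add: power2_eq_square algebra_simps)
    then have "expectation (\<lambda>w. (S (Suc n) w)\<^sup>2) = expectation (\<lambda>w. (S n w)\<^sup>2) + 2 * expectation (\<lambda>w. X w * S n w) + expectation (\<lambda>w. (X w)\<^sup>2)"
      using Si2 iXS Xi2 by simp
    then show ?case unfolding EXS EX2 Suc.IH by (simp add: algebra_simps)
  qed
  then show "expectation (\<lambda>w. (\<Sum>j=1..n. h (Y j w))\<^sup>2) = real n * expectation (\<lambda>w. (h (Y 1 w))\<^sup>2)" unfolding S_def .
qed

definition tail :: "real \<Rightarrow> real" where
  "tail s = prob {w \<in> space M. s < Y 1 w}"

lemma tail_eq: "c \<le> s \<Longrightarrow> tail s = (s / c) powr (- \<alpha>)"
  unfolding tail_def by (rule pareto_tail[OF prob_space_axioms pareto c]) simp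

lemma tail_quantile: "0 < p \<Longrightarrow> p \<le> 1 \<Longrightarrow> tail (quantile \<alpha> c p) = p"
  using tail_eq[OF quantile_ge[OF \<alpha> c]] quantile_tail[OF \<alpha> c] by simp

lemma tail_strict_mono:
  assumes "c \<le> s" "s < s'" shows "tail s' < tail s"
proof -
  have "(s' / c) powr (- \<alpha>) < (s / c) powr (- \<alpha>)"
    using assms c \<alpha> by (intro powr_less_mono2_neg) (auto simp: divide_strict_right_mono)
  then show ?thesis using assms by (simp add: tail_eq)
qed

lemma exceed_second_moment:
  shows "integrable M (\<lambda>w. (real (exceed Y n s w) - real n * tail s)\<^sup>2)"
    and "expectation (\<lambda>w. (real (exceed Y n s w) - real n * tail s)\<^sup>2) \<le> real n"
proof -
  define h where "h y = indicator {s<..} y - tail s" for y :: real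
  have [measurable]: "h \<in> borel_measurable borel" unfolding h_def by measurable
  have t: "0 \<le> tail s" "tail s \<le> 1" unfolding tail_def by auto
  have hb: "\<bar>h y\<bar> \<le> 1" for y unfolding h_def using t by (auto simp: indicator_def)
  have Ei: "expectation (\<lambda>w. indicator {s<..} (Y 1 w) :: real) = tail s"
  proof -
    have "expectation (\<lambda>w. indicator {s<..} (Y 1 w)) = expectation (indicator {w \<in> space M. s < Y 1 w} :: 'a \<Rightarrow> real)"
      by (intro Bochner_Integration.integral_cong) (auto simp: indicator_def)
    also have "\<dots> = prob ({w \<in> space M. s < Y 1 w} \<inter> space M)" by (rule Bochner_Integration.integral_indicator)
    also have "{w \<in> space M. s < Y 1 w} \<inter> space M = {w \<in> space M. s < Y 1 w}" by auto
    finally show ?thesis unfolding tail_def .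
  qed
  have "integrable M (\<lambda>w. indicator {s<..} (Y 1 w) :: real)"
    by (rule integrable_bounded_comp[of 1 _ 1]) (auto simp: indicator_def)
  then have m: "expectation (\<lambda>w. h (Y 1 w)) = 0" unfolding h_def using Ei by (simp add: prob_space)
  have eq: "real (exceed Y n s w) - real n * tail s = (\<Sum>j=1..n. h (Y j w))" for w
  proof -
    have "real (exceed Y n s w) = (\<Sum>j=1..n. indicator {s<..} (Y j w))"
      unfolding exceed_def by (simp add: indicator_def sum.If_cases Int_def)
    then show ?thesis unfolding h_def by (simp add: sum_subtractf)
  qed
  show "integrable M (\<lambda>w. (real (exceed Y n s w) - real n * tail s)\<^sup>2)"
    unfolding eq by (rule second_moment_centred_sum[OF _ hb m]) measurable
  have h2: "\<bar>(h y)\<^sup>2\<bar> \<le> 1" for y using power_mono[OF hb[of y] abs_ge_zero, of 2] by simp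
  have "expectation (\<lambda>w. (real (exceed Y n s w) - real n * tail s)\<^sup>2) = real n * expectation (\<lambda>w. (h (Y 1 w))\<^sup>2)"
    unfolding eq by (rule second_moment_centred_sum[OF _ hb m]) measurable
  also have "\<dots> \<le> real n * expectation (\<lambda>w. 1)"
  proof (rule mult_left_mono)
    show "expectation (\<lambda>w. (h (Y 1 w))\<^sup>2) \<le> expectation (\<lambda>w. 1)"
  proof (rule integral_mono)
    show "integrable M (\<lambda>w. (h (Y 1 w))\<^sup>2)" by (rule integrable_bounded_comp[OF _ _ h2]) auto
    show "(h (Y 1 w))\<^sup>2 \<le> 1" for w using h2[of "Y 1 w"] by simp
    qed simp
  qed simp
  finally show "expectation (\<lambda>w. (real (exceed Y n s w) - real n * tail s)\<^sup>2) \<le> real n"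
    by (simp add: prob_space)
qed

lemma exceed_measurable' [measurable]: "exceed Y n s \<in> measurable M (count_space UNIV)"
  by (rule exceed_measurable[OF Y_measurable])

lemma exceed_deviation:
  assumes "d > 0"
  shows "(\<lambda>n. prob {w \<in> space M. real n * d \<le> \<bar>real (exceed Y n s w) - real n * tail s\<bar>}) \<longlonglongrightarrow> 0"
proof (rule tendsto_sandwich[OF _ _ tendsto_const])
  show "\<forall>\<^sub>F n in sequentially. 0 \<le> prob {w \<in> space M. real n * d \<le> \<bar>real (exceed Y n s w) - real n * tail s\<bar>}" by simp
  show "\<forall>\<^sub>F n in sequentially. prob {w \<in> space M. real n * d \<le> \<bar>real (exceed Y n s w) - real n * tail s\<bar>} \<le> (1 / d\<^sup>2) * inverse (real n)"
  proof (rule eventually_sequentiallyI[of 1])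
    fix n :: nat assume n: "1 \<le> n"
    have "prob {w \<in> space M. real n * d \<le> \<bar>real (exceed Y n s w) - real n * tail s\<bar>}
       \<le> expectation (\<lambda>w. (real (exceed Y n s w) - real n * tail s)\<^sup>2) / (real n * d)\<^sup>2"
      using n assms exceed_second_moment(1) by (intro second_moment_method) auto
    also have "\<dots> \<le> real n / (real n * d)\<^sup>2" by (intro divide_right_mono exceed_second_moment) simp
    also have "\<dots> = (1 / d\<^sup>2) * inverse (real n)" using n by (simp add: power2_eq_square field_simps)
    finally show "prob {w \<in> space M. real n * d \<le> \<bar>real (exceed Y n s w) - real n * tail s\<bar>} \<le> (1 / d\<^sup>2) * inverse (real n)" .
  qed
  show "(\<lambda>n. (1 / d\<^sup>2) * inverse (real n)) \<longlonglongrightarrow> 0"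
    using tendsto_mult_left[OF lim_inverse_n, of "1 / d\<^sup>2"] by simp
qed

lemma exceed_above:
  assumes "tail s < p"
  shows "(\<lambda>n. prob {w \<in> space M. nat \<lfloor>real n * p\<rfloor> < exceed Y n s w}) \<longlonglongrightarrow> 0"
proof (rule tendsto_sandwich[OF _ _ tendsto_const exceed_deviation[of "p - tail s" s]])
  show "\<forall>\<^sub>F n in sequentially. prob {w \<in> space M. nat \<lfloor>real n * p\<rfloor> < exceed Y n s w}
     \<le> prob {w \<in> space M. real n * (p - tail s) \<le> \<bar>real (exceed Y n s w) - real n * tail s\<bar>}"
  proof (intro always_eventually allI finite_measure_mono subsetI)
    fix n w assume w: "w \<in> {w \<in> space M. nat \<lfloor>real n * p\<rfloor> < exceed Y n s w}"
    then have "real n * p \<le> real (exceed Y n s w)" by (simp add: less_imp_le nat_less_iff floor_less_iff) linarith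
    then have "real n * (p - tail s) \<le> \<bar>real (exceed Y n s w) - real n * tail s\<bar>" unfolding right_diff_distrib by linarith
    with w show "w \<in> {w \<in> space M. real n * (p - tail s) \<le> \<bar>real (exceed Y n s w) - real n * tail s\<bar>}" by simp
  qed measurable
qed (use assms in auto)

text \<open>
  The second alternative is needed at \<open>p = 1\<close>: there the quantile is \<open>c\<close>, the tail cannot
  exceed \<open>p\<close> at any lower level, but almost surely all incomes lie above \<open>c\<close>.
\<close>
lemma exceed_below:
  assumes "0 \<le> p" "p \<le> 1" "p < tail s \<or> s \<le> c"
  shows "(\<lambda>n. prob {w \<in> space M. exceed Y n s w < nat \<lfloor>real n * p\<rfloor>}) \<longlonglongrightarrow> 0"
proof (cases "s \<le> c")
  case True
  have "prob {w \<in> space M. exceed Y n s w < nat \<lfloor>real n * p\<rfloor>} = 0" for n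
  proof (rule prob_eq_0_AE)
    have "real n * p \<le> real n" using assms by (intro mult_left_le) auto
    then have le: "nat \<lfloor>real n * p\<rfloor> \<le> n" by linarith
    show "AE w in M. \<not> exceed Y n s w < nat \<lfloor>real n * p\<rfloor>"
      using AE_Y_gt
    proof eventually_elim
      case (elim w)
      then have "{j \<in> {1..n}. s < Y j w} = {1..n}" using True by fastforce
      then show ?case unfolding exceed_def using le by simp
    qed
  qed
  then show ?thesis by simp
next
  case False
  with assms have d: "p < tail s" by simp
  show ?thesis
  proof (rule tendsto_sandwich[OF _ _ tendsto_const exceed_deviation[of "tail s - p" s]])
    show "\<forall>\<^sub>F n in sequentially. prob {w \<in> space M. exceed Y n s w < nat \<lfloor>real n * p\<rfloor>}
       \<le> prob {w \<in> space M. real n * (tail s - p) \<le> \<bar>real (exceed Y n s w) - real n * tail s\<bar>}"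
    proof (intro always_eventually allI finite_measure_mono subsetI)
      fix n w assume w: "w \<in> {w \<in> space M. exceed Y n s w < nat \<lfloor>real n * p\<rfloor>}"
      then have "real (exceed Y n s w) \<le> real n * p" by simp linarith
      then have "real n * (tail s - p) \<le> \<bar>real (exceed Y n s w) - real n * tail s\<bar>" unfolding right_diff_distrib by linarith
      with w show "w \<in> {w \<in> space M. real n * (tail s - p) \<le> \<bar>real (exceed Y n s w) - real n * tail s\<bar>}" by simp
    qed measurable
  qed (use d in auto)
qed

text \<open>
  The error of \<open>top_sum_linearization\<close> at the quantile.
\<close>
definition remainder :: "real \<Rightarrow> nat \<Rightarrow> 'a \<Rightarrow> real" where
  "remainder p n w = (\<Sum>i=1..nat \<lfloor>real n * p\<rfloor>. order_stat Y n i w)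
     - (real (nat \<lfloor>real n * p\<rfloor>) * quantile \<alpha> c p + (\<Sum>j=1..n. max 0 (Y j w - quantile \<alpha> c p)))"

lemma floor_le: "0 \<le> p \<Longrightarrow> p \<le> 1 \<Longrightarrow> nat \<lfloor>real n * p\<rfloor> \<le> n"
proof -
  assume "0 \<le> p" "p \<le> 1"
  then have "real n * p \<le> real n" by (intro mult_left_le) auto
  then show ?thesis by linarith
qed

lemma top_sum_measurable:
  assumes "0 \<le> p" "p \<le> 1"
  shows "(\<lambda>w. \<Sum>i=1..nat \<lfloor>real n * p\<rfloor>. order_stat Y n i w) \<in> borel_measurable M"
  using floor_le[OF assms, of n] by (intro borel_measurable_sum order_stat_measurable Y_measurable) auto

lemma remainder_measurable:
  assumes "0 \<le> p" "p \<le> 1"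
  shows "remainder p n \<in> borel_measurable M"
proof -
  note [measurable] = top_sum_measurable[OF assms] sum_measurable[of "\<lambda>y. max 0 (y - quantile \<alpha> c p)" n]
  show ?thesis unfolding remainder_def by measurable
qed

text \<open>
  Outside two events of small probability the \<open>m\<close>-th largest income is within \<open>d\<close> of the
  quantile. Then the error is at most \<open>d\<close> times a quantity of order $\sqrt n$, and \<open>d\<close> is
  arbitrary.
\<close>
lemma remainder_vanishing:
  assumes p: "0 < p" "p \<le> 1"
  shows "vanishing M (\<lambda>n w. remainder p n w / sqrt (real n))"
proof (rule vanishingI)
  have p0: "0 \<le> p" using p by simp
  note [measurable] = remainder_measurable[OF p0 p(2)]
  show "(\<lambda>w. remainder p n w / sqrt (real n)) \<in> borel_measurable M" for n by measurable
  fix e :: real assume "e > 0"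
  \<comment> \<open>Each exceptional event contributes d, and the remaining part at most 5/2 times d.\<close>
  define d where "d = e / 5"
  have d: "d > 0" "5 * d = e" unfolding d_def using \<open>e > 0\<close> by auto
  define t where "t = quantile \<alpha> c p"
  have tc: "c \<le> t" and tt: "tail t = p" unfolding t_def using p quantile_ge[OF \<alpha> c] tail_quantile by auto
  define m where "m n = nat \<lfloor>real n * p\<rfloor>" for n
  define A where "A n = {w \<in> space M. m n < exceed Y n (t + d) w}" for n
  define B where "B n = {w \<in> space M. exceed Y n (t - d) w < m n}" for n
  have [measurable]: "A n \<in> events" "B n \<in> events" for n unfolding A_def B_def by measurable
  have up: "tail (t + d) < p" using tail_strict_mono[OF tc, of "t + d"] d tt by simp
  have "(\<lambda>n. prob (A n)) \<longlonglongrightarrow> 0" unfolding A_def m_def by (rule exceed_above[OF up])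
  then have evA: "eventually (\<lambda>n. prob (A n) < d) sequentially" using d by (intro order_tendstoD(2)) auto
  have lo: "p < tail (t - d) \<or> t - d \<le> c"
    using tail_strict_mono[of "t - d" t] d tt by fastforce
  have "(\<lambda>n. prob (B n)) \<longlonglongrightarrow> 0" unfolding B_def m_def by (rule exceed_below[OF p0 p(2) lo])
  then have evB: "eventually (\<lambda>n. prob (B n) < d) sequentially" using d by (intro order_tendstoD(2)) auto
  show "eventually (\<lambda>n. expectation (\<lambda>w. min 1 \<bar>remainder p n w / sqrt (real n)\<bar>) \<le> e) sequentially"
    using evA evB eventually_ge_at_top[of 1]
  proof eventually_elim
    case (elim n)
    then have n: "n \<ge> 1" "real n > 0" by auto
    define Z where "Z w = real (exceed Y n t w) - real n * tail t" for w
    have Zi: "integrable M (\<lambda>w. (Z w)\<^sup>2)" and ZE: "expectation (\<lambda>w. (Z w)\<^sup>2) \<le> real n"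
      unfolding Z_def by (rule exceed_second_moment)+
    have bound: "min 1 \<bar>remainder p n w / sqrt (real n)\<bar> \<le> indicator (A n) w + indicator (B n) w + d * (3 / 2 + (Z w)\<^sup>2 / real n)"
      if w: "w \<in> space M" for w
    proof (cases "w \<in> A n \<or> w \<in> B n")
      case True
      have "0 \<le> d * (3 / 2 + (Z w)\<^sup>2 / real n)" using d by (intro mult_nonneg_nonneg add_nonneg_nonneg) auto
      moreover have "1 \<le> indicator (A n) w + (indicator (B n) w :: real)" using True by (auto simp: indicator_def)
      ultimately have "1 \<le> indicator (A n) w + indicator (B n) w + d * (3 / 2 + (Z w)\<^sup>2 / real n)" by linarith
      then show ?thesis by (rule min.coboundedI1)
    next
      case False
      then have AB: "exceed Y n (t + d) w \<le> m n" "m n \<le> exceed Y n (t - d) w" using w unfolding A_def B_def by auto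
      have "\<bar>remainder p n w\<bar> \<le> d * \<bar>real (exceed Y n t w) - real (m n)\<bar>"
        unfolding remainder_def m_def[symmetric] t_def[symmetric]
        using d AB floor_le[OF p0 p(2), of n] by (intro top_sum_linearization) (auto simp: m_def)
      also have "\<bar>real (exceed Y n t w) - real (m n)\<bar> \<le> \<bar>Z w\<bar> + 1"
      proof -
        have "real n * p \<ge> 0" using p by simp
        then have "\<bar>real (m n) - real n * p\<bar> \<le> 1" unfolding m_def by linarith
        then show ?thesis unfolding Z_def tt by linarith
      qed
      finally have r: "\<bar>remainder p n w\<bar> \<le> d * (\<bar>Z w\<bar> + 1)" using d by simp
      define s where "s = sqrt (real n)"
      have s: "s \<ge> 1" "s\<^sup>2 = real n" unfolding s_def using n by auto
      have "\<bar>remainder p n w / s\<bar> \<le> d * (\<bar>Z w\<bar> + 1) / s" using r s by (simp add: divide_right_mono)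
      also have "\<dots> = d * (\<bar>Z w\<bar> / s + 1 / s)"
        by (simp only: add_divide_distrib[symmetric] times_divide_eq_right)
      also have "\<dots> \<le> d * (3 / 2 + (Z w)\<^sup>2 / real n)"
      proof (intro mult_left_mono)
        \<comment> \<open>Trading the first moment for the second, for which a bound is known.\<close>
        have "0 \<le> (\<bar>Z w\<bar> / s - 1 / 2)\<^sup>2" by simp
        moreover have "(1 / 2 :: real)\<^sup>2 = 1 / 4" by (simp add: power2_eq_square)
        ultimately have "\<bar>Z w\<bar> / s \<le> (\<bar>Z w\<bar> / s)\<^sup>2 + 1 / 4" by (simp add: power2_diff)
        moreover have "(\<bar>Z w\<bar> / s)\<^sup>2 = (Z w)\<^sup>2 / real n" by (simp add: power_divide s)
        moreover have "1 / s \<le> 1" using s by simp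
        ultimately show "\<bar>Z w\<bar> / s + 1 / s \<le> 3 / 2 + (Z w)\<^sup>2 / real n" by linarith
      qed (use d in simp)
      finally have "\<bar>remainder p n w / s\<bar> \<le> indicator (A n) w + indicator (B n) w + d * (3 / 2 + (Z w)\<^sup>2 / real n)"
        using False by simp
      then show ?thesis unfolding s_def by (rule min.coboundedI2)
    qed
    have i1: "integrable M (\<lambda>w. indicator (A n) w + indicator (B n) w :: real)"
      by (intro Bochner_Integration.integrable_add integrable_real_indicator) (auto simp: emeasure_eq_measure)
    have i2: "integrable M (\<lambda>w. d * (3 / 2 + (Z w)\<^sup>2 / real n))"
      using Zi by (intro integrable_mult_right Bochner_Integration.integrable_add integrable_divide) auto
    have "expectation (\<lambda>w. min 1 \<bar>remainder p n w / sqrt (real n)\<bar>)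
        \<le> expectation (\<lambda>w. (indicator (A n) w + indicator (B n) w) + d * (3 / 2 + (Z w)\<^sup>2 / real n))"
      by (intro integral_mono integrable_min_1 Bochner_Integration.integrable_add[OF i1 i2] bound) measurable
    also have "\<dots> = expectation (\<lambda>w. indicator (A n) w + indicator (B n) w) + expectation (\<lambda>w. d * (3 / 2 + (Z w)\<^sup>2 / real n))"
      by (rule Bochner_Integration.integral_add[OF i1 i2])
    also have "expectation (\<lambda>w. indicator (A n) w + indicator (B n) w) = prob (A n) + prob (B n)"
      by (subst Bochner_Integration.integral_add) (auto simp: emeasure_eq_measure intro!: integrable_real_indicator)
    also have "expectation (\<lambda>w. d * (3 / 2 + (Z w)\<^sup>2 / real n)) = d * (3 / 2 + expectation (\<lambda>w. (Z w)\<^sup>2) / real n)"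
      using Zi by (simp add: prob_space)
    also have "\<dots> \<le> d * (3 / 2 + 1)" using d ZE n by (intro mult_left_mono add_left_mono) auto
    finally show ?case using elim d by simp
  qed
qed

end

context pareto_sample
begin

text \<open>
  The central limit theorem, evaluated at the test function $\cos(\sigma y + b)$ to undo the
  normalization by the standard deviation.
\<close>
lemma clt_cos:
  fixes h :: "real \<Rightarrow> real"
  assumes h[measurable]: "h \<in> borel_measurable borel" and B: "\<And>y. \<bar>h y\<bar> \<le> B"
    and m: "expectation (\<lambda>w. h (Y 1 w)) = 0" and v: "expectation (\<lambda>w. (h (Y 1 w))\<^sup>2) > 0"
  shows "(\<lambda>n. expectation (\<lambda>w. cos ((\<Sum>j=1..n. h (Y j w)) / sqrt (real n) + b)))
     \<longlonglongrightarrow> cos b * exp (- expectation (\<lambda>w. (h (Y 1 w))\<^sup>2) / 2)"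
proof -
  define \<sigma> where "\<sigma> = sqrt (expectation (\<lambda>w. (h (Y 1 w))\<^sup>2))"
  have \<sigma>: "\<sigma> > 0" "\<sigma>\<^sup>2 = expectation (\<lambda>w. (h (Y 1 w))\<^sup>2)" unfolding \<sigma>_def using v by auto
  define X where "X i w = h (Y (Suc i) w)" for i w
  have Xm[measurable]: "X i \<in> borel_measurable M" for i unfolding X_def by measurable
  have h2b: "\<bar>(h y)\<^sup>2\<bar> \<le> B\<^sup>2" for y using power_mono[OF B[of y] abs_ge_zero, of 2] by simp
  have EX: "expectation (X i) = 0" for i unfolding X_def using expectation_Y[OF _ h, of "Suc i"] m by simp
  have EX2: "expectation (\<lambda>w. (X i w)\<^sup>2) = \<sigma>\<^sup>2" for i
    unfolding X_def \<sigma>(2) by (rule expectation_Y[where h = "\<lambda>y. (h y)\<^sup>2"]) auto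
  have "weak_conv_m (\<lambda>n. distr M borel (\<lambda>w. (\<Sum>i<n. X i w) / sqrt (real n * \<sigma>\<^sup>2))) std_normal_distribution"
  proof (rule central_limit_theorem_zero_mean[where \<mu> = "distr M borel (X 0)"])
    show "indep_vars (\<lambda>i. borel) X UNIV"
      using indep_vars_compose2[OF indep_vars_shift[OF indep], of "\<lambda>_. h" "\<lambda>_. borel"] unfolding X_def[abs_def] by simp
    show "integrable M (\<lambda>w. (X i w)\<^sup>2)" for i unfolding X_def
      by (rule integrable_bounded_comp[where h = "\<lambda>y. (h y)\<^sup>2", OF _ _ h2b]) auto
    show "variance (X i) = \<sigma>\<^sup>2" for i unfolding EX by (simp add: EX2)
    show "distr M borel (X i) = distr M borel (X 0)" for i
    proof -
      have "distr M borel (X i) = distr (distr M borel (Y (Suc i))) borel h" for i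
        unfolding X_def by (subst distr_distr) (auto simp: comp_def)
      then show ?thesis using distr_Y[of "Suc i"] by simp
    qed
  qed (use \<sigma>(1) EX in auto)
  then have "(\<lambda>n. \<integral>y. cos (\<sigma> * y + b) \<partial>distr M borel (\<lambda>w. (\<Sum>i<n. X i w) / sqrt (real n * \<sigma>\<^sup>2)))
     \<longlonglongrightarrow> (\<integral>y. cos (\<sigma> * y + b) \<partial>std_normal_distribution)"
    by (intro weak_conv_imp_integral_bdd_continuous_conv[where B = 1] real_distribution_distr real_dist_normal_dist) auto
  moreover have "(\<integral>y. cos (\<sigma> * y + b) \<partial>distr M borel (\<lambda>w. (\<Sum>i<n. X i w) / sqrt (real n * \<sigma>\<^sup>2)))
      = expectation (\<lambda>w. cos ((\<Sum>j=1..n. h (Y j w)) / sqrt (real n) + b))" for n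
  proof -
    have "(\<Sum>i<n. X i w) = (\<Sum>j=1..n. h (Y j w))" for w
      unfolding X_def by (simp add: sum.atLeast1_atMost_eq)
    then have eq: "cos (\<sigma> * ((\<Sum>i<n. X i w) / sqrt (real n * \<sigma>\<^sup>2)) + b) = cos ((\<Sum>j=1..n. h (Y j w)) / sqrt (real n) + b)" for w
      using \<sigma>(1) by (simp add: real_sqrt_mult)
    have "(\<integral>y. cos (\<sigma> * y + b) \<partial>distr M borel (\<lambda>w. (\<Sum>i<n. X i w) / sqrt (real n * \<sigma>\<^sup>2)))
       = expectation (\<lambda>w. cos (\<sigma> * ((\<Sum>i<n. X i w) / sqrt (real n * \<sigma>\<^sup>2)) + b))"
      by (rule integral_distr) measurable
    then show ?thesis unfolding eq .
  qed
  moreover have "(\<integral>y. cos (\<sigma> * y + b) \<partial>std_normal_distribution) = cos b * exp (- expectation (\<lambda>w. (h (Y 1 w))\<^sup>2) / 2)"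
  proof -
    have "(std_gauss :: real \<Rightarrow> real) = std_normal_density" by (rule ext) (simp add: std_gauss_def)
    then show ?thesis using std_gauss_cos[of \<sigma> b] \<sigma>(2) by (simp add: power2_eq_square)
  qed
  ultimately show ?thesis by simp
qed

lemma prob_interval_pos:
  assumes "c \<le> a" "a < b" shows "prob {w \<in> space M. a < Y 1 w \<and> Y 1 w \<le> b} > 0"
proof -
  have [measurable]: "Y 1 \<in> borel_measurable M" by (rule Y_measurable) simp
  have "prob {w \<in> space M. a < Y 1 w \<and> Y 1 w \<le> b} = prob ({w \<in> space M. a < Y 1 w} - {w \<in> space M. b < Y 1 w})"
    by (rule arg_cong[where f = prob]) auto
  also have "\<dots> = tail a - tail b" unfolding tail_def by (rule finite_measure_Diff) (use assms in auto)
  finally show ?thesis using tail_strict_mono[OF assms] by simp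
qed

lemma AE_witness_in_interval:
  assumes "c \<le> a" "a < b" and P: "AE w in M. P (Y 1 w)"
  shows "\<exists>y. a < y \<and> y \<le> b \<and> P y"
proof (rule ccontr)
  assume "\<not> ?thesis"
  then have "\<not> P y" if "a < y" "y \<le> b" for y using that by blast
  note no = this
  from P have "AE w in M. \<not> (a < Y 1 w \<and> Y 1 w \<le> b)" by eventually_elim (use no in blast)
  then have "prob {w \<in> space M. a < Y 1 w \<and> Y 1 w \<le> b} = 0" by (rule prob_eq_0_AE)
  with prob_interval_pos[OF assms(1,2)] show False by simp
qed

end

section \<open>Blocks of order statistics and their ratios\<close>

locale top_shares = pareto_sample +
  fixes K :: nat and p :: "nat \<Rightarrow> real"
  assumes K: "K \<ge> 2" and p1: "0 < p 1" and p_incr: "\<And>k. k \<in> {1..K} \<Longrightarrow> p k < p (k + 1)" and pK: "p (K + 1) \<le> 1"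
begin

lemma p_less: "1 \<le> j \<Longrightarrow> j < k \<Longrightarrow> k \<le> K + 1 \<Longrightarrow> p j < p k"
proof (induction k)
  case (Suc k)
  then have "p k < p (Suc k)" using p_incr[of k] by simp
  moreover have "j = k \<or> p j < p k" using Suc by (cases "j = k") auto
  ultimately show ?case by auto
qed simp

lemma p_pos: "1 \<le> k \<Longrightarrow> k \<le> K + 1 \<Longrightarrow> 0 < p k"
  using p_less[of 1 k] p1 by (cases "k = 1") auto

lemma p_le_1: "1 \<le> k \<Longrightarrow> k \<le> K + 1 \<Longrightarrow> p k \<le> 1"
  using p_less[of k "K + 1"] pK by (cases "k = K + 1") auto

definition t :: "nat \<Rightarrow> real" where "t k = quantile \<alpha> c (p k)"

lemma t_less: "1 \<le> j \<Longrightarrow> j < k \<Longrightarrow> k \<le> K + 1 \<Longrightarrow> t k < t j"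
  unfolding t_def by (intro quantile_strict_mono[OF \<alpha> c] p_less p_pos) auto

lemma t_le: "1 \<le> j \<Longrightarrow> j \<le> k \<Longrightarrow> k \<le> K + 1 \<Longrightarrow> t k \<le> t j"
  using t_less[of j k] by (cases "j = k") auto

lemma t_ge: "1 \<le> k \<Longrightarrow> k \<le> K + 1 \<Longrightarrow> c \<le> t k"
  unfolding t_def by (intro quantile_ge[OF \<alpha> c] p_pos p_le_1)

abbreviation slab_mean_at :: "nat \<Rightarrow> real" where "slab_mean_at k \<equiv> mean_slab \<alpha> c (p k) (p (k + 1))"

definition centred_slab :: "nat \<Rightarrow> real \<Rightarrow> real" where "centred_slab k y = slab (t (k + 1)) (t k) y - slab_mean_at k"

lemma centred_slab_measurable [measurable]: "centred_slab k \<in> borel_measurable borel"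
  unfolding centred_slab_def by measurable

lemma slab_bounded: "\<bar>slab a b y\<bar> \<le> \<bar>a\<bar> + \<bar>b\<bar>"
  unfolding slab_def by (auto simp: max_def min_def)

lemma centred_slab_bounded: "\<bar>centred_slab k y\<bar> \<le> \<bar>t (k + 1)\<bar> + \<bar>t k\<bar> + \<bar>slab_mean_at k\<bar>"
  unfolding centred_slab_def using slab_bounded[of "t (k + 1)" "t k" y] by linarith

lemma Y1: "Y 1 \<in> borel_measurable M" "pareto_distributed M \<alpha> c (Y 1)"
  using Y_measurable pareto by auto

lemma slab_integrable: "integrable M (\<lambda>w. slab a b (Y 1 w))"
  by (rule integrable_bounded_comp[OF order_refl _ slab_bounded]) measurable

lemma slab_square_integrable: "integrable M (\<lambda>w. (slab a b (Y 1 w))\<^sup>2)"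
proof (rule integrable_bounded_comp[OF order_refl, where h = "\<lambda>y. (slab a b y)\<^sup>2"])
  show "\<bar>(slab a b y)\<^sup>2\<bar> \<le> (\<bar>a\<bar> + \<bar>b\<bar>)\<^sup>2" for y
    using power_mono[OF slab_bounded[of a b y] abs_ge_zero, of 2] by simp
qed measurable

lemma slab_expectation:
  assumes "k \<in> {1..K}"
  shows "expectation (\<lambda>w. slab (t (k + 1)) (t k) (Y 1 w)) = slab_mean_at k"
  unfolding t_def using assms p_pos[of k] p_less[of k "k + 1"] p_le_1[of "k + 1"]
  by (intro slab_mean[OF \<alpha> c prob_space_axioms Y1(2)]) auto

lemma centred_slab_mean: "k \<in> {1..K} \<Longrightarrow> expectation (\<lambda>w. centred_slab k (Y 1 w)) = 0"
  unfolding centred_slab_def by (simp add: slab_integrable slab_expectation prob_space del: One_nat_def Suc_eq_plus1 add_Suc_right)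

definition slab_cov :: "nat \<Rightarrow> nat \<Rightarrow> real" where
  "slab_cov j k = (if j = k then sigma2 \<alpha> c (p k) (p (k + 1))
     else if j < k then sigma_offdiag \<alpha> c p j k else sigma_offdiag \<alpha> c p k j)"

lemma slab_cov_sym: "slab_cov j k = slab_cov k j"
  unfolding slab_cov_def by auto

lemma centred_slab_product_integrable: "integrable M (\<lambda>w. centred_slab j (Y 1 w) * centred_slab k (Y 1 w))"
proof (rule integrable_bounded_comp[OF order_refl, where h = "\<lambda>y. centred_slab j y * centred_slab k y"])
  show "\<bar>centred_slab j y * centred_slab k y\<bar> \<le> (\<bar>t (j + 1)\<bar> + \<bar>t j\<bar> + \<bar>slab_mean_at j\<bar>) * (\<bar>t (k + 1)\<bar> + \<bar>t k\<bar> + \<bar>slab_mean_at k\<bar>)" for y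
    unfolding abs_mult by (intro mult_mono centred_slab_bounded) auto
qed measurable

lemma centred_slab_covariance_aux:
  assumes jk: "j \<in> {1..K}" "k \<in> {1..K}" "j < k"
  shows "expectation (\<lambda>w. centred_slab j (Y 1 w) * centred_slab k (Y 1 w)) = sigma_offdiag \<alpha> c p j k"
proof -
  let ?a = "\<lambda>w. slab (t (j + 1)) (t j) (Y 1 w)" and ?b = "\<lambda>w. slab (t (k + 1)) (t k) (Y 1 w)"
  have nest: "?b w * ?a w = (t k - t (k + 1)) * ?a w" for w
    using jk by (intro slab_mult_nested t_le) auto
  have "centred_slab j (Y 1 w) * centred_slab k (Y 1 w) = (t k - t (k + 1) - slab_mean_at k) * ?a w - slab_mean_at j * ?b w + slab_mean_at j * slab_mean_at k" for w
    using nest[of w] unfolding centred_slab_def by (simp add: algebra_simps)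
  then have "expectation (\<lambda>w. centred_slab j (Y 1 w) * centred_slab k (Y 1 w))
     = (t k - t (k + 1) - slab_mean_at k) * expectation ?a - slab_mean_at j * expectation ?b + slab_mean_at j * slab_mean_at k"
    using slab_integrable by (simp add: prob_space)
  also have "\<dots> = (t k - t (k + 1) - slab_mean_at k) * slab_mean_at j"
    unfolding slab_expectation[OF jk(1)] slab_expectation[OF jk(2)] by simp
  also have "\<dots> = sigma_offdiag \<alpha> c p j k"
    unfolding sigma_offdiag_eq[OF \<alpha> c] t_def by simp
  finally show ?thesis .
qed

text \<open>
  Nesting gives the off-diagonal entries of \<open>Sigma_mat\<close> and the second moment the diagonal
  ones; the indices are positions here.
\<close>
lemma centred_slab_covariance:
  assumes jk: "j \<in> {1..K}" "k \<in> {1..K}"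
  shows "expectation (\<lambda>w. centred_slab j (Y 1 w) * centred_slab k (Y 1 w)) = slab_cov j k"
proof -
  consider "j = k" | "j < k" | "k < j" by linarith
  then show ?thesis
  proof cases
    case 1
    let ?b = "\<lambda>w. slab (t (k + 1)) (t k) (Y 1 w)"
    have "centred_slab j (Y 1 w) * centred_slab k (Y 1 w) = (?b w)\<^sup>2 - 2 * slab_mean_at k * ?b w + (slab_mean_at k)\<^sup>2" for w
      unfolding centred_slab_def 1 by (simp add: power2_eq_square algebra_simps)
    then have "expectation (\<lambda>w. centred_slab j (Y 1 w) * centred_slab k (Y 1 w))
       = expectation (\<lambda>w. (?b w)\<^sup>2) - 2 * slab_mean_at k * expectation ?b + (slab_mean_at k)\<^sup>2"
      using slab_integrable slab_square_integrable by (simp add: prob_space)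
    also have "expectation (\<lambda>w. (?b w)\<^sup>2) = sigma2 \<alpha> c (p k) (p (k + 1)) + (slab_mean_at k)\<^sup>2"
      unfolding t_def using jk p_pos[of k] p_less[of k "k + 1"] p_le_1[of "k + 1"]
      by (intro slab_second_moment[OF \<alpha> c prob_space_axioms Y1(2)]) auto
    also have "expectation ?b = slab_mean_at k" by (rule slab_expectation[OF jk(2)])
    finally show ?thesis unfolding slab_cov_def 1 by (simp add: power2_eq_square)
  next
    case 2
    then show ?thesis using centred_slab_covariance_aux[OF jk 2] unfolding slab_cov_def by simp
  next
    case 3
    then show ?thesis using centred_slab_covariance_aux[OF jk(2,1) 3] unfolding slab_cov_def by (simp add: mult.commute)
  qed
qed

definition slab_comb :: "(nat \<Rightarrow> real) \<Rightarrow> real \<Rightarrow> real" where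
  "slab_comb z y = (\<Sum>k=1..K. z k * centred_slab k y)"

lemma slab_comb_measurable [measurable]: "slab_comb z \<in> borel_measurable borel"
  unfolding slab_comb_def by measurable

lemma slab_comb_bounded: "\<bar>slab_comb z y\<bar> \<le> (\<Sum>k=1..K. \<bar>z k\<bar> * (\<bar>t (k + 1)\<bar> + \<bar>t k\<bar> + \<bar>slab_mean_at k\<bar>))"
  unfolding slab_comb_def by (rule order_trans[OF sum_abs]) (intro sum_mono, simp only: abs_mult, intro mult_left_mono centred_slab_bounded abs_ge_zero)

lemma centred_slab_integrable: "integrable M (\<lambda>w. centred_slab k (Y 1 w))"
  by (rule integrable_bounded_comp[OF order_refl _ centred_slab_bounded]) measurable

lemma slab_comb_mean: "expectation (\<lambda>w. slab_comb z (Y 1 w)) = 0"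
  unfolding slab_comb_def using centred_slab_integrable centred_slab_mean by (simp del: One_nat_def)

lemma slab_comb_second_moment:
  "expectation (\<lambda>w. (slab_comb z (Y 1 w))\<^sup>2) = (\<Sum>j=1..K. \<Sum>k=1..K. z j * z k * slab_cov j k)"
proof -
  have "(slab_comb z y)\<^sup>2 = (\<Sum>j=1..K. \<Sum>k=1..K. z j * z k * (centred_slab j y * centred_slab k y))" for y
    unfolding slab_comb_def power2_eq_square sum_product by (intro sum.cong) (auto simp: algebra_simps)
  then have "expectation (\<lambda>w. (slab_comb z (Y 1 w))\<^sup>2) = (\<Sum>j=1..K. \<Sum>k=1..K. z j * z k * expectation (\<lambda>w. centred_slab j (Y 1 w) * centred_slab k (Y 1 w)))"
    using centred_slab_product_integrable by (simp del: One_nat_def)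
  then show ?thesis using centred_slab_covariance by (simp del: One_nat_def)
qed

text \<open>
  On the interval of the \<open>k\<close>-th slab all other slabs are constant: empty if they lie above it,
  full if they lie below it.
\<close>
lemma slab_comb_affine:
  assumes k: "k \<in> {1..K}" and y: "t (k + 1) \<le> y" "y \<le> t k" "t (k + 1) \<le> y'" "y' \<le> t k"
  shows "slab_comb z y - slab_comb z y' = z k * (y - y')"
proof -
  have "centred_slab j y - centred_slab j y' = (if j = k then y - y' else 0)" if j: "j \<in> {1..K}" for j
  proof -
    consider "j = k" | "j < k" | "k < j" by linarith
    then show ?thesis
    proof cases
      case 1
      then show ?thesis unfolding centred_slab_def slab_def using y by simp
    next
      case 2
      then have "t k \<le> t (j + 1)" using j k by (intro t_le) auto
      then show ?thesis unfolding centred_slab_def slab_def using y 2 by simp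
    next
      case 3
      then have "t j \<le> t (k + 1)" "t (j + 1) \<le> t j" using j k by (auto intro!: t_le)
      then show ?thesis unfolding centred_slab_def slab_def using y 3 by simp
    qed
  qed
  then have "(\<Sum>j=1..K. z j * (centred_slab j y - centred_slab j y')) = (\<Sum>j=1..K. if j = k then z k * (y - y') else 0)"
    by (intro sum.cong) auto
  then show ?thesis unfolding slab_comb_def using k by (simp add: sum_subtractf[symmetric] right_diff_distrib)
qed

text \<open>
  If the variance were zero, the combination would vanish at two different points of the \<open>k\<close>-th
  interval, one in each half, contradicting its slope.
\<close>
lemma slab_comb_nondegenerate:
  assumes k: "k \<in> {1..K}" "z k \<noteq> 0"
  shows "expectation (\<lambda>w. (slab_comb z (Y 1 w))\<^sup>2) > 0"
proof (rule ccontr)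
  define B where "B = (\<Sum>k=1..K. \<bar>z k\<bar> * (\<bar>t (k + 1)\<bar> + \<bar>t k\<bar> + \<bar>slab_mean_at k\<bar>))"
  have b: "\<bar>(slab_comb z y)\<^sup>2\<bar> \<le> B\<^sup>2" for y using power_mono[OF slab_comb_bounded[of z y] abs_ge_zero, of 2] unfolding B_def by simp
  have i: "integrable M (\<lambda>w. (slab_comb z (Y 1 w))\<^sup>2)"
    by (rule integrable_bounded_comp[OF order_refl, where h = "\<lambda>y. (slab_comb z y)\<^sup>2", OF _ b]) measurable
  assume "\<not> ?thesis"
  moreover have "expectation (\<lambda>w. (slab_comb z (Y 1 w))\<^sup>2) \<ge> 0" by (intro integral_nonneg_AE) auto
  ultimately have "expectation (\<lambda>w. (slab_comb z (Y 1 w))\<^sup>2) = 0" by linarith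
  then have "AE w in M. (slab_comb z (Y 1 w))\<^sup>2 = 0" using integral_nonneg_eq_0_iff_AE[OF i] by simp
  then have ae: "AE w in M. slab_comb z (Y 1 w) = 0" by simp
  define m where "m = (t (k + 1) + t k) / 2"
  have tk: "t (k + 1) < t k" "c \<le> t (k + 1)" using k by (auto intro!: t_less t_ge)
  obtain y where y: "t (k + 1) < y" "y \<le> m" "slab_comb z y = 0"
    using AE_witness_in_interval[OF tk(2), of m "\<lambda>y. slab_comb z y = 0"] ae tk(1) unfolding m_def by auto
  obtain y' where y': "m < y'" "y' \<le> t k" "slab_comb z y' = 0"
    using AE_witness_in_interval[of m "t k" "\<lambda>y. slab_comb z y = 0"] ae tk unfolding m_def by auto
  have "slab_comb z y' - slab_comb z y = z k * (y' - y)"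
    using slab_comb_affine[OF k(1), of y' y z] y y' tk unfolding m_def by auto
  then show False using y y' k by simp
qed

definition block_sum :: "nat \<Rightarrow> nat \<Rightarrow> 'a \<Rightarrow> real" where
  "block_sum k n w = (\<Sum>i=1..nat \<lfloor>real n * p (k + 1)\<rfloor>. order_stat Y n i w) - (\<Sum>i=1..nat \<lfloor>real n * p k\<rfloor>. order_stat Y n i w)"

definition slab_sum :: "nat \<Rightarrow> nat \<Rightarrow> 'a \<Rightarrow> real" where
  "slab_sum k n w = (\<Sum>j=1..n. centred_slab k (Y j w)) / sqrt (real n)"

abbreviation block_mean :: "nat \<Rightarrow> real" where "block_mean k \<equiv> mu \<alpha> c (p k) (p (k + 1))"

text \<open>
  The part of the centred and scaled block sum that is not a sum of independent terms.
\<close>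
definition block_error :: "nat \<Rightarrow> nat \<Rightarrow> 'a \<Rightarrow> real" where
  "block_error k n w = (block_sum k n w - real n * block_mean k) / sqrt (real n) - slab_sum k n w"

lemma block_mean_pos: "k \<in> {1..K} \<Longrightarrow> block_mean k > 0"
  by (intro mu_pos[OF \<alpha> c] p_pos p_less) auto

lemma slab_sum_measurable [measurable]: "slab_sum k n \<in> borel_measurable M"
  using sum_measurable[of "centred_slab k" n] unfolding slab_sum_def by measurable

lemma top_measurable [measurable]:
  "1 \<le> k \<Longrightarrow> k \<le> K + 1 \<Longrightarrow> (\<lambda>w. \<Sum>i=1..nat \<lfloor>real n * p k\<rfloor>. order_stat Y n i w) \<in> borel_measurable M"
  by (rule top_sum_measurable) (use p_pos[of k] p_le_1[of k] in auto)

lemma floor_error_vanishing: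
  assumes "0 \<le> x"
  shows "(\<lambda>n. (real (nat \<lfloor>real n * x\<rfloor>) - real n * x) * a / sqrt (real n)) \<longlonglongrightarrow> 0"
proof (rule Lim_null_comparison)
  have "(\<lambda>n. \<bar>a\<bar> * (1 / sqrt (real n))) \<longlonglongrightarrow> \<bar>a\<bar> * 0"
    by (intro tendsto_mult_left) (rule real_tendsto_divide_at_top[OF tendsto_const filterlim_compose[OF sqrt_at_top filterlim_real_sequentially]])
  then show "(\<lambda>n. \<bar>a\<bar> * (1 / sqrt (real n))) \<longlonglongrightarrow> 0" by simp
  have "norm ((real (nat \<lfloor>real n * x\<rfloor>) - real n * x) * a / sqrt (real n)) \<le> \<bar>a\<bar> * (1 / sqrt (real n))" for n
  proof -
    have "0 \<le> real n * x" using assms by simp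
    then have "\<bar>real (nat \<lfloor>real n * x\<rfloor>) - real n * x\<bar> \<le> 1" by linarith
    then have "\<bar>real (nat \<lfloor>real n * x\<rfloor>) - real n * x\<bar> * \<bar>a\<bar> / sqrt (real n) \<le> 1 * \<bar>a\<bar> / sqrt (real n)"
      by (intro divide_right_mono mult_right_mono) auto
    then show ?thesis by (simp add: abs_mult)
  qed
  then show "\<forall>\<^sub>F n in sequentially. norm ((real (nat \<lfloor>real n * x\<rfloor>) - real n * x) * a / sqrt (real n)) \<le> \<bar>a\<bar> * (1 / sqrt (real n))"
    by (intro always_eventually allI)
qed

text \<open>
  Two remainders, at the two ends of the block, and the effect of rounding \<open>n * p k\<close> to an
  integer.
\<close>
lemma block_error_vanishing:
  assumes k: "k \<in> {1..K}"
  shows "vanishing M (block_error k)"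
proof -
  define f where "f k n = (real (nat \<lfloor>real n * p k\<rfloor>) - real n * p k) * t k / sqrt (real n)" for k n
  have pk: "0 < p k" "p k < p (k + 1)" "p (k + 1) \<le> 1" "0 < p (k + 1)" "p k \<le> 1"
    using k p_pos[of k] p_less[of k "k + 1"] p_le_1[of "k + 1"] p_pos[of "k + 1"] p_le_1[of k] by auto
  have tk: "t (k + 1) \<le> t k" using k by (intro t_le) auto
  have eq: "block_error k n w = remainder (p (k + 1)) n w / sqrt (real n) + (- 1) * (remainder (p k) n w / sqrt (real n)) + (f (k + 1) n + (- 1) * f k n)" for n w
  proof -
    define m m' where "m = real (nat \<lfloor>real n * p k\<rfloor>)" and "m' = real (nat \<lfloor>real n * p (k + 1)\<rfloor>)"
    have "(\<Sum>j=1..n. max 0 (Y j w - t (k + 1))) - (\<Sum>j=1..n. max 0 (Y j w - t k)) = (\<Sum>j=1..n. slab (t (k + 1)) (t k) (Y j w))"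
      unfolding sum_subtractf[symmetric] slab_eq[OF tk] ..
    moreover have "(\<Sum>j=1..n. centred_slab k (Y j w)) = (\<Sum>j=1..n. slab (t (k + 1)) (t k) (Y j w)) - real n * slab_mean_at k"
      unfolding centred_slab_def by (simp add: sum_subtractf)
    moreover have mu: "block_mean k = slab_mean_at k + p (k + 1) * t (k + 1) - p k * t k"
      unfolding t_def by (rule mu_eq[OF \<alpha> c pk(1,4)])
    ultimately have "block_sum k n w - real n * block_mean k - (\<Sum>j=1..n. centred_slab k (Y j w)) =
       remainder (p (k + 1)) n w - remainder (p k) n w + ((m' - real n * p (k + 1)) * t (k + 1) - (m - real n * p k) * t k)"
      unfolding block_sum_def remainder_def t_def[symmetric] m_def[symmetric] m'_def[symmetric] mu by (simp add: algebra_simps)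
    then have "block_error k n w = (remainder (p (k + 1)) n w - remainder (p k) n w + ((m' - real n * p (k + 1)) * t (k + 1) - (m - real n * p k) * t k)) / sqrt (real n)"
      unfolding block_error_def slab_sum_def diff_divide_distrib[symmetric] by simp
    then show ?thesis unfolding f_def m_def m'_def by (simp add: add_divide_distrib diff_divide_distrib)
  qed
  have "f (k + 1) \<longlonglongrightarrow> 0" "f k \<longlonglongrightarrow> 0"
    unfolding f_def by (rule floor_error_vanishing, use pk in simp)+
  from tendsto_diff[OF this] have "(\<lambda>n. f (k + 1) n + (- 1) * f k n) \<longlonglongrightarrow> 0" by simp
  then have "vanishing M (\<lambda>n w. remainder (p (k + 1)) n w / sqrt (real n) + (- 1) * (remainder (p k) n w / sqrt (real n)) + (f (k + 1) n + (- 1) * f k n))"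
    using pk by (intro vanishing_add vanishing_cmult vanishing_const remainder_vanishing)
  then show ?thesis unfolding eq[symmetric] .
qed

lemma slab_sum_second_moment:
  assumes k: "k \<in> {1..K}"
  shows "integrable M (\<lambda>w. (slab_sum k n w)\<^sup>2)" "expectation (\<lambda>w. (slab_sum k n w)\<^sup>2) \<le> expectation (\<lambda>w. (centred_slab k (Y 1 w))\<^sup>2)"
proof -
  have sq: "(slab_sum k n w)\<^sup>2 = (\<Sum>j=1..n. centred_slab k (Y j w))\<^sup>2 / real n" for w
    unfolding slab_sum_def by (simp add: power_divide)
  note m = second_moment_centred_sum[OF centred_slab_measurable centred_slab_bounded centred_slab_mean[OF k], of n]
  show "integrable M (\<lambda>w. (slab_sum k n w)\<^sup>2)" unfolding sq using m(1) by simp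
  have "expectation (\<lambda>w. (slab_sum k n w)\<^sup>2) = real n * expectation (\<lambda>w. (centred_slab k (Y 1 w))\<^sup>2) / real n"
    unfolding sq m(2)[symmetric] by simp
  also have "\<dots> \<le> expectation (\<lambda>w. (centred_slab k (Y 1 w))\<^sup>2)"
  proof (cases "n = 0")
    case True
    then show ?thesis by (simp add: integral_nonneg_AE)
  qed simp
  finally show "expectation (\<lambda>w. (slab_sum k n w)\<^sup>2) \<le> expectation (\<lambda>w. (centred_slab k (Y 1 w))\<^sup>2)" .
qed

lemma normalized_share_measurable:
  assumes "k \<in> {1..K}"
  shows "(\<lambda>w. normalized_share Y p K n w k) \<in> borel_measurable M"
proof -
  have [measurable]: "top_share Y p n j \<in> borel_measurable M" if "1 \<le> j" "j \<le> K + 1" for j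
    unfolding top_share_def using that
    by (intro borel_measurable_divide top_measurable borel_measurable_sum order_stat_measurable Y_measurable) auto
  show ?thesis
    unfolding normalized_share_def using assms
    by (intro borel_measurable_divide borel_measurable_diff) auto
qed

text \<open>
  With $q_n = \mu_K / (\mu_K + Q_n) - 1$, where $\mu_K + Q_n$ is the last block sum divided by $n$,
  the scaled error of the ratio is $(1 + q_n)/\mu_K$ times the scaled sum of the block \<open>k\<close>
  minus $r_k$ times that of the block \<open>K\<close>; the part with $q_n$ vanishes because $q_n$ does and
  the slab sums are bounded in $L^2$. The denominator is positive almost surely as soon as the last
  block is not empty.
\<close>
lemma share_linearization:
  assumes k: "k \<in> {1..<K}"
  shows "vanishing M (\<lambda>n w. sqrt (real n) * (normalized_share Y p K n w k - mean_ratio \<alpha> c p K k)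
      - (slab_sum k n w - mean_ratio \<alpha> c p K k * slab_sum K n w) / block_mean K)"
proof -
  define r where "r = mean_ratio \<alpha> c p K k"
  have kK: "k \<in> {1..K}" "K \<in> {1..K}" using k K by auto
  note \<mu> = block_mean_pos[OF kK(2)]
  have r: "r * block_mean K = block_mean k" unfolding r_def mean_ratio_def using \<mu> by simp
  define Q where "Q n w = (1 / sqrt (real n)) * slab_sum K n w + (1 / sqrt (real n)) * block_error K n w" for n w
  have sq0: "(\<lambda>n. 1 / sqrt (real n)) \<longlonglongrightarrow> 0"
    by (rule real_tendsto_divide_at_top[OF tendsto_const filterlim_compose[OF sqrt_at_top filterlim_real_sequentially]])
  have Q: "vanishing M Q"
    unfolding Q_def
    by (intro vanishing_add vanishing_L2[OF slab_sum_measurable slab_sum_second_moment[OF kK(2)] sq0]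
      vanishing_mult_vanishing[OF vanishing_const[OF sq0] block_error_vanishing[OF kK(2)]])
  define q where "q n w = block_mean K / (block_mean K + Q n w) - 1" for n w
  have q: "vanishing M q" unfolding q_def by (rule vanishing_quotient[OF Q \<mu>])
  define E where "E n w = q n w * slab_sum k n w + (- r) * (q n w * slab_sum K n w) + (q n w * block_error k n w + (- r) * (q n w * block_error K n w))
     + (block_error k n w + (- r) * block_error K n w)" for n w
  have E: "vanishing M E"
    unfolding E_def
    by (intro vanishing_add vanishing_cmult vanishing_mult_L2[OF q slab_sum_measurable slab_sum_second_moment[OF kK(1)]]
      vanishing_mult_L2[OF q slab_sum_measurable slab_sum_second_moment[OF kK(2)]]
      vanishing_mult_vanishing[OF q] block_error_vanishing kK)
  have E': "vanishing M (\<lambda>n w. (1 / block_mean K) * E n w)" by (rule vanishing_cmult[OF E])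
  define L where "L n w = sqrt (real n) * (normalized_share Y p K n w k - r) - (slab_sum k n w - r * slab_sum K n w) / block_mean K" for n w
  have Lm: "L n \<in> borel_measurable M" for n
    unfolding L_def using normalized_share_measurable[OF kK(1), of n] by measurable
  have big: "eventually (\<lambda>n. 1 \<le> n \<and> nat \<lfloor>real n * p K\<rfloor> < nat \<lfloor>real n * p (K + 1)\<rfloor>) sequentially"
  proof -
    have d: "0 < p (K + 1) - p K" using p_less[of K "K + 1"] kK by simp
    obtain n0 :: nat where n0: "1 / (p (K + 1) - p K) \<le> real n0" using real_arch_simple by blast
    show ?thesis
    proof (rule eventually_sequentiallyI[of "max 1 n0"])
      fix n assume n: "max 1 n0 \<le> n"
      then have "1 / (p (K + 1) - p K) \<le> real n" using n0 by linarith
      then have "1 \<le> real n * (p (K + 1) - p K)" using d by (simp add: field_simps)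
      then have "real n * p K + 1 \<le> real n * p (K + 1)" by (simp add: algebra_simps)
      moreover have "0 \<le> real n * p K" using p_pos[of K] kK by simp
      ultimately have "nat \<lfloor>real n * p K\<rfloor> < nat \<lfloor>real n * p (K + 1)\<rfloor>" by linarith
      then show "1 \<le> n \<and> nat \<lfloor>real n * p K\<rfloor> < nat \<lfloor>real n * p (K + 1)\<rfloor>" using n by simp
    qed
  qed
  have "vanishing M L"
  proof (rule vanishing_dominated[OF Lm E', where C = 1])
    show "eventually (\<lambda>n. AE w in M. min 1 \<bar>L n w\<bar> \<le> 1 * min 1 \<bar>(1 / block_mean K) * E n w\<bar>) sequentially"
      using big
    proof eventually_elim
      case (elim n)
      show ?case
        using AE_Y_gt
      proof eventually_elim
        fix w assume Yc: "\<forall>j\<ge>1. c < Y j w"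
        have os: "0 < order_stat Y n i w" if i: "i \<in> {1..n}" for i
        proof -
          obtain i' where i': "i = Suc i'" "i' < n" using i by (cases i) auto
          have "{j \<in> {1..n}. c < Y j w} = {1..n}" using Yc by auto
          then have "exceed Y n c w = n" unfolding exceed_def by simp
          then have "c < order_stat Y n i w" unfolding i'(1) order_stat_gt_iff[OF i'(2)] using i'(2) by simp
          with c show ?thesis by simp
        qed
        define m m' where "m = nat \<lfloor>real n * p K\<rfloor>" and "m' = nat \<lfloor>real n * p (K + 1)\<rfloor>"
        have mm: "m < m'" "m' \<le> n" using elim floor_le[of "p (K + 1)" n] pK p_pos[of "K + 1"] unfolding m_def m'_def by auto
        have T: "(\<Sum>i=1..n. order_stat Y n i w) > 0" using elim by (intro sum_pos os) auto
        have DK: "block_sum K n w > 0"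
        proof -
          have "(\<Sum>i=1..m'. order_stat Y n i w) = (\<Sum>i=1..m. order_stat Y n i w) + (\<Sum>i\<in>{m+1..m'}. order_stat Y n i w)"
            using mm by (subst sum.union_disjoint[symmetric]) (auto intro!: sum.cong)
          then have "block_sum K n w = (\<Sum>i\<in>{m+1..m'}. order_stat Y n i w)" unfolding block_sum_def m_def[symmetric] m'_def[symmetric] by simp
          also have "\<dots> > 0" using mm by (intro sum_pos os) auto
          finally show ?thesis .
        qed
        have ns: "normalized_share Y p K n w k = block_sum k n w / block_sum K n w"
        proof -
          define T where "T = (\<Sum>i=1..n. order_stat Y n i w)"
          have "T > 0" unfolding T_def by fact
          have "normalized_share Y p K n w k = (block_sum k n w / T) / (block_sum K n w / T)"
            unfolding normalized_share_def top_share_def block_sum_def T_def diff_divide_distrib ..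
          then show ?thesis using \<open>T > 0\<close> by simp
        qed
        define s where "s = sqrt (real n)"
        have s: "s > 0" "s * s = real n" unfolding s_def using elim by auto
        define a where "a = slab_sum k n w + block_error k n w"
        define b where "b = slab_sum K n w + block_error K n w"
        have Dk: "block_sum k n w = real n * block_mean k + s * a" and DK': "block_sum K n w = real n * block_mean K + s * b"
          unfolding a_def b_def block_error_def s_def[symmetric] using s(1) by (simp_all add: field_simps)
        have Qb: "Q n w = b / s" unfolding Q_def b_def s_def[symmetric] by (simp add: add_divide_distrib)
        have DKQ: "block_sum K n w = s * s * (block_mean K + Q n w)" unfolding DK' Qb s(2)[symmetric] using s(1) by (simp add: field_simps)
        have nz: "block_mean K + Q n w \<noteq> 0" using DK unfolding DKQ by auto
        have "L n w = (1 / block_mean K) * E n w"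
        proof -
          have "block_sum k n w - r * block_sum K n w = s * (a - r * b)"
            unfolding Dk DK' r[symmetric] by (simp add: algebra_simps)
          moreover have "s * (block_sum k n w / block_sum K n w - r) = s * (block_sum k n w - r * block_sum K n w) / block_sum K n w"
            using DK by (simp add: right_diff_distrib diff_divide_distrib)
          ultimately have "s * (block_sum k n w / block_sum K n w - r) = s * (s * (a - r * b)) / block_sum K n w" by simp
          also have "\<dots> = (a - r * b) / (block_mean K + Q n w)" unfolding DKQ using s(1) nz by simp
          also have "\<dots> = (1 / block_mean K) * ((q n w + 1) * (a - r * b))" unfolding q_def using \<mu> by simp
          finally have "s * (block_sum k n w / block_sum K n w - r) = (1 / block_mean K) * ((q n w + 1) * (a - r * b))" .
          then have "L n w = (1 / block_mean K) * ((q n w + 1) * (a - r * b) - (slab_sum k n w - r * slab_sum K n w))"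
            unfolding L_def ns s_def by (simp add: right_diff_distrib diff_divide_distrib)
          also have "(q n w + 1) * (a - r * b) - (slab_sum k n w - r * slab_sum K n w) = E n w"
            unfolding E_def a_def b_def by (simp add: algebra_simps)
          finally show ?thesis .
        qed
        then show "min 1 \<bar>L n w\<bar> \<le> 1 * min 1 \<bar>(1 / block_mean K) * E n w\<bar>" by simp
      qed
    qed
  qed
  then show ?thesis unfolding L_def r_def .
qed

lemma slab_sum_slab_comb: "(\<Sum>k=1..K. z k * slab_sum k n w) = (\<Sum>j=1..n. slab_comb z (Y j w)) / sqrt (real n)"
proof -
  have "(\<Sum>j=1..n. slab_comb z (Y j w)) = (\<Sum>k=1..K. z k * (\<Sum>j=1..n. centred_slab k (Y j w)))"
    unfolding slab_comb_def sum_distrib_left by (rule sum.swap)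
  then show ?thesis by (simp only: slab_sum_def times_divide_eq_right sum_divide_distrib[symmetric])
qed

end

section \<open>The variance matrix and the limit theorem\<close>

lemma pos_less: "i < j \<Longrightarrow> pos i < pos j"
  unfolding pos_def by (intro psubset_card_mono) (auto dest: order.strict_trans2)

lemma pos_bij: "bij_betw (pos :: 'n::{finite,linorder} \<Rightarrow> nat) UNIV {1..CARD('n)}"
proof -
  have inj: "inj (pos :: 'n \<Rightarrow> nat)"
    by (rule injI) (metis linorder_less_linear less_irrefl pos_less)
  have "pos i \<in> {1..CARD('n)}" for i :: 'n
  proof -
    have "i \<in> {j. j \<le> i}" by simp
    then have "card {j. j \<le> i} > 0" by (subst card_gt_0_iff) auto
    moreover have "card {j. j \<le> i} \<le> CARD('n)" by (intro card_mono) auto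
    ultimately show ?thesis unfolding pos_def by simp
  qed
  then have "range (pos :: 'n \<Rightarrow> nat) \<subseteq> {1..CARD('n)}" by auto
  moreover have "card (range (pos :: 'n \<Rightarrow> nat)) = CARD('n)" using inj by (rule card_image)
  ultimately have "range (pos :: 'n \<Rightarrow> nat) = {1..CARD('n)}" by (intro card_subset_eq) auto
  with inj show ?thesis unfolding bij_betw_def by simp
qed

lemma pos_inj: "pos i = pos j \<longleftrightarrow> i = (j :: 'n::{finite,linorder})"
  using bij_betw_imp_inj_on[OF pos_bij[where 'n = 'n]] by (auto simp: inj_on_eq_iff)

lemma pos_range: "pos (i :: 'n::{finite,linorder}) \<in> {1..CARD('n)}"
  using pos_bij bij_betwE by blast

lemma pos_surj: "k \<in> {1..CARD('n)} \<Longrightarrow> \<exists>i :: 'n::{finite,linorder}. pos i = k"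
  using pos_bij[where 'n = 'n] unfolding bij_betw_def by (metis imageE)

lemma sum_pos_reindex: "(\<Sum>i\<in>UNIV. f (pos (i :: 'n::{finite,linorder}))) = (\<Sum>k=1..CARD('n). f k)"
  using sum.reindex_bij_betw[OF pos_bij] .

lemma mu_scale: "mu \<alpha> b p q = b * mu \<alpha> 1 p q"
  unfolding mu_def by (simp add: Let_def)

lemma mean_ratio_scale: "b \<noteq> 0 \<Longrightarrow> mean_ratio \<alpha> b p K k = mean_ratio \<alpha> 1 p K k"
  unfolding mean_ratio_def mu_scale[of \<alpha> b] by simp

lemma H_mat_scale: "b \<noteq> 0 \<Longrightarrow> H_mat \<alpha> b p K = (1 / b) *\<^sub>R H_mat \<alpha> 1 p K"
proof -
  assume b: "b \<noteq> 0"
  have e: "mean_ratio \<alpha> b p K = mean_ratio \<alpha> 1 p K" by (rule ext) (rule mean_ratio_scale[OF b])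
  show ?thesis unfolding H_mat_def mu_scale[of \<alpha> b] e by simp
qed

lemma sigma2_scale: "sigma2 \<alpha> b p q = b\<^sup>2 * sigma2 \<alpha> 1 p q"
proof -
  have "2 * b\<^sup>2 * x / y * w = b\<^sup>2 * (2 * 1\<^sup>2 * x / y * w)" for x y w :: real by simp
  then show ?thesis unfolding sigma2_def Let_def .
qed

lemma sigma_offdiag_scale: "sigma_offdiag \<alpha> b p j k = b\<^sup>2 * sigma_offdiag \<alpha> 1 p j k"
  unfolding sigma_offdiag_def Let_def by simp

lemma Sigma_mat_scale: "Sigma_mat \<alpha> b p = b\<^sup>2 *\<^sub>R Sigma_mat \<alpha> 1 p"
  unfolding Sigma_mat_def mat_of_def
  by (simp add: vec_eq_iff sigma2_scale[of \<alpha> b] sigma_offdiag_scale[of \<alpha> b])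

text \<open>
  Block means are of degree 1 and the entries of \<open>Sigma_mat\<close> of degree 2 in the minimum size.
\<close>
lemma Omega_scale:
  assumes "b \<noteq> 0"
  shows "(H_mat \<alpha> b p K :: real ^ 'k::{finite,linorder} ^ 'm::{finite,linorder}) ** Sigma_mat \<alpha> b p ** transpose (H_mat \<alpha> b p K :: real ^ 'k::{finite,linorder} ^ 'm::{finite,linorder})
    = (H_mat \<alpha> 1 p K :: real ^ 'k::{finite,linorder} ^ 'm::{finite,linorder}) ** Sigma_mat \<alpha> 1 p ** transpose (H_mat \<alpha> 1 p K :: real ^ 'k::{finite,linorder} ^ 'm::{finite,linorder})"
proof -
  have sL: "(a *\<^sub>R A) ** B = a *\<^sub>R (A ** B)" for a :: real and A :: "real^'x^'y" and B :: "real^'z^'x"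
    by (simp add: matrix_matrix_mult_def vec_eq_iff sum_distrib_left mult.assoc)
  have sR: "A ** (a *\<^sub>R B) = a *\<^sub>R (A ** B)" for a :: real and A :: "real^'x^'y" and B :: "real^'z^'x"
    by (simp add: matrix_matrix_mult_def vec_eq_iff sum_distrib_left mult.left_commute)
  have sT: "transpose (a *\<^sub>R A) = a *\<^sub>R transpose A" for a :: real and A :: "real^'x^'y"
    by (simp add: transpose_def vec_eq_iff)
  show ?thesis
    unfolding H_mat_scale[OF assms] Sigma_mat_scale[of \<alpha> b] sL sR sT scaleR_scaleR
    using assms by (simp add: power2_eq_square)
qed

context top_shares
begin

lemma H_row:
  assumes m: "CARD('m::{finite,linorder}) = K - 1" and k: "CARD('k::{finite,linorder}) = K"
  shows "(\<Sum>j\<in>UNIV. (H_mat \<alpha> c p K :: real ^ 'k::{finite,linorder} ^ 'm::{finite,linorder}) $ i $ j * f (pos j)) = (f (pos i) - mean_ratio \<alpha> c p K (pos i) * f K) / block_mean K"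
proof -
  have i: "pos i \<in> {1..K - 1}" using pos_range[of i] unfolding m .
  define g where "g l = (if l = K then - mean_ratio \<alpha> c p K (pos i) else if pos i = l then 1 else 0) * f l" for l
  have "(\<Sum>j\<in>UNIV. (H_mat \<alpha> c p K :: real ^ 'k::{finite,linorder} ^ 'm::{finite,linorder}) $ i $ j * f (pos j)) = (\<Sum>j\<in>(UNIV::'k set). g (pos j)) / block_mean K"
    unfolding H_mat_def mat_of_def g_def by (simp add: sum_divide_distrib)
  also have "(\<Sum>j\<in>(UNIV::'k set). g (pos j)) = (\<Sum>l=1..K. g l)" using sum_pos_reindex[where 'n = 'k, of g] unfolding k .
  also have "\<dots> = (\<Sum>l=1..K. (if l = K then - mean_ratio \<alpha> c p K (pos i) * f K else 0) + (if l = pos i then f (pos i) else 0))"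
    unfolding g_def using i by (intro sum.cong) auto
  also have "\<dots> = f (pos i) - mean_ratio \<alpha> c p K (pos i) * f K"
  proof -
    have "pos i \<in> {1..K}" "K \<in> {1..K}" using i K by auto
    then show ?thesis unfolding sum.distrib by simp
  qed
  finally show ?thesis .
qed

text \<open>
  Everything is read off the weights \<open>z x\<close>, the entries of $H^\top x$ listed by position:
  \<open>x\<close> applied to the linearized shares is the slab sum with these weights, so its variance is
  both $x \cdot \Omega x$ and the second moment of a slab combination.
\<close>
lemma share_ratios_asymptotically_normal:
  fixes H :: "real ^ 'k::{finite,linorder} ^ 'm::{finite,linorder}" and \<Omega> :: "real ^ 'm::{finite,linorder} ^ 'm::{finite,linorder}"
  assumes m: "CARD('m) = K - 1" and k: "CARD('k) = K"
  defines "H \<equiv> H_mat \<alpha> c p K" and "\<Omega> \<equiv> H ** Sigma_mat \<alpha> c p ** transpose H"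
  shows "positive_definite \<Omega>"
    and "converges_in_distribution M (\<lambda>n w. sqrt (real n) *\<^sub>R (vec_of (normalized_share Y p K n w) - vec_of (mean_ratio \<alpha> c p K)))
      (multivariate_normal 0 \<Omega>)"
proof -
  \<comment> \<open>The library vector is indexed by a type, the weights by the positions 1, ..., K.\<close>
  define z where "z x l = (transpose H *v x) $ (inv_into UNIV pos l)" for x l
  have z_pos: "z x (pos j) = (transpose H *v x) $ j" for x j
    unfolding z_def using pos_bij[where 'n = 'k] by (simp add: bij_betw_def inv_into_f_f)
  have z_eq: "(transpose H *v x) $ j = (\<Sum>i\<in>UNIV. x $ i * H $ i $ j)" for x j
    unfolding matrix_vector_mult_def transpose_def by (simp add: mult.commute)
  have z_dual: "(\<Sum>l=1..K. z x l * f l) = (\<Sum>i\<in>UNIV. x $ i * ((f (pos i) - mean_ratio \<alpha> c p K (pos i) * f K) / block_mean K))" for x f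
  proof -
    have "(\<Sum>l=1..K. z x l * f l) = (\<Sum>j\<in>(UNIV::'k set). z x (pos j) * f (pos j))"
      using sum_pos_reindex[where 'n = 'k, of "\<lambda>l. z x l * f l"] unfolding k by simp
    also have "\<dots> = (\<Sum>j\<in>UNIV. \<Sum>i\<in>UNIV. x $ i * (H $ i $ j * f (pos j)))"
      unfolding z_pos z_eq sum_distrib_right by (simp only: mult.assoc)
    also have "\<dots> = (\<Sum>i\<in>UNIV. \<Sum>j\<in>UNIV. x $ i * (H $ i $ j * f (pos j)))" by (rule sum.swap)
    also have "\<dots> = (\<Sum>i\<in>UNIV. x $ i * ((f (pos i) - mean_ratio \<alpha> c p K (pos i) * f K) / block_mean K))"
      unfolding sum_distrib_left[symmetric] H_def H_row[OF m k] ..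
    finally show ?thesis .
  qed
  have quad: "x \<bullet> (\<Omega> *v x) = expectation (\<lambda>w. (slab_comb (z x) (Y 1 w))\<^sup>2)" for x
  proof -
    define v where "v = transpose H *v x"
    have "x \<bullet> (\<Omega> *v x) = x \<bullet> (H *v (Sigma_mat \<alpha> c p *v v))"
      unfolding \<Omega>_def v_def by (simp only: matrix_vector_mul_assoc matrix_mul_assoc)
    also have "\<dots> = v \<bullet> (Sigma_mat \<alpha> c p *v v)"
      unfolding v_def by (simp add: dot_lmul_matrix)
    also have "\<dots> = (\<Sum>j\<in>UNIV. \<Sum>l\<in>UNIV. v $ j * v $ l * slab_cov (pos j) (pos l))"
      unfolding inner_vec_def matrix_vector_mult_def Sigma_mat_def mat_of_def slab_cov_def
      by (simp add: sum_distrib_left mult_ac)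
    also have "\<dots> = (\<Sum>j\<in>(UNIV::'k set). \<Sum>l\<in>(UNIV::'k set). z x (pos j) * z x (pos l) * slab_cov (pos j) (pos l))"
      unfolding z_pos v_def ..
    also have "\<dots> = (\<Sum>j\<in>(UNIV::'k set). \<Sum>l=1..K. z x (pos j) * z x l * slab_cov (pos j) l)"
      using sum_pos_reindex[where 'n = 'k] unfolding k by (intro sum.cong refl)
    also have "\<dots> = (\<Sum>j=1..K. \<Sum>l=1..K. z x j * z x l * slab_cov j l)"
      using sum_pos_reindex[where 'n = 'k, of "\<lambda>j. \<Sum>l=1..K. z x j * z x l * slab_cov j l"] unfolding k .
    finally show ?thesis unfolding slab_comb_second_moment .
  qed
  have z_nonzero: "\<exists>l\<in>{1..K}. z x l \<noteq> 0" if x: "x \<noteq> 0" for x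
  proof -
    obtain i where i: "x $ i \<noteq> 0" using x by (auto simp: vec_eq_iff)
    have pi: "pos i \<in> {1..K - 1}" using pos_range[of i] unfolding m .
    then have "pos i \<in> {1..CARD('k)}" unfolding k by auto
    then obtain j :: 'k where j: "pos j = pos i" using pos_surj by blast
    have Hij: "H $ i' $ j = (if i' = i then 1 / block_mean K else 0)" for i'
      unfolding H_def H_mat_def mat_of_def using pi K by (auto simp: j pos_inj)
    have "z x (pos j) = x $ i / block_mean K" unfolding z_pos z_eq Hij by (simp add: if_distrib cong: if_cong)
    then have "z x (pos i) \<noteq> 0" using i block_mean_pos[of K] K unfolding j by simp
    then show ?thesis using pi by (intro bexI[of _ "pos i"]) auto
  qed
  have pd: "x \<bullet> (\<Omega> *v x) > 0" if "x \<noteq> 0" for x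
    using z_nonzero[OF that] slab_comb_nondegenerate unfolding quad by blast
  have S_transpose: "transpose (Sigma_mat \<alpha> c p) = (Sigma_mat \<alpha> c p :: real ^ 'k::{finite,linorder} ^ 'k::{finite,linorder})"
    using slab_cov_sym unfolding Sigma_mat_def mat_of_def transpose_def slab_cov_def by (simp add: vec_eq_iff)
  have "transpose \<Omega> = \<Omega>"
    unfolding \<Omega>_def by (simp add: matrix_transpose_mul S_transpose matrix_mul_assoc)
  with pd show PD: "positive_definite \<Omega>" unfolding positive_definite_def by blast
  define Z where "Z n w = sqrt (real n) *\<^sub>R (vec_of (normalized_share Y p K n w) - vec_of (mean_ratio \<alpha> c p K) :: real ^ 'm::{finite,linorder})" for n w
  have Z_nth: "Z n w $ i = sqrt (real n) * (normalized_share Y p K n w (pos i) - mean_ratio \<alpha> c p K (pos i))" for n w i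
    unfolding Z_def vec_of_def by simp
  have pi: "pos i \<in> {1..<K}" for i :: 'm using pos_range[of i] K unfolding m by auto
  have Zm: "Z n \<in> borel_measurable M" for n
  proof (rule borel_measurable_euclidean_space[THEN iffD2], rule ballI)
    fix b :: "real ^ 'm::{finite,linorder}" assume "b \<in> Basis"
    then obtain i where b: "b = axis i 1" by (auto simp: Basis_vec_def)
    have "(\<lambda>w. normalized_share Y p K n w (pos i)) \<in> borel_measurable M"
      using pi[of i] by (intro normalized_share_measurable) auto
    then show "(\<lambda>w. Z n w \<bullet> b) \<in> borel_measurable M" unfolding b by (simp add: inner_axis Z_nth)
  qed
  have "converges_in_distribution M Z (multivariate_normal 0 \<Omega>)"
  proof (rule multivariate_levy_continuity[OF prob_space_axioms Zm multivariate_normal_prob_space[OF PD]])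
    show "sets (multivariate_normal 0 \<Omega>) = sets borel" unfolding multivariate_normal_def by simp
    fix x :: "real ^ 'm::{finite,linorder}" and b :: real
    define B where "B n w = (\<Sum>l=1..K. z x l * slab_sum l n w)" for n w
    have "vanishing M (\<lambda>n w. \<Sum>i\<in>UNIV. x $ i * (Z n w $ i - (slab_sum (pos i) n w - mean_ratio \<alpha> c p K (pos i) * slab_sum K n w) / block_mean K))"
      unfolding Z_nth using pi by (intro vanishing_sum vanishing_cmult share_linearization) auto
    moreover have "(\<Sum>i\<in>UNIV. x $ i * (Z n w $ i - (slab_sum (pos i) n w - mean_ratio \<alpha> c p K (pos i) * slab_sum K n w) / block_mean K)) = x \<bullet> Z n w - B n w" for n w
      unfolding B_def z_dual by (simp add: inner_vec_def right_diff_distrib sum_subtractf)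
    ultimately have van: "vanishing M (\<lambda>n w. x \<bullet> Z n w - B n w)" by simp
    have lim: "(\<lambda>n. expectation (\<lambda>w. cos (B n w + b))) \<longlonglongrightarrow> cos b * exp (- (x \<bullet> (\<Omega> *v x)) / 2)"
    proof (cases "x = 0")
      case True
      have "z x = (\<lambda>l. 0)" unfolding z_def True by simp
      then have "B = (\<lambda>n w. 0)" unfolding B_def by simp
      then show ?thesis using True by (simp add: prob_space)
    next
      case False
      show ?thesis
        unfolding B_def slab_sum_slab_comb quad
        using slab_comb_nondegenerate z_nonzero[OF False]
        by (intro clt_cos[OF slab_comb_measurable slab_comb_bounded slab_comb_mean]) blast
    qed
    show "(\<lambda>n. expectation (\<lambda>w. cos (x \<bullet> Z n w + b))) \<longlonglongrightarrow> (\<integral>y. cos (x \<bullet> y + b) \<partial>multivariate_normal 0 \<Omega>)"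
      unfolding multivariate_normal_cos[OF PD]
    proof (rule vanishing_cos[OF _ _ van lim])
      show "(\<lambda>w. x \<bullet> Z n w) \<in> borel_measurable M" for n using Zm[of n] by measurable
      show "B n \<in> borel_measurable M" for n unfolding B_def by measurable
    qed
  qed
  then show "converges_in_distribution M (\<lambda>n w. sqrt (real n) *\<^sub>R (vec_of (normalized_share Y p K n w) - vec_of (mean_ratio \<alpha> c p K)))
      (multivariate_normal 0 \<Omega>)" unfolding Z_def .
qed

end

theorem proposition3p1:
  fixes M :: "'a measure" and Y :: "nat \<Rightarrow> 'a \<Rightarrow> real"
    and K :: nat and p :: "nat \<Rightarrow> real" and \<alpha> c :: real
  assumes "K \<ge> 2"
    and "CARD('m::{finite,linorder}) = K - 1" and "CARD('k::{finite,linorder}) = K"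
    and "0 < p 1" and "\<And>k. k \<in> {1..K} \<Longrightarrow> p k < p (k + 1)" and "p (K + 1) \<le> 1"
    and "\<alpha> > 1" and "c > 0"
    and "prob_space M"
    and "prob_space.indep_vars M (\<lambda>_. borel) Y {1..}"
    and "\<And>i. i \<ge> 1 \<Longrightarrow> pareto_distributed M \<alpha> c (Y i)"
  shows "let H = (\<lambda>b. H_mat \<alpha> b p K :: real ^ 'k::{finite,linorder} ^ 'm::{finite,linorder});
             \<Sigma> = (\<lambda>b. Sigma_mat \<alpha> b p :: real ^ 'k::{finite,linorder} ^ 'k::{finite,linorder});
             \<Omega> = (\<lambda>b. H b ** \<Sigma> b ** transpose (H b));
             r = vec_of (mean_ratio \<alpha> c p K);
             s = (\<lambda>n \<omega>. vec_of (normalized_share Y p K n \<omega>))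
         in converges_in_distribution M (\<lambda>n \<omega>. sqrt (real n) *\<^sub>R (s n \<omega> - r))
              (multivariate_normal 0 (\<Omega> c))
            \<and> (\<forall>b>0. \<Omega> b = \<Omega> c)
            \<and> positive_definite (\<Omega> c)"
proof -
  have "pareto_sample M Y \<alpha> c"
    unfolding pareto_sample_def pareto_sample_axioms_def by (intro conjI allI impI assms(7-11))
  then have "top_shares M Y \<alpha> c K p"
    unfolding top_shares_def top_shares_axioms_def by (intro conjI allI impI assms(1,4-6))
  then interpret top_shares M Y \<alpha> c K p .
  have "(H_mat \<alpha> b p K :: real ^ 'k::{finite,linorder} ^ 'm::{finite,linorder}) ** Sigma_mat \<alpha> b p ** transpose (H_mat \<alpha> b p K :: real ^ 'k::{finite,linorder} ^ 'm::{finite,linorder})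
    = (H_mat \<alpha> c p K :: real ^ 'k::{finite,linorder} ^ 'm::{finite,linorder}) ** Sigma_mat \<alpha> c p ** transpose (H_mat \<alpha> c p K :: real ^ 'k::{finite,linorder} ^ 'm::{finite,linorder})" if "b > 0" for b
    by (rule trans[OF Omega_scale Omega_scale[symmetric]]) (use that \<open>c > 0\<close> in simp_all)
  then show ?thesis
    unfolding Let_def
    by (intro conjI allI impI share_ratios_asymptotically_normal[OF assms(2,3)])
qed

end
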